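(* Suppose the Main Assumption (see context) is satisfied and $\mathcal R$ is not hyperfinite. Then the action of $\mathcal R$ on the limit set $\mathcal L$ is minimal in the following sense: if $C\subset\mathcal L$ is Borel and (i) $C_x:=C\cap\mathcal L_x$ is closed for a.e. $x$, (ii) $\alpha(x,y)C_y=C_x$ for a.e. $(x,y)\in\mathcal R$, (iii) $C_x\neq\emptyset$ for a.e. $x$, then $\mathcal L_x\subset C_x$ for a.e. $x$.
   Context: Equivalence relations. $(X,\mu)$ is a standard probability space. A Borel equivalence relation $\mathcal R\subset X\times X$ is discrete if every class $[x]_{\mathcal R}$ is countable. $\mu$ is $\mathcal R$-invariant if $\phi_*\mu=\mu$ for every Borel isomorphism $\phi:X\to X$ with graph contained in $\mathcal R$; then $\mathcal R$ carries the measure $\hat\mu(F)=\int|\{y:(x,y)\in F\}|\,d\mu(x)$, and "a.e. $(x,y)\in\mathcal R$" refers to $\hat\mu$. $\mathcal R$ is ergodic if every Borel union $Y$ of $\mathcal R$-classes has $\mu(Y)\in\{0,1\}$. $\mathcal R$ is hyperfinite if (up to null sets) there are Borel subequivalence relations $\mathcal R_1\le\mathcal R_2\le\cdots$ with all $\mathcal R_n$-classes finite and $\mathcal R=\bigcup_n\mathcal R_n$. Hyperbolic spaces. In a metric space $(H,d)$ put $(x|y)_z=\frac12(d(x,z)+d(y,z)-d(x,y))$. $H$ is $\delta$-hyperbolic if $(x|y)_z\ge\min\{(x|w)_z,(w|y)_z\}-\delta$ for all $x,y,z,w$; Gromov hyperbolic means $\delta$-hyperbolic for some $\delta$. $\partial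 H$ is the Gromov boundary, $\overline H=H\cup\partial H$ the Gromov completion with its usual topology; Gromov products extend to $\overline H$ by taking the infimum over representing sequences of the lower limits. Bundles and actions. A Borel bundle over $X$ is a standard Borel space $B$ with a Borel surjection $\pi:B\to X$; fibers $B_x=\pi^{-1}(x)$, $B*B=\{(y,z):\pi(y)=\pi(z)\}$. A metric bundle also has a Borel map $d:B*B\to[0,\infty)$ restricting to a metric on each $B_x$. A section is a map $\sigma:X\to B$ with $\sigma(x)\in B_x$. The bundle is separable if there are countably many Borel sections $\sigma_i$ with $\{\sigma_i(x)\}_i$ dense in $B_x$ for every $x$. A bundle of hyperbolic spaces is a metric bundle $\pi:\mathcal H\to X$ whose fibers are geodesic Gromov hyperbolic spaces. An isometric action of $\mathcal R$ on $\mathcal H$ is a family of isometries $\alpha(x,y):\mathcal H_y\to\mathcal H_x$, $(x,y)\in\mathcal R$, with $\alpha(x,y)\alpha(y,z)=\alpha(x,z)$ and $\{(p,q)\in\mathcal H\times\mathcal H:\alpha(\pi(p),\pi(q))(q)=p\}$ Borel. Each $\alpha(x,y)$ extends uniquely to a homeomorphism $\overline{\mathcal H}_y\to\overline{\mathcal H}_x$, also denoted $\alpha(x,y)$. $\overline{\mathcal H}=\bigsqcup_x\overline{\mathcal H}_x$ has the smallest Borel structure making $\{\xi\in\overline{\mathcal H}:(\xi|\sigma(x))_{\eta(x)}\in B \text{ where } x=\pi(\xi)\}$ Borel for all Borel sections $\sigma,\eta:X\to\mathcal H$ and Borel $B\subset[0,\infty)$. Orbits and limit sets. For a section $\sigma$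 of $\mathcal H$, let $\sigma_x(y)=\alpha(x,y)\sigma(y)$ for $y\in[x]_{\mathcal R}$, and $\mathcal O^\sigma_x=\sigma_x([x]_{\mathcal R})$. $\sigma$ is metrically proper if for a.e. $x$ and every metric ball $\mathcal B\subset\mathcal H_x$, only finitely many $y\in[x]_{\mathcal R}$ have $\sigma_x(y)\in\mathcal B$. Main Assumption: $(X,\mu)$ is a standard non-atomic probability space, $\mathcal R\subset X\times X$ is a discrete Borel equivalence relation, $\mu$ is $\mathcal R$-invariant and ergodic, $\pi:\mathcal H\to X$ is a separable bundle of hyperbolic spaces with an isometric action $\alpha$ of $\mathcal R$, and $\sigma:X\to\mathcal H$ is a metrically proper Borel section such that the closure $\overline{\mathcal O^\sigma_x}$ is compact in $\overline{\mathcal H}_x$ for a.e. $x$. The limit set is $\mathcal L_x=\overline{\mathcal O^\sigma_x}\cap\partial\mathcal H_x$ (up to null sets it does not depend on the choice of such $\sigma$), and $\mathcal L=\bigsqcup_x\mathcal L_x$. *)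

theory Defs
  imports "HOL-Probability.Probability"
begin

section \<open>Measured equivalence relations\<close>

text \<open>Only \<^term>\<open>space M\<close> and \<^term>\<open>sets M\<close> matter here.\<close>
definition standard_borel :: "'a measure \<Rightarrow> bool" where
  "standard_borel M \<longleftrightarrow>
     (\<exists>T. completely_metrizable_space T \<and> separable_space T \<and> topspace T = space M
        \<and> sets M = sigma_sets (space M) {U. openin T U})"

definition non_atomic :: "'a measure \<Rightarrow> bool" where
  "non_atomic M \<longleftrightarrow>
     \<not> (\<exists>A\<in>sets M. emeasure M A > 0 \<and>
          (\<forall>B\<in>sets M. B \<subseteq> A \<longrightarrow> emeasure M B = 0 \<or> emeasure M B = emeasure M A))"

definition borel_isomorphism :: "'a measure \<Rightarrow> 'b measure \<Rightarrow> ('a \<Rightarrow> 'b) \<Rightarrow> bool" where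
  "borel_isomorphism M N \<phi> \<longleftrightarrow>
     bij_betw \<phi> (space M) (space N) \<and> \<phi> \<in> measurable M N \<and>
     the_inv_into (space M) \<phi> \<in> measurable N M"

definition borel_equivalence_relation :: "'a measure \<Rightarrow> ('a \<times> 'a) set \<Rightarrow> bool" where
  "borel_equivalence_relation M R \<longleftrightarrow> equiv (space M) R \<and> R \<in> sets (M \<Otimes>\<^sub>M M)"

definition discrete_relation :: "'a measure \<Rightarrow> ('a \<times> 'a) set \<Rightarrow> bool" where
  "discrete_relation M R \<longleftrightarrow> (\<forall>x\<in>space M. countable (R `` {x}))"

definition invariant_measure :: "'a measure \<Rightarrow> ('a \<times> 'a) set \<Rightarrow> bool" where
  "invariant_measure M R \<longleftrightarrow>
     (\<forall>\<phi>. borel_isomorphism M M \<phi> \<and> (\<forall>x\<in>space M. (x, \<phi> x) \<in> R) \<longrightarrow> distr M M \<phi> = M)"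

definition ergodic_relation :: "'a measure \<Rightarrow> ('a \<times> 'a) set \<Rightarrow> bool" where
  "ergodic_relation M R \<longleftrightarrow>
     (\<forall>Y\<in>sets M. R `` Y = Y \<longrightarrow> measure M Y = 0 \<or> measure M Y = 1)"

text \<open>``Up to null sets'': the exhaustion is required for the restriction of \<open>R\<close> to a conull
  Borel set \<open>X\<^sub>0\<close>.\<close>
definition hyperfinite :: "'a measure \<Rightarrow> ('a \<times> 'a) set \<Rightarrow> bool" where
  "hyperfinite M R \<longleftrightarrow>
     (\<exists>X\<^sub>0\<in>sets M. (AE x in M. x \<in> X\<^sub>0) \<and>
       (\<exists>S :: nat \<Rightarrow> ('a \<times> 'a) set.
          (\<forall>n. equiv X\<^sub>0 (S n) \<and> S n \<in> sets (M \<Otimes>\<^sub>M M) \<and> (\<forall>x\<in>X\<^sub>0. finite (S n `` {x}))) \<and>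
          (\<forall>n. S n \<subseteq> S (Suc n)) \<and>
          R \<inter> (X\<^sub>0 \<times> X\<^sub>0) = (\<Union>n. S n)))"

text \<open>The measure \<open>F \<mapsto> \<integral> |F\<^sub>x| d\<mu>(x)\<close> on \<open>R\<close>.\<close>
definition relation_measure :: "'a measure \<Rightarrow> ('a \<times> 'a) set \<Rightarrow> ('a \<times> 'a) measure" where
  "relation_measure M R =
     measure_of R {F \<in> sets (M \<Otimes>\<^sub>M M). F \<subseteq> R}
       (\<lambda>F. \<integral>\<^sup>+ x. emeasure (count_space UNIV) (F `` {x}) \<partial>M)"

section \<open>Gromov hyperbolic spaces and their completions\<close>

text \<open>\<open>gromov_product m z x y\<close> is \<open>(x|y)\<^sub>z\<close>.\<close>
definition gromov_product :: "'h metric \<Rightarrow> 'h \<Rightarrow> 'h \<Rightarrow> 'h \<Rightarrow> real" where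
  "gromov_product m z x y = (mdist m x z + mdist m y z - mdist m x y) / 2"

definition gromov_hyperbolic :: "'h metric \<Rightarrow> bool" where
  "gromov_hyperbolic m \<longleftrightarrow>
     (\<exists>\<delta>. \<forall>x\<in>mspace m. \<forall>y\<in>mspace m. \<forall>z\<in>mspace m. \<forall>w\<in>mspace m.
        gromov_product m z x y \<ge> min (gromov_product m z x w) (gromov_product m z w y) - \<delta>)"

definition geodesic_metric :: "'h metric \<Rightarrow> bool" where
  "geodesic_metric m \<longleftrightarrow>
     (\<forall>x\<in>mspace m. \<forall>y\<in>mspace m. \<exists>\<gamma> :: real \<Rightarrow> 'h.
        \<gamma> ` {0..mdist m x y} \<subseteq> mspace m \<and> \<gamma> 0 = x \<and> \<gamma> (mdist m x y) = y \<and>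
        (\<forall>s\<in>{0..mdist m x y}. \<forall>t\<in>{0..mdist m x y}. mdist m (\<gamma> s) (\<gamma> t) = \<bar>s - t\<bar>))"

text \<open>Sequences \<open>s\<close>, \<open>t\<close> with \<open>(s\<^sub>i|t\<^sub>j)\<^sub>z \<rightarrow> \<infinity>\<close> as \<open>i, j \<rightarrow> \<infinity>\<close>;
  this does not depend on the base point \<open>z\<close>.\<close>
definition gromov_asymptotic :: "'h metric \<Rightarrow> (nat \<Rightarrow> 'h) \<Rightarrow> (nat \<Rightarrow> 'h) \<Rightarrow> bool" where
  "gromov_asymptotic m s t \<longleftrightarrow>
     (\<forall>z\<in>mspace m. filterlim (\<lambda>(i, j). gromov_product m z (s i) (t j)) at_top
        (sequentially \<times>\<^sub>F sequentially))"

definition gromov_sequences :: "'h metric \<Rightarrow> (nat \<Rightarrow> 'h) set" where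
  "gromov_sequences m = {s. range s \<subseteq> mspace m \<and> gromov_asymptotic m s s}"

definition gromov_boundary :: "'h metric \<Rightarrow> (nat \<Rightarrow> 'h) set set" where
  "gromov_boundary m =
     gromov_sequences m //
       {(s, t). s \<in> gromov_sequences m \<and> t \<in> gromov_sequences m \<and> gromov_asymptotic m s t}"

text \<open>Points of the completion: \<open>Inl p\<close> is a point of the space, \<open>Inr c\<close> a boundary point.\<close>
type_synonym 'h gpoint = "'h + (nat \<Rightarrow> 'h) set"

definition gromov_completion :: "'h metric \<Rightarrow> 'h gpoint set" where
  "gromov_completion m = Inl ` mspace m \<union> Inr ` gromov_boundary m"

fun representing_sequences :: "'h metric \<Rightarrow> 'h gpoint \<Rightarrow> (nat \<Rightarrow> 'h) set" where
  "representing_sequences m (Inl p) =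
     {s. range s \<subseteq> mspace m \<and> limitin (mtopology_of m) s p sequentially}"
| "representing_sequences m (Inr c) = c"

definition gromov_product_ext :: "'h metric \<Rightarrow> 'h \<Rightarrow> 'h gpoint \<Rightarrow> 'h gpoint \<Rightarrow> ereal" where
  "gromov_product_ext m z \<xi> \<eta> =
     (INF (s, t) \<in> representing_sequences m \<xi> \<times> representing_sequences m \<eta>.
        Liminf (sequentially \<times>\<^sub>F sequentially) (\<lambda>(i, j). ereal (gromov_product m z (s i) (t j))))"

text \<open>The usual topology of the completion, for spaces that need not be proper: the space itself is
  open with its metric topology, and the sets \<open>{\<eta>. (\<xi>|\<eta>)\<^sub>z > r}\<close> are a
  neighbourhood base at a boundary point \<open>\<xi>\<close>. The choice of \<open>z\<close> is immaterial.\<close>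
definition gromov_open :: "'h metric \<Rightarrow> 'h gpoint set \<Rightarrow> bool" where
  "gromov_open m U \<longleftrightarrow>
     U \<subseteq> gromov_completion m \<and>
     openin (mtopology_of m) {p. Inl p \<in> U} \<and>
     (\<forall>c. Inr c \<in> U \<longrightarrow> (\<forall>z\<in>mspace m. \<exists>r::real.
        {\<eta> \<in> gromov_completion m. gromov_product_ext m z (Inr c) \<eta> > ereal r} \<subseteq> U))"

definition gromov_topology :: "'h metric \<Rightarrow> 'h gpoint topology" where
  "gromov_topology m = topology (gromov_open m)"

lemma istopology_gromov_open: "istopology (gromov_open m)"
proof -
  define N where "N z c r = {\<eta> \<in> gromov_completion m. gromov_product_ext m z (Inr c) \<eta> > ereal r}"
    for z c and r :: real
  have N_mono: "N z c s \<subseteq> N z c r" if "r \<le> s" for z c r s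
    using that unfolding N_def by (auto intro: le_less_trans[of "ereal r" "ereal s"])
  have open_iff: "gromov_open m U \<longleftrightarrow> U \<subseteq> gromov_completion m \<and>
      openin (mtopology_of m) (Inl -` U) \<and>
      (\<forall>c. Inr c \<in> U \<longrightarrow> (\<forall>z\<in>mspace m. \<exists>r. N z c r \<subseteq> U))" for U
    by (simp add: gromov_open_def N_def vimage_def)
  have "gromov_open m (S \<inter> T)" if S: "gromov_open m S" and T: "gromov_open m T" for S T
    unfolding open_iff
  proof (intro conjI allI impI ballI)
    show "S \<inter> T \<subseteq> gromov_completion m"
      using S by (auto simp: open_iff)
    show "openin (mtopology_of m) (Inl -` (S \<inter> T))"
      using S T by (simp add: open_iff vimage_Int openin_Int)
    fix c z assume c: "Inr c \<in> S \<inter> T" and z: "z \<in> mspace m"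
    from S c z obtain a where "N z c a \<subseteq> S"
      unfolding open_iff by (metis IntD1)
    moreover from T c z obtain b where "N z c b \<subseteq> T"
      unfolding open_iff by (metis IntD2)
    ultimately have "N z c (max a b) \<subseteq> S \<inter> T"
      using N_mono[of a "max a b" z c] N_mono[of b "max a b" z c]
      by (meson Int_greatest max.cobounded1 max.cobounded2 subset_trans)
    then show "\<exists>r. N z c r \<subseteq> S \<inter> T" ..
  qed
  moreover have "gromov_open m (\<Union>K)" if K: "\<forall>S\<in>K. gromov_open m S" for K
    unfolding open_iff
  proof (intro conjI allI impI ballI)
    show "\<Union>K \<subseteq> gromov_completion m"
      using K by (simp add: open_iff Sup_le_iff)
    show "openin (mtopology_of m) (Inl -` \<Union>K)"
      unfolding vimage_Union using K by (intro openin_Union) (auto simp: open_iff)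
    fix c z assume c: "Inr c \<in> \<Union>K" and z: "z \<in> mspace m"
    then obtain S where S: "S \<in> K" "Inr c \<in> S" by (elim UnionE)
    with K z obtain r where "N z c r \<subseteq> S"
      unfolding open_iff by metis
    then have "N z c r \<subseteq> \<Union>K" using S(1) by (meson Union_upper subset_trans)
    then show "\<exists>r. N z c r \<subseteq> \<Union>K" ..
  qed
  ultimately show ?thesis
    by (simp add: istopology_def)
qed

lemma openin_gromov_topology: "openin (gromov_topology m) = gromov_open m"
  by (simp add: gromov_topology_def istopology_gromov_open topology_inverse')

definition isometry_between :: "'h metric \<Rightarrow> 'h metric \<Rightarrow> ('h \<Rightarrow> 'h) \<Rightarrow> bool" where
  "isometry_between m m' f \<longleftrightarrow>
     f ` mspace m = mspace m' \<and>
     (\<forall>p\<in>mspace m. \<forall>q\<in>mspace m. mdist m' (f p) (f q) = mdist m p q)"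

text \<open>The extension of a surjective isometry to the completions, \<open>[s] \<mapsto> [f \<circ> s]\<close> on the boundary;
  the image of a full equivalence class under \<open>s \<mapsto> f \<circ> s\<close> is again a full equivalence class.\<close>
definition extend_isometry :: "('h \<Rightarrow> 'h) \<Rightarrow> 'h gpoint \<Rightarrow> 'h gpoint" where
  "extend_isometry f = map_sum f (\<lambda>c. (\<lambda>s. f \<circ> s) ` c)"

section \<open>Bundles of hyperbolic spaces\<close>

definition borel_bundle :: "'x measure \<Rightarrow> 'h measure \<Rightarrow> ('h \<Rightarrow> 'x) \<Rightarrow> bool" where
  "borel_bundle M B \<pi> \<longleftrightarrow>
     standard_borel B \<and> \<pi> \<in> measurable B M \<and> \<pi> ` space B = space M"

text \<open>The fibrewise distance is given by a family of metrics \<open>H x\<close> carried by the fibres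
  \<open>\<pi>\<^sup>-\<^sup>1(x)\<close>; the corresponding map on \<open>B * B\<close> is \<open>(p, q) \<mapsto> mdist (H (\<pi> p)) p q\<close>.\<close>
definition metric_bundle ::
    "'x measure \<Rightarrow> 'h measure \<Rightarrow> ('h \<Rightarrow> 'x) \<Rightarrow> ('x \<Rightarrow> 'h metric) \<Rightarrow> bool" where
  "metric_bundle M B \<pi> H \<longleftrightarrow>
     borel_bundle M B \<pi> \<and>
     (\<forall>x\<in>space M. mspace (H x) = {p \<in> space B. \<pi> p = x}) \<and>
     (\<lambda>(p, q). mdist (H (\<pi> p)) p q) \<in>
       borel_measurable (restrict_space (B \<Otimes>\<^sub>M B) {(p, q). \<pi> p = \<pi> q})"

definition borel_section :: "'x measure \<Rightarrow> 'h measure \<Rightarrow> ('h \<Rightarrow> 'x) \<Rightarrow> ('x \<Rightarrow> 'h) \<Rightarrow> bool" where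
  "borel_section M B \<pi> \<sigma> \<longleftrightarrow> \<sigma> \<in> measurable M B \<and> (\<forall>x\<in>space M. \<pi> (\<sigma> x) = x)"

definition separable_bundle ::
    "'x measure \<Rightarrow> 'h measure \<Rightarrow> ('h \<Rightarrow> 'x) \<Rightarrow> ('x \<Rightarrow> 'h metric) \<Rightarrow> bool" where
  "separable_bundle M B \<pi> H \<longleftrightarrow>
     (\<exists>\<tau> :: nat \<Rightarrow> 'x \<Rightarrow> 'h. (\<forall>i. borel_section M B \<pi> (\<tau> i)) \<and>
        (\<forall>x\<in>space M. mtopology_of (H x) closure_of (range (\<lambda>i. \<tau> i x)) = mspace (H x)))"

definition hyperbolic_bundle ::
    "'x measure \<Rightarrow> 'h measure \<Rightarrow> ('h \<Rightarrow> 'x) \<Rightarrow> ('x \<Rightarrow> 'h metric) \<Rightarrow> bool" where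
  "hyperbolic_bundle M B \<pi> H \<longleftrightarrow>
     metric_bundle M B \<pi> H \<and>
     (\<forall>x\<in>space M. geodesic_metric (H x) \<and> gromov_hyperbolic (H x))"

definition isometric_action ::
    "('x \<times> 'x) set \<Rightarrow> 'h measure \<Rightarrow> ('h \<Rightarrow> 'x) \<Rightarrow> ('x \<Rightarrow> 'h metric) \<Rightarrow>
     ('x \<Rightarrow> 'x \<Rightarrow> 'h \<Rightarrow> 'h) \<Rightarrow> bool" where
  "isometric_action R B \<pi> H \<alpha> \<longleftrightarrow>
     (\<forall>(x, y)\<in>R. isometry_between (H y) (H x) (\<alpha> x y)) \<and>
     (\<forall>x y z. (x, y) \<in> R \<and> (y, z) \<in> R \<longrightarrow>
        (\<forall>p\<in>mspace (H z). \<alpha> x y (\<alpha> y z p) = \<alpha> x z p)) \<and>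
     {(p, q) \<in> space B \<times> space B. (\<pi> p, \<pi> q) \<in> R \<and> \<alpha> (\<pi> p) (\<pi> q) q = p} \<in> sets (B \<Otimes>\<^sub>M B)"

text \<open>The disjoint union of the fibrewise completions, as pairs \<open>(x, \<xi>)\<close>, with its Borel structure.
  For \<open>\<xi>\<close> in the completion and points \<open>p, z\<close> of the space, \<open>(\<xi>|p)\<^sub>z\<close> is a nonnegative real.\<close>
definition completion_bundle ::
    "'x measure \<Rightarrow> 'h measure \<Rightarrow> ('h \<Rightarrow> 'x) \<Rightarrow> ('x \<Rightarrow> 'h metric) \<Rightarrow> ('x \<times> 'h gpoint) measure" where
  "completion_bundle M B \<pi> H =
     sigma (SIGMA x:space M. gromov_completion (H x))
       {{(x, \<xi>). x \<in> space M \<and> \<xi> \<in> gromov_completion (H x) \<and>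
           gromov_product_ext (H x) (\<eta> x) \<xi> (Inl (\<sigma> x)) \<in> ereal ` A} | \<sigma> \<eta> A.
         borel_section M B \<pi> \<sigma> \<and> borel_section M B \<pi> \<eta> \<and> A \<in> sets borel \<and> A \<subseteq> {0..}}"

section \<open>Orbits and limit sets\<close>

definition orbit ::
    "('x \<times> 'x) set \<Rightarrow> ('x \<Rightarrow> 'x \<Rightarrow> 'h \<Rightarrow> 'h) \<Rightarrow> ('x \<Rightarrow> 'h) \<Rightarrow> 'x \<Rightarrow> 'h set" where
  "orbit R \<alpha> \<sigma> x = (\<lambda>y. \<alpha> x y (\<sigma> y)) ` (R `` {x})"

definition metrically_proper ::
    "'x measure \<Rightarrow> ('x \<times> 'x) set \<Rightarrow> ('x \<Rightarrow> 'h metric) \<Rightarrow> ('x \<Rightarrow> 'x \<Rightarrow> 'h \<Rightarrow> 'h) \<Rightarrow>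
     ('x \<Rightarrow> 'h) \<Rightarrow> bool" where
  "metrically_proper M R H \<alpha> \<sigma> \<longleftrightarrow>
     (AE x in M. \<forall>p\<in>mspace (H x). \<forall>r.
        finite {y \<in> R `` {x}. \<alpha> x y (\<sigma> y) \<in> mball_of (H x) p r})"

definition orbit_closure ::
    "('x \<times> 'x) set \<Rightarrow> ('x \<Rightarrow> 'h metric) \<Rightarrow> ('x \<Rightarrow> 'x \<Rightarrow> 'h \<Rightarrow> 'h) \<Rightarrow> ('x \<Rightarrow> 'h) \<Rightarrow>
     'x \<Rightarrow> 'h gpoint set" where
  "orbit_closure R H \<alpha> \<sigma> x = gromov_topology (H x) closure_of (Inl ` orbit R \<alpha> \<sigma> x)"

definition limit_set ::
    "('x \<times> 'x) set \<Rightarrow> ('x \<Rightarrow> 'h metric) \<Rightarrow> ('x \<Rightarrow> 'x \<Rightarrow> 'h \<Rightarrow> 'h) \<Rightarrow> ('x \<Rightarrow> 'h) \<Rightarrow>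
     'x \<Rightarrow> 'h gpoint set" where
  "limit_set R H \<alpha> \<sigma> x = orbit_closure R H \<alpha> \<sigma> x \<inter> Inr ` gromov_boundary (H x)"

definition main_assumption ::
    "'x measure \<Rightarrow> ('x \<times> 'x) set \<Rightarrow> 'h measure \<Rightarrow> ('h \<Rightarrow> 'x) \<Rightarrow> ('x \<Rightarrow> 'h metric) \<Rightarrow>
     ('x \<Rightarrow> 'x \<Rightarrow> 'h \<Rightarrow> 'h) \<Rightarrow> ('x \<Rightarrow> 'h) \<Rightarrow> bool" where
  "main_assumption M R B \<pi> H \<alpha> \<sigma> \<longleftrightarrow>
     prob_space M \<and> standard_borel M \<and> non_atomic M \<and>
     borel_equivalence_relation M R \<and> discrete_relation M R \<and>
     invariant_measure M R \<and> ergodic_relation M R \<and>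
     hyperbolic_bundle M B \<pi> H \<and> separable_bundle M B \<pi> H \<and>
     isometric_action R B \<pi> H \<alpha> \<and>
     borel_section M B \<pi> \<sigma> \<and> metrically_proper M R H \<alpha> \<sigma> \<and>
     (AE x in M. compactin (gromov_topology (H x)) (orbit_closure R H \<alpha> \<sigma> x))"

end

theory Submission
  imports Defs
begin

text \<open>
The proof is a mass transport argument. For an invariant probability measure, if every point sends
unit mass to one point of its class, then almost every point receives mass from finitely many points
only (\<open>finite_fibres\<close>, \<open>finite_selected\<close>). Distances between points of a class are measured between
the corresponding orbit points, and for a subset \<open>A\<close> of \<open>X\<close> of positive measure almost every class
meets \<open>A\<close>, by ergodicity.

Suppose first that \<open>C\<^sub>x\<close> contains two points for a non-null set of \<open>x\<close>. Then for some \<open>r\<close> the set \<open>A\<close>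
of all \<open>z\<close> such that \<open>(\<xi>|\<eta>) \<le> r\<close> at \<open>\<sigma>(z)\<close> for some \<open>\<xi>, \<eta> \<in> C\<^sub>z\<close> has positive measure. Its
orbit points lie near geodesics between points of \<open>C\<^sub>x\<close> and can accumulate only in the closed set
\<open>C\<^sub>x\<close>. Send each point of the class to a nearest point of \<open>A\<close>. If orbit points \<open>y\<^sub>n\<close> converge to a
limit point outside \<open>C\<^sub>x\<close>, their nearest points in \<open>A\<close> stay away from that limit point, hence the
geodesic joining \<open>y\<^sub>n\<close> to its nearest point passes near a fixed point of \<open>A\<close>, and minimality keeps the
nearest points in a bounded region. By properness one of them receives infinite mass, which happens
almost nowhere (\<open>minimal_if_near_geodesics\<close>, \<open>minimal_or_single_point\<close>).

There remains the case \<open>C\<^sub>x = {\<xi>\<^sub>x}\<close>, and here non-hyperfiniteness enters. If \<open>L\<^sub>x \<noteq> {\<xi>\<^sub>x}\<close> for a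
non-null set of \<open>x\<close>, there is \<open>r\<close> such that for a positive measure set of \<open>x\<close> infinitely many orbit
points \<open>y\<close> satisfy \<open>(y|\<xi>\<^sub>x) \<le> r\<close> at \<open>\<sigma>(x)\<close>: their rays to \<open>\<xi>\<^sub>x\<close> pass near \<open>\<sigma>(x)\<close>. Let \<open>A\<close> be a
subset of positive measure in which distinct points of a class are far apart. Sending each point to
the last point of \<open>A\<close> on its ray shows that the ray from almost every \<open>x \<in> A\<close> meets \<open>A\<close> infinitely
often (\<open>conical\<close>). Let \<open>f(y)\<close> be the first point of \<open>A\<close> near the ray from \<open>y\<close>. The \<open>f\<close>-orbit of \<open>y\<close> passes
exactly through every point of \<open>A\<close> that is near the ray in a slightly stricter sense, so the
\<open>f\<close>-orbits of any two equivalent points of \<open>A\<close> merge, and on \<open>A\<close> the relation is the tail equivalence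
relation of \<open>f\<close>. Such a relation is hyperfinite: cut the \<open>f\<close>-orbits at a vanishing sequence of markers;
the resulting classes are finite by mass transport (\<open>tail_relation_hyperfinite\<close>,
\<open>horospherical_hyperfinite\<close>). Rays are never used; being near the ray from \<open>y\<close> to \<open>\<xi>\<close> means that the
Gromov product of \<open>y\<close> and \<open>\<xi>\<close> is small.

Measurability is obtained up to null sets from one tool, \<open>measurable_projection\<close>: a measurable subset
of a product with a standard Borel space has a projection that is measurable for the completed
measure. It provides Borel functions enumerating the classes on an invariant conull Borel set
(\<open>enumeration\<close>, where properness writes the relation as a countable union of relations with finite
sections), the measurability of orbit points in the fibres (\<open>orbit_section\<close>), and that of sets defined
by the existence of a point of \<open>C\<^sub>x\<close> with prescribed Gromov products (\<open>boundary_projection\<close>).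
\<close>


section \<open>Measurable projections along sequences of natural numbers\<close>

definition baire :: "(nat \<Rightarrow> nat) measure" where
  "baire = (\<Pi>\<^sub>M i\<in>UNIV. count_space UNIV)"

lemma space_baire [simp]: "space baire = UNIV"
  by (simp add: baire_def space_PiM PiE_UNIV_domain)

lemma measurable_baire_coordinate [measurable]: "(\<lambda>z. z i) \<in> baire \<rightarrow>\<^sub>M count_space UNIV"
  unfolding baire_def by measurable

lemma measurable_into_baire:
  assumes "\<And>i. (\<lambda>x. f x i) \<in> N \<rightarrow>\<^sub>M count_space UNIV"
  shows "f \<in> N \<rightarrow>\<^sub>M baire"
  unfolding baire_def by (rule measurable_PiM_single') (auto simp: assms)

text \<open>A subset of \<open>M \<times> (nat \<Rightarrow> nat)\<close> that looks at finitely many coordinates of the sequence only. These sets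
replace rectangles with clopen sides in the Souslin representation of measurable sets.\<close>
definition finitary :: "'a measure \<Rightarrow> ('a \<times> (nat \<Rightarrow> nat)) set \<Rightarrow> bool" where
  "finitary M D \<longleftrightarrow> (\<forall>z. {x. (x, z) \<in> D} \<in> sets M) \<and>
     (\<exists>m. \<forall>z z'. (\<forall>i<m. z i = z' i) \<longrightarrow> {x. (x, z) \<in> D} = {x. (x, z') \<in> D})"

lemma finitaryI:
  assumes "\<And>z. {x. (x, z) \<in> D} \<in> sets M"
    and "\<And>z z'. (\<forall>i<m. z i = z' i) \<Longrightarrow> {x. (x, z) \<in> D} = {x. (x, z') \<in> D}"
  shows "finitary M D"
  using assms unfolding finitary_def by blast

lemma finitary_reindex:
  fixes \<phi> :: "nat \<Rightarrow> nat"
  assumes "finitary M D"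
  shows "finitary M {(x, z). (x, z \<circ> \<phi>) \<in> D}"
proof -
  obtain m where m: "\<And>z z'. (\<forall>i<m. z i = z' i) \<Longrightarrow> {x. (x, z) \<in> D} = {x. (x, z') \<in> D}"
    using assms unfolding finitary_def by blast
  show ?thesis
  proof (rule finitaryI)
    show "{x. (x, z) \<in> {(x, z). (x, z \<circ> \<phi>) \<in> D}} \<in> sets M" for z
      using assms by (simp add: finitary_def)
    fix z z' :: "nat \<Rightarrow> nat" assume eq: "\<forall>i<Suc (Max (\<phi> ` {..<m})). z i = z' i"
    have "\<forall>i<m. (z \<circ> \<phi>) i = (z' \<circ> \<phi>) i"
    proof (intro allI impI)
      fix i assume "i < m"
      then have "\<phi> i \<le> Max (\<phi> ` {..<m})" by (intro Max_ge) auto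
      then show "(z \<circ> \<phi>) i = (z' \<circ> \<phi>) i" using eq by auto
    qed
    from m[OF this] have "(x, z \<circ> \<phi>) \<in> D \<longleftrightarrow> (x, z' \<circ> \<phi>) \<in> D" for x by blast
    then show "{x. (x, z) \<in> {(x, z). (x, z \<circ> \<phi>) \<in> D}} = {x. (x, z') \<in> {(x, z). (x, z \<circ> \<phi>) \<in> D}}"
      by (simp only: mem_Collect_eq case_prod_conv)
  qed
qed

lemma finitary_coordinate:
  "finitary M {(x, z). x \<in> space M \<and> z i \<in> V}"
  by (rule finitaryI[where m = "Suc i"]) auto

lemma finitary_rectangle: "A \<in> sets M \<Longrightarrow> finitary M (A \<times> UNIV)"
  by (rule finitaryI[where m = 0]) auto

lemma finitary_Un:
  assumes "finitary M D" "finitary M D'"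
  shows "finitary M (D \<union> D')"
proof -
  obtain m where m: "\<And>z z'. (\<forall>i<m. z i = z' i) \<Longrightarrow> {x. (x, z) \<in> D} = {x. (x, z') \<in> D}"
    using assms unfolding finitary_def by blast
  obtain m' where m': "\<And>z z'. (\<forall>i<m'. z i = z' i) \<Longrightarrow> {x. (x, z) \<in> D'} = {x. (x, z') \<in> D'}"
    using assms unfolding finitary_def by blast
  have eq: "{x. (x, z) \<in> D \<union> D'} = {x. (x, z) \<in> D} \<union> {x. (x, z) \<in> D'}" for z by auto
  show ?thesis
  proof (rule finitaryI[where m = "max m m'"])
    show "{x. (x, z) \<in> D \<union> D'} \<in> sets M" for z
      unfolding eq using assms by (auto simp: finitary_def)
    fix z z' :: "nat \<Rightarrow> nat" assume "\<forall>i<max m m'. z i = z' i"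
    then show "{x. (x, z) \<in> D \<union> D'} = {x. (x, z') \<in> D \<union> D'}"
      unfolding eq using m[of z z'] m'[of z z'] by simp
  qed
qed

text \<open>The sets that are closed in the sequence variable in a measurable way. Their projections are the
results of the Souslin operation on \<open>sets M\<close>.\<close>
definition closed_meas :: "'a measure \<Rightarrow> ('a \<times> (nat \<Rightarrow> nat)) set \<Rightarrow> bool" where
  "closed_meas M G \<longleftrightarrow> (\<exists>D. (\<forall>n::nat. finitary M (D n)) \<and> G = (\<Inter>n. D n))"

lemma closed_measI:
  assumes "\<And>n::nat. finitary M (D n)" "G = (\<Inter>n. D n)"
  shows "closed_meas M G"
  unfolding closed_meas_def using assms by (intro exI[of _ D]) simp

lemma closed_measE:
  assumes "closed_meas M G"
  obtains D where "\<And>n::nat. finitary M (D n)" "G = (\<Inter>n. D n)"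
proof -
  obtain D where "(\<forall>n::nat. finitary M (D n)) \<and> G = (\<Inter>n. D n)"
    using assms unfolding closed_meas_def ..
  then show thesis by (intro that[of D]) simp_all
qed

lemma finitary_subset: "finitary M D \<Longrightarrow> D \<subseteq> space M \<times> UNIV"
  unfolding finitary_def by (auto dest: sets.sets_into_space)

lemma closed_meas_subset:
  assumes "closed_meas M G" shows "G \<subseteq> space M \<times> UNIV"
proof -
  obtain D where D: "\<And>n::nat. finitary M (D n)" "G = (\<Inter>n. D n)"
    by (rule closed_measE[OF assms]) (rule that)
  show ?thesis unfolding D(2) using finitary_subset[OF D(1), of 0] by blast
qed

lemma closed_meas_finitary: "finitary M D \<Longrightarrow> closed_meas M D"
  unfolding closed_meas_def by (rule exI[of _ "\<lambda>_. D"]) auto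

lemma closed_meas_INT:
  assumes "\<And>j::nat. closed_meas M (G j)"
  shows "closed_meas M (\<Inter>j. G j)"
proof -
  have "\<forall>j. \<exists>D. (\<forall>n::nat. finitary M (D n)) \<and> G j = (\<Inter>n. D n)"
    using assms by (simp add: closed_meas_def)
  from choice[OF this] obtain D where "\<forall>j. (\<forall>n::nat. finitary M (D j n)) \<and> G j = (\<Inter>n. D j n)" ..
  then have D: "\<And>j n::nat. finitary M (D j n)" "\<And>j. G j = (\<Inter>n. D j n)" by simp_all
  have "(\<Inter>j. G j) = (\<Inter>k. D (fst (prod_decode k)) (snd (prod_decode k)))"
  proof (intro set_eqI iffI INT_I)
    fix p j assume p: "p \<in> (\<Inter>k. D (fst (prod_decode k)) (snd (prod_decode k)))"
    have "p \<in> D j n" for n using INT_D[OF p, of "prod_encode (j, n)"] by simp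
    then show "p \<in> G j" unfolding D(2) by blast
  qed (auto simp: D(2))
  then show ?thesis by (rule closed_measI[OF D(1)])
qed

lemma closed_meas_Int:
  assumes "closed_meas M G" "closed_meas M G'"
  shows "closed_meas M (G \<inter> G')"
proof -
  have "G \<inter> G' = (\<Inter>j::nat. if j = 0 then G else G')"
  proof (intro equalityI subsetI IntI)
    fix p assume p: "p \<in> (\<Inter>j::nat. if j = 0 then G else G')"
    show "p \<in> G" "p \<in> G'" using INT_D[OF p, of 0] INT_D[OF p, of 1] by simp_all
  qed simp
  moreover have "closed_meas M (\<Inter>j::nat. if j = 0 then G else G')"
    by (rule closed_meas_INT) (simp add: assms)
  ultimately show ?thesis by simp
qed

lemma closed_meas_reindex:
  assumes "closed_meas M G"
  shows "closed_meas M {(x, z). (x, z \<circ> \<phi>) \<in> G}"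
proof -
  obtain D where D: "\<And>n::nat. finitary M (D n)" "G = (\<Inter>n. D n)"
    by (rule closed_measE[OF assms(1)]) (rule that)
  have "{(x, z). (x, z \<circ> \<phi>) \<in> G} = (\<Inter>n. {(x, z). (x, z \<circ> \<phi>) \<in> D n})"
    unfolding D(2) by auto
  then show ?thesis unfolding closed_meas_def
    by (intro exI[of _ "\<lambda>n. {(x, z). (x, z \<circ> \<phi>) \<in> D n}"] conjI allI finitary_reindex D)
qed

lemma closed_meas_Un_finitary:
  assumes "closed_meas M G" "finitary M D'"
  shows "closed_meas M (D' \<union> G)"
proof -
  obtain D where D: "\<And>n::nat. finitary M (D n)" "G = (\<Inter>n. D n)"
    by (rule closed_measE[OF assms(1)]) (rule that)
  have "D' \<union> G = (\<Inter>n. D' \<union> D n)"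
    unfolding D(2) by auto
  then show ?thesis unfolding closed_meas_def
    by (intro exI[of _ "\<lambda>n. D' \<union> D n"] conjI allI finitary_Un assms D)
qed

definition interleave :: "(nat \<Rightarrow> 'b) \<Rightarrow> (nat \<Rightarrow> 'b) \<Rightarrow> nat \<Rightarrow> 'b" where
  "interleave y a i = (if even i then y (i div 2) else a (i div 2))"

lemma interleave_even [simp]: "interleave y a (2 * i) = y i"
  and interleave_odd [simp]: "interleave y a (Suc (2 * i)) = a i"
  by (auto simp: interleave_def)

lemma interleave_split: "interleave (\<lambda>i. z (2 * i)) (\<lambda>i. z (Suc (2 * i))) = z"
  by (rule ext) (auto simp: interleave_def)

text \<open>Both the second coordinate and the witness \<open>a\<close> are sequences; interleaving them keeps the closed set
inside \<open>M \<times> (nat \<Rightarrow> nat)\<close>.\<close>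
definition analytic :: "'a measure \<Rightarrow> ('a \<times> (nat \<Rightarrow> nat)) set \<Rightarrow> bool" where
  "analytic M E \<longleftrightarrow> (\<exists>G. closed_meas M G \<and> E = {(x, y). \<exists>a. (x, interleave y a) \<in> G})"

lemma analyticI:
  assumes "closed_meas M G" "E = {(x, y). \<exists>a. (x, interleave y a) \<in> G}"
  shows "analytic M E"
  unfolding analytic_def using assms by (intro exI[of _ G] conjI)

lemma analyticE:
  assumes "analytic M E"
  obtains G where "closed_meas M G" "E = {(x, y). \<exists>a. (x, interleave y a) \<in> G}"
  using assms unfolding analytic_def by (elim exE conjE)

lemma analytic_finitary:
  assumes "finitary M D" shows "analytic M D"
proof -
  have "closed_meas M {(x, z). (x, z \<circ> (\<lambda>i. 2 * i)) \<in> D}"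
    by (intro closed_meas_reindex closed_meas_finitary assms)
  moreover have "D = {(x, y). \<exists>a. (x, interleave y a) \<in> {(x, z). (x, z \<circ> (\<lambda>i. 2 * i)) \<in> D}}"
    by (auto simp: comp_def)
  ultimately show ?thesis by (rule analyticI)
qed

text \<open>One witness codes countably many through the pairing function; the \<open>j\<close>-th condition reads the
coordinates of its own witness by a reindexing.\<close>
lemma analytic_INT:
  assumes "\<And>j::nat. analytic M (E j)"
  shows "analytic M (\<Inter>j. E j)"
proof -
  have "\<forall>j. \<exists>G. closed_meas M G \<and> E j = {(x, y). \<exists>a. (x, interleave y a) \<in> G}"
    using assms by (simp add: analytic_def)
  from choice[OF this] obtain G where "\<forall>j. closed_meas M (G j) \<and>
    E j = {(x, y). \<exists>a. (x, interleave y a) \<in> G j}" ..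
  then have G: "\<And>j. closed_meas M (G j)" "\<And>j. E j = {(x, y). \<exists>a. (x, interleave y a) \<in> G j}"
    by simp_all
  define \<phi> where "\<phi> j i = (if even i then i else Suc (2 * prod_encode (j, i div 2)))" for j i :: nat
  have \<phi>: "interleave y a \<circ> \<phi> j = interleave y (\<lambda>i. a (prod_encode (j, i)))" for y a and j :: nat
    by (rule ext) (auto simp: \<phi>_def interleave_def)
  let ?G = "\<Inter>j. {(x, z). (x, z \<circ> \<phi> j) \<in> G j}"
  have "closed_meas M ?G"
    by (intro closed_meas_INT closed_meas_reindex G)
  moreover have "(\<Inter>j. E j) = {(x, y). \<exists>a. (x, interleave y a) \<in> ?G}"
  proof (intro set_eqI iffI; clarsimp simp: G(2))
    fix x y assume "\<forall>j. \<exists>a. (x, interleave y a) \<in> G j"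
    then obtain a where a: "\<And>j. (x, interleave y (a j)) \<in> G j" by metis
    show "\<exists>a. \<forall>j. (x, interleave y a \<circ> \<phi> j) \<in> G j"
      by (rule exI[of _ "\<lambda>k. a (fst (prod_decode k)) (snd (prod_decode k))"]) (simp add: \<phi> a)
  next
    fix x y a j assume "\<forall>j. (x, interleave y a \<circ> \<phi> j) \<in> G j"
    then show "\<exists>a. (x, interleave y a) \<in> G j" by (auto simp: \<phi>)
  qed
  ultimately show ?thesis by (rule analyticI)
qed

text \<open>The first entry of the witness chooses the index \<open>j\<close>. The bound on the coordinates read by the \<open>j\<close>-th
set depends on \<open>j\<close>, so the condition is split into one closed condition for every \<open>j\<close>.\<close>
lemma analytic_UN:
  assumes "\<And>j::nat. analytic M (E j)"
  shows "analytic M (\<Union>j. E j)"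
proof -
  have "\<forall>j. \<exists>G. closed_meas M G \<and> E j = {(x, y). \<exists>a. (x, interleave y a) \<in> G}"
    using assms by (simp add: analytic_def)
  from choice[OF this] obtain G where "\<forall>j. closed_meas M (G j) \<and>
    E j = {(x, y). \<exists>a. (x, interleave y a) \<in> G j}" ..
  then have G: "\<And>j. closed_meas M (G j)" "\<And>j. E j = {(x, y). \<exists>a. (x, interleave y a) \<in> G j}"
    by simp_all
  define \<psi> where "\<psi> i = (if even i then i else Suc (Suc i))" for i :: nat
  have \<psi>: "interleave y a \<circ> \<psi> = interleave y (\<lambda>i. a (Suc i))" for y a :: "nat \<Rightarrow> nat"
    by (rule ext) (auto simp: \<psi>_def interleave_def)
  let ?D = "\<lambda>j. {(x, z). x \<in> space M \<and> z (Suc 0) \<in> - {j}}"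
  let ?G = "(space M \<times> UNIV) \<inter> (\<Inter>j. ?D j \<union> {(x, z). (x, z \<circ> \<psi>) \<in> G j})"
  note G_sub = closed_meas_subset[OF G(1)]
  have "closed_meas M ?G"
    by (intro closed_meas_Int closed_meas_INT closed_meas_Un_finitary closed_meas_reindex G
        closed_meas_finitary finitary_coordinate finitary_rectangle sets.top)
  moreover have "(\<Union>j. E j) = {(x, y). \<exists>a. (x, interleave y a) \<in> ?G}"
  proof (intro equalityI subsetI)
    fix p assume "p \<in> (\<Union>j. E j)"
    then obtain x y j a where p: "p = (x, y)" "(x, interleave y a) \<in> G j" by (auto simp: G(2))
    have "interleave y (case_nat j a) \<circ> \<psi> = interleave y a" by (simp add: \<psi>)
    moreover have "interleave y (case_nat j a) (Suc 0) = j" by (simp add: interleave_def)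
    ultimately have "(x, interleave y (case_nat j a)) \<in> ?G"
      using p(2) G_sub[of j] by auto
    then show "p \<in> {(x, y). \<exists>a. (x, interleave y a) \<in> ?G}" unfolding p(1) by blast
  next
    fix p assume "p \<in> {(x, y). \<exists>a. (x, interleave y a) \<in> ?G}"
    then obtain x y a where p: "p = (x, y)" "(x, interleave y a) \<in> ?G" by blast
    then have "(x, interleave y a) \<in> ?D (interleave y a (Suc 0)) \<union> {(x, z). (x, z \<circ> \<psi>) \<in> G (interleave y a (Suc 0))}"
      by blast
    then have "(x, interleave y (\<lambda>i. a (Suc i))) \<in> G (interleave y a (Suc 0))" by (auto simp: \<psi>)
    then show "p \<in> (\<Union>j. E j)" unfolding p(1) G(2) by blast
  qed
  ultimately show ?thesis by (rule analyticI)
qed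

lemma analytic_subset: "analytic M E \<Longrightarrow> E \<subseteq> space M \<times> UNIV"
  by (elim analyticE) (use closed_meas_subset in blast)

text \<open>The sets that are analytic together with their complements form a \<open>\<sigma>\<close>-algebra, and both coordinate
projections are measurable with respect to it.\<close>
lemma analytic_measurable:
  assumes "E \<in> sets (M \<Otimes>\<^sub>M baire)"
  shows "analytic M E"
proof -
  let ?\<Omega> = "space M \<times> (UNIV :: (nat \<Rightarrow> nat) set)"
  let ?S = "{E. analytic M E \<and> analytic M (?\<Omega> - E)}"
  have "sigma_algebra ?\<Omega> ?S"
    unfolding sigma_algebra_iff2
  proof (intro conjI ballI allI impI)
    show "?S \<subseteq> Pow ?\<Omega>" using analytic_subset by blast
    have e: "analytic M {}" "analytic M ?\<Omega>"
      by (intro analytic_finitary; simp add: finitary_def)+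
    show "{} \<in> ?S" using e by simp
    show "?\<Omega> - s \<in> ?S" if "s \<in> ?S" for s
      using that analytic_subset[of M s] by (auto simp: double_diff)
    fix A :: "nat \<Rightarrow> _" assume A: "range A \<subseteq> ?S"
    have "?\<Omega> - (\<Union>i. A i) = (\<Inter>i. ?\<Omega> - A i)" by auto
    moreover have A': "analytic M (A i)" "analytic M (?\<Omega> - A i)" for i using A by blast+
    ultimately have "analytic M (?\<Omega> - (\<Union>i. A i))" using analytic_INT[of M "\<lambda>i. ?\<Omega> - A i"] by metis
    then show "(\<Union>i. A i) \<in> ?S" using analytic_UN[of M A, OF A'(1)] by blast
  qed
  then interpret S: sigma_algebra ?\<Omega> ?S .
  let ?N = "sigma ?\<Omega> ?S"
  have sets_N: "sets ?N = ?S" and space_N: "space ?N = ?\<Omega>"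
    using S.sigma_sets_eq S.space_closed by auto
  have inS: "D \<in> ?S" if "finitary M D" "finitary M (?\<Omega> - D)" for D
    using that by (simp add: analytic_finitary)
  have "(\<lambda>p. p) \<in> ?N \<rightarrow>\<^sub>M M \<Otimes>\<^sub>M baire"
  proof (rule measurable_pair)
    show "fst \<circ> (\<lambda>p. p) \<in> ?N \<rightarrow>\<^sub>M M"
    proof (rule measurableI)
      fix A assume A: "A \<in> sets M"
      have eq: "(fst \<circ> (\<lambda>p. p)) -` A \<inter> space ?N = A \<times> UNIV"
        using sets.sets_into_space[OF A] by (auto simp: space_N)
      have "?\<Omega> - A \<times> UNIV = (space M - A) \<times> UNIV" by auto
      then show "(fst \<circ> (\<lambda>p. p)) -` A \<inter> space ?N \<in> sets ?N"
        unfolding sets_N eq using A by (intro inS) (simp_all add: finitary_rectangle)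
    qed (auto simp: space_N)
    show "snd \<circ> (\<lambda>p. p) \<in> ?N \<rightarrow>\<^sub>M baire"
    proof (rule measurable_into_baire)
      fix i show "(\<lambda>x. (snd \<circ> (\<lambda>p. p)) x i) \<in> ?N \<rightarrow>\<^sub>M count_space UNIV"
      proof (rule measurableI)
        fix V :: "nat set"
        have eq: "(\<lambda>x. (snd \<circ> (\<lambda>p. p)) x i) -` V \<inter> space ?N = {(x, z). x \<in> space M \<and> z i \<in> V}"
          by (auto simp: space_N)
        have "?\<Omega> - {(x, z). x \<in> space M \<and> z i \<in> V} = {(x, z). x \<in> space M \<and> z i \<in> - V}" by auto
        then show "(\<lambda>x. (snd \<circ> (\<lambda>p. p)) x i) -` V \<inter> space ?N \<in> sets ?N"
          unfolding sets_N eq by (intro inS) (simp_all only: finitary_coordinate)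
      qed auto
    qed
  qed
  from measurable_sets[OF this assms] have "E \<in> sets ?N"
    using sets.sets_into_space[OF assms] by (simp add: space_N space_pair_measure Int_absorb2)
  then show ?thesis unfolding sets_N by simp
qed

lemma ennreal_SUP_approx:
  fixes f :: "nat \<Rightarrow> ennreal"
  assumes "(SUP b. f b) \<noteq> \<infinity>" "e > 0"
  shows "\<exists>b. (SUP b. f b) \<le> f b + ennreal e"
proof (rule ccontr)
  assume "\<not> ?thesis"
  then have "f b + ennreal e \<le> (SUP b. f b)" for b by (auto simp: not_le less_imp_le)
  then have "(SUP b. f b + ennreal e) \<le> (SUP b. f b)" by (rule SUP_least)
  then have "(SUP b. f b) + ennreal e \<le> (SUP b. f b)" by (simp add: ennreal_SUP_add_left)
  moreover have "S < S + ennreal e" if "S \<noteq> \<infinity>" for S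
    using that \<open>e > 0\<close> by (cases S) (simp_all add: ennreal_plus[symmetric] ennreal_less_iff del: ennreal_plus)
  ultimately show False using assms(1) leD by blast
qed

text \<open>The argument of Lusin: bounding one coordinate of the sequence after the other by sufficiently large
numbers loses arbitrarily little outer measure. The sequences below a fixed sequence \<open>k\<close> form a compact
set, so a point whose finite approximations are all met by such sequences belongs to the projection;
the finite approximations are finite unions of measurable sets.\<close>
lemma closed_meas_proj_inner:
  assumes "finite_measure M" "closed_meas M G" "\<epsilon> > 0"
  defines "P \<equiv> {x. \<exists>z. (x, z) \<in> G}"
  shows "\<exists>Q\<in>sets M. Q \<subseteq> P \<and> outer_measure_of M P \<le> emeasure M Q + ennreal \<epsilon>"
proof -
  interpret finite_measure M by fact
  obtain D where D: "\<And>n::nat. finitary M (D n)" "G = (\<Inter>n. D n)"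
    by (rule closed_measE[OF assms(2)]) (rule that)
  have P_sub: "P \<subseteq> space M" unfolding P_def using closed_meas_subset[OF assms(2)] by blast
  \<comment> \<open>The projection of the part of \<open>G\<close> whose first \<open>n\<close> coordinates are bounded by \<open>k\<close>.\<close>
  define PP where "PP k n = {x. \<exists>z. (\<forall>i<n. z i \<le> k i) \<and> (x, z) \<in> G}" for k :: "nat \<Rightarrow> nat" and n
  have PP_sub: "PP k n \<subseteq> P" for k n unfolding PP_def P_def by auto
  have fin: "outer_measure_of M A \<noteq> \<infinity>" if "A \<subseteq> space M" for A
  proof -
    have "outer_measure_of M A \<le> outer_measure_of M (space M)"
      by (rule outer_measure_of_mono[OF that])
    then show ?thesis using emeasure_finite[of "space M"] by (auto simp: top_unique)
  qed
  have step: "\<exists>b. outer_measure_of M (PP k n) \<le> outer_measure_of M (PP (k(n := b)) (Suc n)) + ennreal (\<epsilon> / 2 ^ Suc n)" for k n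
  proof -
    have inc: "incseq (\<lambda>b. PP (k(n := b)) (Suc n))"
      unfolding incseq_def PP_def by (clarsimp simp: less_Suc_eq) (metis le_trans)
    have un: "(\<Union>b. PP (k(n := b)) (Suc n)) = PP k n"
      unfolding PP_def by (auto simp: less_Suc_eq)
    have "(SUP b. outer_measure_of M (PP (k(n := b)) (Suc n))) = outer_measure_of M (PP k n)"
      using SUP_outer_measure_of_incseq[OF order_trans[OF PP_sub P_sub] inc] un by simp
    moreover have "outer_measure_of M (PP k n) \<noteq> \<infinity>" using fin PP_sub P_sub by blast
    moreover have "\<epsilon> / 2 ^ Suc n > 0" using \<open>\<epsilon> > 0\<close> by simp
    ultimately show ?thesis
      using ennreal_SUP_approx[of "\<lambda>b. outer_measure_of M (PP (k(n := b)) (Suc n))" "\<epsilon> / 2 ^ Suc n"] by metis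
  qed
  then obtain b where b: "\<And>k n. outer_measure_of M (PP k n) \<le> outer_measure_of M (PP (k(n := b k n)) (Suc n)) + ennreal (\<epsilon> / 2 ^ Suc n)"
    by metis
  define K where "K = rec_nat (\<lambda>_. 0) (\<lambda>n k. k(n := b k n))"
  have K_Suc: "K (Suc n) = (K n)(n := b (K n) n)" for n by (simp add: K_def)
  have K_stable: "K n i = K (Suc i) i" if "i < n" for n i
    using that by (induction n) (auto simp: K_Suc less_Suc_eq)
  define k where "k i = K (Suc i) i" for i
  have PPk: "PP k n = PP (K n) n" for n
  proof -
    have "k i = K n i" if "i < n" for i using K_stable[OF that] by (simp add: k_def)
    then have "(\<forall>i<n. z i \<le> k i) \<longleftrightarrow> (\<forall>i<n. z i \<le> K n i)" for z by simp
    then show ?thesis by (simp only: PP_def)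
  qed
  have sum_bound: "outer_measure_of M P \<le> outer_measure_of M (PP k n) + ennreal (\<epsilon> * (1 - 1 / 2 ^ n))" for n
  proof (induction n)
    case 0 then show ?case by (simp add: PP_def P_def)
  next
    case (Suc n)
    have "outer_measure_of M (PP k n) \<le> outer_measure_of M (PP k (Suc n)) + ennreal (\<epsilon> / 2 ^ Suc n)"
      using b[of "K n" n] by (simp add: PPk K_Suc)
    then have "outer_measure_of M P \<le> outer_measure_of M (PP k (Suc n)) + ennreal (\<epsilon> / 2 ^ Suc n) + ennreal (\<epsilon> * (1 - 1 / 2 ^ n))"
      using Suc by (meson add_right_mono order_trans)
    also have "\<dots> = outer_measure_of M (PP k (Suc n)) + (ennreal (\<epsilon> / 2 ^ Suc n) + ennreal (\<epsilon> * (1 - 1 / 2 ^ n)))"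
      by (simp add: add.assoc)
    also have "ennreal (\<epsilon> / 2 ^ Suc n) + ennreal (\<epsilon> * (1 - 1 / 2 ^ n)) = ennreal (\<epsilon> * (1 - 1 / 2 ^ Suc n))"
      using \<open>\<epsilon> > 0\<close> by (subst ennreal_plus[symmetric]) (auto simp: field_simps)
    finally show ?case .
  qed
  define Q where "Q n = {x. \<exists>z. (\<forall>i. z i \<le> k i) \<and> (\<forall>j\<le>n. (x, z) \<in> D j)}" for n
  have level: "\<exists>m. \<forall>z z'. (\<forall>i<m. z i = z' i) \<longrightarrow> (\<forall>x. \<forall>j\<le>n. (x, z) \<in> D j \<longleftrightarrow> (x, z') \<in> D j)" for n
  proof -
    have "\<exists>m. \<forall>j. \<forall>z z'. (\<forall>i<m j. z i = z' i) \<longrightarrow> {x. (x, z) \<in> D j} = {x. (x, z') \<in> D j}"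
      using D(1) unfolding finitary_def by metis
    then obtain m where m: "\<And>j z z'. (\<forall>i<m j. z i = z' i) \<Longrightarrow> {x. (x, z) \<in> D j} = {x. (x, z') \<in> D j}"
      by metis
    show ?thesis
    proof (intro exI allI impI)
      fix z z' :: "nat \<Rightarrow> nat" and x j assume eq: "\<forall>i<Max (m ` {..n}). z i = z' i" and "j \<le> n"
      then have "m j \<le> Max (m ` {..n})" by simp
      then have "{x. (x, z) \<in> D j} = {x. (x, z') \<in> D j}" using eq by (intro m) auto
      then show "(x, z) \<in> D j \<longleftrightarrow> (x, z') \<in> D j" by auto
    qed
  qed
  then obtain m where m: "\<And>n z z' x j. (\<forall>i<m n. z i = z' i) \<Longrightarrow> j \<le> n \<Longrightarrow> (x, z) \<in> D j \<longleftrightarrow> (x, z') \<in> D j"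
    by metis
  have PP_Q: "PP k (m n) \<subseteq> Q n" for n
  proof
    fix x assume "x \<in> PP k (m n)"
    then obtain z where z: "\<forall>i<m n. z i \<le> k i" "\<forall>j. (x, z) \<in> D j" unfolding PP_def D(2) by auto
    then have "(\<forall>i. min (z i) (k i) \<le> k i) \<and> (\<forall>j\<le>n. (x, \<lambda>i. min (z i) (k i)) \<in> D j)"
      using m[of n "\<lambda>i. min (z i) (k i)" z _ x] by (auto simp: min_def)
    then show "x \<in> Q n" unfolding Q_def by (intro CollectI exI[of _ "\<lambda>i. min (z i) (k i)"])
  qed
  have Q_meas: "Q n \<in> sets M" for n
  proof -
    let ?F = "{z. (\<forall>i. z i \<le> k i) \<and> (\<forall>i\<ge>m n. z i = 0)}"
    have "?F \<subseteq> PiE_dflt {..<m n} 0 (\<lambda>i. {..k i})" by (auto simp: PiE_dflt_def)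
    moreover have "finite (PiE_dflt {..<m n} 0 (\<lambda>i. {..k i}))" by (intro finite_PiE_dflt) auto
    ultimately have F: "finite ?F" by (rule finite_subset)
    have "Q n = (\<Union>z\<in>?F. (\<Inter>j\<in>{..n}. {x. (x, z) \<in> D j}))"
    proof (intro set_eqI iffI)
      fix x assume "x \<in> Q n"
      then obtain z where z: "\<forall>i. z i \<le> k i" "\<forall>j\<le>n. (x, z) \<in> D j" unfolding Q_def by auto
      define z' where "z' i = (if i < m n then z i else 0)" for i
      have "\<forall>j\<le>n. (x, z') \<in> D j" using z(2) m[of n z z' _ x] by (auto simp: z'_def)
      moreover have "z' \<in> ?F" using z(1) by (auto simp: z'_def)
      ultimately show "x \<in> (\<Union>z\<in>?F. (\<Inter>j\<in>{..n}. {x. (x, z) \<in> D j}))"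
        by (intro UN_I[of z'] INT_I) simp_all
    qed (auto simp: Q_def)
    also have "\<dots> \<in> sets M"
      using D(1) by (intro sets.finite_UN F sets.finite_INT) (auto simp: finitary_def)
    finally show ?thesis .
  qed
  have Q_dec: "decseq Q" unfolding decseq_def Q_def by (auto; meson le_trans)
  have "(\<Inter>n. Q n) \<subseteq> P"
  proof
    fix x assume x: "x \<in> (\<Inter>n. Q n)"
    \<comment> \<open>Koenig's lemma: a prefix with arbitrarily good extensions below \<open>k\<close> can be prolonged.\<close>
    define good where "good s n \<longleftrightarrow> (\<forall>N. \<exists>z. (\<forall>i<n. z i = s i) \<and> (\<forall>i. z i \<le> k i) \<and> (\<forall>j\<le>N. (x, z) \<in> D j))" for s :: "nat \<Rightarrow> nat" and n :: nat
    have "good (\<lambda>_. 0) 0" using x unfolding good_def Q_def by auto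
    have ext: "\<exists>c. good (s(n := c)) (Suc n)" if "good s n" for s n
    proof (rule ccontr)
      assume "\<not> ?thesis"
      then have "\<not> good (s(n := c)) (Suc n)" for c by simp
      then have "\<forall>c. \<exists>N. \<not> (\<exists>z. (\<forall>i<Suc n. z i = (s(n := c)) i) \<and> (\<forall>i. z i \<le> k i) \<and> (\<forall>j\<le>N. (x, z) \<in> D j))"
        unfolding good_def not_all ..
      from choice[OF this] obtain N where
        N: "\<forall>c. \<not> (\<exists>z. (\<forall>i<Suc n. z i = (s(n := c)) i) \<and> (\<forall>i. z i \<le> k i) \<and> (\<forall>j\<le>N c. (x, z) \<in> D j))" ..
      have "\<exists>z. (\<forall>i<n. z i = s i) \<and> (\<forall>i. z i \<le> k i) \<and> (\<forall>j\<le>Max (N ` {..k n}). (x, z) \<in> D j)"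
        using that unfolding good_def ..
      then obtain z where z: "\<forall>i<n. z i = s i" "\<forall>i. z i \<le> k i" "\<forall>j\<le>Max (N ` {..k n}). (x, z) \<in> D j"
        by (elim exE conjE) (rule that)
      have "N (z n) \<le> Max (N ` {..k n})" using z(2) by simp
      then have "\<forall>j\<le>N (z n). (x, z) \<in> D j" using z(3) by simp
      moreover have "\<forall>i<Suc n. z i = (s(n := z n)) i" using z(1) by (simp add: less_Suc_eq)
      ultimately have "\<exists>z'. (\<forall>i<Suc n. z' i = (s(n := z n)) i) \<and> (\<forall>i. z' i \<le> k i) \<and> (\<forall>j\<le>N (z n). (x, z') \<in> D j)"
        using z(2) by (intro exI[of _ z] conjI)
      then show False using spec[OF N, of "z n"] by (rule notE[rotated])
    qed
    then obtain c where c: "\<And>s n. good s n \<Longrightarrow> good (s(n := c s n)) (Suc n)" by metis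
    define S where "S = rec_nat (\<lambda>_. 0) (\<lambda>n s. s(n := c s n))"
    have S_Suc: "S (Suc n) = (S n)(n := c (S n) n)" for n by (simp add: S_def)
    have S_good: "good (S n) n" for n
    proof (induction n)
      case 0 then show ?case using \<open>good (\<lambda>_. 0) 0\<close> by (simp add: S_def)
    next
      case (Suc n) then show ?case unfolding S_Suc by (rule c)
    qed
    have S_stable: "S n i = S (Suc i) i" if "i < n" for n i
      using that by (induction n) (auto simp: S_Suc less_Suc_eq)
    have "(x, \<lambda>i. S (Suc i) i) \<in> D n" for n
    proof -
      obtain z where z: "\<forall>i<m n. z i = S (m n) i" "\<forall>j\<le>n. (x, z) \<in> D j"
        using S_good[of "m n"] unfolding good_def by blast
      have "z i = S (Suc i) i" if "i < m n" for i using z(1) S_stable[OF that] that by simp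
      then have "(x, z) \<in> D n \<longleftrightarrow> (x, \<lambda>i. S (Suc i) i) \<in> D n" by (intro m[of n]) simp_all
      then show ?thesis using z(2) by simp
    qed
    then show "x \<in> P" unfolding P_def D(2) by auto
  qed
  moreover have "outer_measure_of M P \<le> emeasure M (\<Inter>n. Q n) + ennreal \<epsilon>"
  proof -
    have "outer_measure_of M P \<le> emeasure M (Q n) + ennreal \<epsilon>" for n
    proof -
      have "outer_measure_of M (PP k (m n)) \<le> emeasure M (Q n)"
        using outer_measure_of_mono[OF PP_Q[of n], of M] Q_meas by simp
      moreover have "ennreal (\<epsilon> * (1 - 1 / 2 ^ m n)) \<le> ennreal \<epsilon>"
        using \<open>\<epsilon> > 0\<close> by (intro ennreal_leI) (simp add: mult_left_le)
      ultimately show ?thesis using sum_bound[of "m n"] by (meson add_mono order_trans)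
    qed
    then have "outer_measure_of M P \<le> (INF n. emeasure M (Q n) + ennreal \<epsilon>)" by (simp add: le_INF_iff)
    also have "\<dots> = (INF n. emeasure M (Q n)) + ennreal \<epsilon>"
      by (subst INF_ennreal_add_const) simp
    also have "(INF n. emeasure M (Q n)) = emeasure M (\<Inter>n. Q n)"
      using Q_meas Q_dec by (intro INF_emeasure_decseq) (auto simp: emeasure_finite)
    finally show ?thesis .
  qed
  moreover have "(\<Inter>n. Q n) \<in> sets M" using Q_meas by auto
  ultimately show ?thesis by blast
qed

text \<open>By the approximation from inside, the projection lies between a measurable subset and a measurable
hull of the same measure.\<close>
theorem measurable_projection_baire:
  assumes "finite_measure M" "E \<in> sets (M \<Otimes>\<^sub>M baire)"
  shows "{x. \<exists>z. (x, z) \<in> E} \<in> sets (completion M)"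
proof -
  interpret finite_measure M by fact
  obtain G where G: "closed_meas M G" "E = {(x, y). \<exists>a. (x, interleave y a) \<in> G}"
    by (rule analyticE[OF analytic_measurable[OF assms(2)]]) (rule that)
  define P where "P = {x. \<exists>z. (x, z) \<in> G}"
  have "{x. \<exists>z. (x, z) \<in> E} = P"
    unfolding G(2) P_def by auto (metis interleave_split)
  moreover have "P \<in> sets (completion M)"
  proof -
    have "P \<subseteq> space M" using \<open>_ = P\<close> sets.sets_into_space[OF assms(2)] by (auto simp: space_pair_measure)
    then obtain B where B: "B \<in> sets M" "P \<subseteq> B" "outer_measure_of M P = emeasure M B"
      using outer_measure_of_attain[of P M] that by force
    have "\<exists>Q\<in>sets M. Q \<subseteq> P \<and> outer_measure_of M P \<le> emeasure M Q + ennreal (1 / Suc n)" for n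
      using closed_meas_proj_inner[OF assms(1) G(1), of "1 / Suc n"] unfolding P_def by simp
    then obtain Q where Q: "\<And>n. Q n \<in> sets M" "\<And>n. Q n \<subseteq> P"
      "\<And>n. outer_measure_of M P \<le> emeasure M (Q n) + ennreal (1 / Suc n)"
      by metis
    let ?Q = "\<Union>n. Q n"
    have Q': "?Q \<in> sets M" "?Q \<subseteq> P" using Q by auto
    have "emeasure M B \<le> emeasure M ?Q + ennreal (1 / Suc n)" for n
    proof -
      have "emeasure M (Q n) \<le> emeasure M ?Q" using Q' by (intro emeasure_mono) auto
      then show ?thesis using Q(3)[of n] B(3) by (metis add_right_mono order_trans)
    qed
    then have "measure M B \<le> measure M ?Q + 1 / Suc n" for n
      by (simp add: emeasure_eq_measure flip: ennreal_plus del: of_nat_Suc)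
    then have "measure M B \<le> measure M ?Q"
      by (intro LIMSEQ_le_const[OF LIMSEQ_inverse_real_of_nat_add[of "measure M ?Q"]]) (auto simp: inverse_eq_divide)
    moreover have "measure M (B - ?Q) = measure M B - measure M ?Q"
      using Q' B by (intro finite_measure_Diff) auto
    ultimately have "measure M (B - ?Q) = 0"
      using measure_nonneg[of M "B - ?Q"] by linarith
    then have "B - ?Q \<in> null_sets M" using B Q' by (auto simp: null_sets_def emeasure_eq_measure)
    then show ?thesis
      by (intro sets_completionI[of P ?Q "P - ?Q" "B - ?Q"]) (use Q' B in auto)
  qed
  ultimately show ?thesis by simp
qed


section \<open>Standard Borel spaces\<close>

definition souslin_space :: "'b measure \<Rightarrow> bool" where
  "souslin_space N \<longleftrightarrow> (\<exists>h\<in>baire \<rightarrow>\<^sub>M N. range h = space N)"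

lemma souslin_space_pair:
  assumes "souslin_space N" "souslin_space N'"
  shows "souslin_space (N \<Otimes>\<^sub>M N')"
proof -
  obtain h where h: "h \<in> baire \<rightarrow>\<^sub>M N" "range h = space N" using assms(1) unfolding souslin_space_def by (elim bexE) (rule that)
  obtain h' where h': "h' \<in> baire \<rightarrow>\<^sub>M N'" "range h' = space N'" using assms(2) unfolding souslin_space_def by (elim bexE) (rule that)
  let ?h = "\<lambda>z. (h (\<lambda>i. z (2 * i)), h' (\<lambda>i. z (Suc (2 * i))))"
  have "(\<lambda>z i. z (2 * i)) \<in> baire \<rightarrow>\<^sub>M baire" "(\<lambda>z i. z (Suc (2 * i))) \<in> baire \<rightarrow>\<^sub>M baire"
    by (auto intro!: measurable_into_baire)
  then have "?h \<in> baire \<rightarrow>\<^sub>M N \<Otimes>\<^sub>M N'"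
    by (intro measurable_Pair measurable_compose[OF _ h(1)] measurable_compose[OF _ h'(1)])
  moreover have "range ?h = space (N \<Otimes>\<^sub>M N')"
  proof (intro equalityI subsetI)
    fix p assume "p \<in> space (N \<Otimes>\<^sub>M N')"
    then obtain y a where "p = (h y, h' a)"
      using h(2) h'(2) by (force simp: space_pair_measure)
    then have "p = ?h (interleave y a)" by simp
    then show "p \<in> range ?h" by blast
  qed (use h(2) h'(2) in \<open>auto simp: space_pair_measure\<close>)
  ultimately show ?thesis unfolding souslin_space_def by blast
qed

text \<open>The measurable projection theorem. It replaces the theorems of Lusin--Souslin and Lusin--Novikov, at the
price of a null set for a given measure.\<close>
theorem measurable_projection:
  assumes "finite_measure M" "souslin_space N" "E \<in> sets (M \<Otimes>\<^sub>M N)"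
  shows "{x. \<exists>y. (x, y) \<in> E} \<in> sets (completion M)"
proof -
  obtain h where h: "h \<in> baire \<rightarrow>\<^sub>M N" "range h = space N"
    using assms(2) unfolding souslin_space_def by (elim bexE) (rule that)
  let ?f = "\<lambda>p. (fst p, h (snd p))"
  have f: "?f \<in> M \<Otimes>\<^sub>M baire \<rightarrow>\<^sub>M M \<Otimes>\<^sub>M N"
    by (intro measurable_Pair measurable_fst measurable_compose[OF measurable_snd h(1)])
  have "{x. \<exists>y. (x, y) \<in> E} = {x. \<exists>z. (x, z) \<in> ?f -` E \<inter> space (M \<Otimes>\<^sub>M baire)}"
  proof (intro Collect_cong iffI)
    fix x assume "\<exists>y. (x, y) \<in> E"
    then obtain y where y: "(x, y) \<in> E" ..
    then have xy: "x \<in> space M" "y \<in> space N"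
      using sets.sets_into_space[OF assms(3)] by (auto simp: space_pair_measure)
    then obtain z where "y = h z" using h(2) by auto
    then show "\<exists>z. (x, z) \<in> ?f -` E \<inter> space (M \<Otimes>\<^sub>M baire)"
      using y xy by (intro exI[of _ z]) (simp add: space_pair_measure)
  qed auto
  then show ?thesis
    using measurable_projection_baire[OF assms(1) measurable_sets[OF f assms(3)]] by simp
qed

lemma standard_borel_metric:
  assumes "standard_borel N"
  obtains d q where "Metric_space (space N) d" "Metric_space.mcomplete (space N) d"
    "sets N = sigma_sets (space N) {U. openin (Metric_space.mtopology (space N) d) U}"
    "space N \<noteq> {} \<Longrightarrow> range q \<subseteq> space N"
    "\<And>x e. x \<in> space N \<Longrightarrow> e > 0 \<Longrightarrow> \<exists>i::nat. d x (q i) < e"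
proof -
  obtain T where T: "completely_metrizable_space T" "separable_space T" "topspace T = space N"
    "sets N = sigma_sets (space N) {U. openin T U}"
    using assms unfolding standard_borel_def by blast
  obtain S d where S: "Metric_space S d" "Metric_space.mcomplete S d" "T = Metric_space.mtopology S d"
    using T(1) unfolding completely_metrizable_space_def by blast
  interpret Metric_space S d by fact
  have S_eq: "S = space N" using T(3) S(3) by simp
  obtain C where C: "countable C" "C \<subseteq> S" "mtopology closure_of C = S"
    using T(2) unfolding separable_space_def S(3) by auto
  have near: "\<exists>c\<in>C. d x c < e" if "x \<in> S" "e > 0" for x e
    using that C(3) unfolding metric_closure_of by auto
  define q where "q = from_nat_into C"
  have C_ne: "C \<noteq> {}" if "space N \<noteq> {}" using near[of _ 1] that S_eq by auto
  show thesis
  proof (rule that[of d q])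
    show "Metric_space (space N) d" "Metric_space.mcomplete (space N) d"
      "sets N = sigma_sets (space N) {U. openin (Metric_space.mtopology (space N) d) U}"
      using S T(4) S_eq by simp_all
    show "range q \<subseteq> space N" if "space N \<noteq> {}"
      using C_ne[OF that] C(2) S_eq unfolding q_def by (simp add: range_from_nat_into[OF _ C(1)])
    show "\<exists>i::nat. d x (q i) < e" if xe: "x \<in> space N" "e > 0" for x e
    proof -
      obtain c where c: "c \<in> C" "d x c < e" using near[of x e] xe S_eq by auto
      then have "c \<in> range q" using range_from_nat_into[OF _ C(1)] unfolding q_def by auto
      then show ?thesis using c by auto
    qed
  qed
qed

text \<open>A sequence \<open>z\<close> names points \<open>q (z n)\<close> of a dense sequence. A point is accepted as the next
approximation only if it is within \<open>(1/2)^n\<close> of the current one; then every sequence yields a Cauchy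
sequence, and every point of the space is a limit.\<close>
lemma standard_borel_souslin:
  assumes "standard_borel N" "space N \<noteq> {}"
  shows "souslin_space N"
proof -
  obtain d q where d: "Metric_space (space N) d" "Metric_space.mcomplete (space N) d"
    and sets_N: "sets N = sigma_sets (space N) {U. openin (Metric_space.mtopology (space N) d) U}"
    and q: "range q \<subseteq> space N" "\<And>x e. x \<in> space N \<Longrightarrow> e > 0 \<Longrightarrow> \<exists>i::nat. d x (q i) < e"
    using standard_borel_metric[OF assms(1)] assms(2) by metis
  interpret Metric_space "space N" d by fact
  have qS: "q i \<in> space N" for i using q(1) by auto
  define p where "p z = rec_nat (q (z 0)) (\<lambda>n a. if d a (q (z (Suc n))) < (1/2)^n then q (z (Suc n)) else a)" for z :: "nat \<Rightarrow> nat"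
  have p_0: "p z 0 = q (z 0)" for z by (simp add: p_def)
  have p_Suc: "p z (Suc n) = (if d (p z n) (q (z (Suc n))) < (1/2)^n then q (z (Suc n)) else p z n)" for z n
    by (simp add: p_def)
  have pS: "p z n \<in> space N" for z n by (induction n) (auto simp: p_0 p_Suc qS)
  have p_step: "d (p z n) (p z (Suc n)) \<le> (1/2)^n" for z n
    using pS by (simp add: p_Suc)
  have p_dist: "d (p z n) (p z (n + k)) \<le> 2 * (1/2)^n - 2 * (1/2)^(n + k)" for z n k
  proof (induction k)
    case 0 then show ?case using pS by simp
  next
    case (Suc k)
    have "d (p z n) (p z (n + Suc k)) \<le> d (p z n) (p z (n + k)) + d (p z (n + k)) (p z (n + Suc k))"
      by (rule triangle) (rule pS)+
    then show ?case using Suc p_step[of z "n + k"] by simp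
  qed
  have p_dist': "d (p z n) (p z m) \<le> 2 * (1/2)^n" if "n \<le> m" for z n m
  proof -
    have "d (p z n) (p z m) \<le> 2 * (1/2)^n - 2 * (1/2)^m"
      using p_dist[of z n "m - n"] that by simp
    moreover have "0 \<le> 2 * (1/2::real)^m" by simp
    ultimately show ?thesis by linarith
  qed
  have "\<exists>l. limitin mtopology (p z) l sequentially" for z
  proof -
    have "MCauchy (p z)"
      unfolding MCauchy_def
    proof (intro conjI allI impI)
      show "range (p z) \<subseteq> space N" using pS by auto
      fix e :: real assume "e > 0"
      then obtain n where n: "(1/2::real)^n < e / 4" using real_arch_pow_inv[of "e/4" "1/2"] by auto
      have "d (p z a) (p z b) < e" if "n \<le> a" "n \<le> b" for a b
      proof -
        have "d (p z a) (p z b) \<le> d (p z a) (p z n) + d (p z n) (p z b)"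
          by (rule triangle) (rule pS)+
        then show ?thesis using p_dist'[OF that(1), of z] p_dist'[OF that(2), of z] n
          by (simp add: commute)
      qed
      then show "\<exists>Na. \<forall>n n'. Na \<le> n \<longrightarrow> Na \<le> n' \<longrightarrow> d (p z n) (p z n') < e" by blast
    qed
    then show ?thesis using d(2) unfolding mcomplete_def by blast
  qed
  then obtain h where h: "\<And>z. limitin mtopology (p z) (h z) sequentially" by metis
  have hS: "h z \<in> space N" for z using h[of z] by (simp add: limitin_metric)
  have h_dist: "d (p z n) (h z) \<le> 2 * (1/2)^n" for z n
  proof (rule field_le_epsilon)
    fix e :: real assume "e > 0"
    then have "\<forall>\<^sub>F m in sequentially. p z m \<in> space N \<and> d (p z m) (h z) < e"
      using h[of z] by (simp add: limitin_metric)
    then obtain m where m: "m \<ge> n" "d (p z m) (h z) < e"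
      unfolding eventually_sequentially by (meson nle_le)
    have "d (p z n) (h z) \<le> d (p z n) (p z m) + d (p z m) (h z)"
      by (rule triangle) (rule pS hS)+
    then show "d (p z n) (h z) \<le> 2 * (1/2)^n + e" using m p_dist'[OF m(1), of z] by simp
  qed
  have pow_small: "\<exists>n. (1/2::real)^n < e" if "e > 0" for e
    using real_arch_pow_inv[OF that, of "1/2"] by auto
  have "range h = space N"
  proof (intro equalityI subsetI)
    fix x assume x: "x \<in> space N"
    have "\<exists>i. d x (q i) < (1/2)^n / 4" for n by (rule q(2)[OF x]) simp
    then obtain z where z: "\<And>n. d x (q (z n)) < (1/2)^n / 4" by metis
    have pq: "p z n = q (z n)" for n
    proof (induction n)
      case (Suc n)
      have "d (q (z n)) (q (z (Suc n))) \<le> d (q (z n)) x + d x (q (z (Suc n)))"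
        by (rule triangle) (use qS x in auto)
      also have "\<dots> < (1/2)^n"
      proof -
        have "(1/2::real)^Suc n = (1/2)^n / 2" "(1/2::real)^n > 0" by simp_all
        then show ?thesis using z[of n] z[of "Suc n"] unfolding commute[of "q (z n)" x] by linarith
      qed
      finally show ?case using Suc by (simp add: p_Suc)
    qed (simp add: p_0)
    have "limitin mtopology (p z) x sequentially"
      unfolding limitin_metric
    proof (intro conjI x allI impI)
      fix e :: real assume "e > 0"
      then obtain n where n: "(1/2::real)^n < e" using pow_small by blast
      show "\<forall>\<^sub>F m in sequentially. p z m \<in> space N \<and> d (p z m) x < e"
        unfolding eventually_sequentially
      proof (intro exI[of _ n] allI impI conjI pS)
        fix m assume "n \<le> m"
        then have "(1/2::real)^m \<le> (1/2)^n" by (rule power_decreasing) auto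
        moreover have "0 \<le> (1/2::real)^m" by simp
        moreover have "d (p z m) x = d x (q (z m))" by (simp add: pq commute)
        ultimately show "d (p z m) x < e" using z[of m] n by linarith
      qed
    qed
    then have "h z = x" using limitin_metric_unique[OF h[of z]] by simp
    then show "x \<in> range h" by blast
  qed (use hS in auto)
  moreover have "h \<in> baire \<rightarrow>\<^sub>M N"
  proof (rule measurable_sigma_sets[OF sets_N])
    show "{U. openin mtopology U} \<subseteq> Pow (space N)" using openin_subset by fastforce
    show "h \<in> space baire \<rightarrow> space N" using hS by auto
    fix U assume "U \<in> {U. openin mtopology U}"
    then have U: "openin mtopology U" by simp
    have p_meas: "{z. Q (p z n)} \<in> sets baire" for Q n
    proof (induction n arbitrary: Q)
      case 0
      have "(\<lambda>z. z 0) -` {k. Q (q k)} \<inter> space baire \<in> sets baire"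
        by (rule measurable_sets[OF measurable_baire_coordinate]) simp
      then show ?case by (simp add: p_0 vimage_def)
    next
      case (Suc n)
      have "(\<lambda>z. z (Suc n)) -` {k} \<inter> space baire \<in> sets baire" for k
        by (rule measurable_sets[OF measurable_baire_coordinate]) simp
      then have c: "{z. z (Suc n) = k} \<in> sets baire" for k by (simp add: vimage_def)
      have "{z. Q (p z (Suc n))} = (\<Union>k. {z. z (Suc n) = k} \<inter>
          {z. Q (if d (p z n) (q k) < (1/2)^n then q k else p z n)})"
        by (auto simp: p_Suc)
      then show ?case
        using c Suc.IH[of "\<lambda>a. Q (if d a (q k) < (1/2)^n then q k else a)" for k] by simp
    qed
    have "h -` U \<inter> space baire = (\<Union>n. {z. mcball (p z n) (2 * (1/2)^n) \<subseteq> U})"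
    proof (intro equalityI subsetI)
      fix z assume "z \<in> h -` U \<inter> space baire"
      then obtain e where e: "e > 0" "mball (h z) e \<subseteq> U"
        using U unfolding openin_mtopology by auto
      obtain n where n: "(1/2::real)^n < e / 4" using pow_small[of "e/4"] e by auto
      have "mcball (p z n) (2 * (1/2)^n) \<subseteq> mball (h z) e"
      proof
        fix y assume y: "y \<in> mcball (p z n) (2 * (1/2)^n)"
        then have "d (h z) y \<le> d (h z) (p z n) + d (p z n) y"
          by (intro triangle hS pS) simp
        then show "y \<in> mball (h z) e"
          using y h_dist[of z n] n hS by (simp add: commute)
      qed
      then show "z \<in> (\<Union>n. {z. mcball (p z n) (2 * (1/2)^n) \<subseteq> U})" using e by blast
    next
      fix z assume "z \<in> (\<Union>n. {z. mcball (p z n) (2 * (1/2)^n) \<subseteq> U})"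
      then obtain n where "mcball (p z n) (2 * (1/2)^n) \<subseteq> U" by blast
      moreover have "h z \<in> mcball (p z n) (2 * (1/2)^n)" using pS hS h_dist by simp
      ultimately show "z \<in> h -` U \<inter> space baire" by auto
    qed
    also have "\<dots> \<in> sets baire" by (intro sets.countable_UN'' countableI_type p_meas)
    finally show "h -` U \<inter> space baire \<in> sets baire" .
  qed
  ultimately show ?thesis unfolding souslin_space_def by blast
qed

text \<open>Balls with radii \<open>1/(n+1)\<close> around a dense sequence. They generate the \<open>\<sigma>\<close>-algebra and isolate a point
from any finite set.\<close>
lemma standard_borel_base:
  assumes "standard_borel N"
  obtains U :: "nat \<Rightarrow> 'a set" where "\<And>n. U n \<in> sets N" "sets N = sigma_sets (space N) (range U)"
    "\<And>F x. finite F \<Longrightarrow> F \<subseteq> space N \<Longrightarrow> x \<in> space N \<Longrightarrow> x \<notin> F \<Longrightarrow> \<exists>n. x \<in> U n \<and> U n \<inter> F = {}"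
proof -
  obtain d q where d: "Metric_space (space N) d" "Metric_space.mcomplete (space N) d"
    and sets_N: "sets N = sigma_sets (space N) {U. openin (Metric_space.mtopology (space N) d) U}"
    and q: "space N \<noteq> {} \<Longrightarrow> range q \<subseteq> space N" "\<And>x e. x \<in> space N \<Longrightarrow> e > 0 \<Longrightarrow> \<exists>i::nat. d x (q i) < e"
    using standard_borel_metric[OF assms(1)] by metis
  interpret Metric_space "space N" d by fact
  define U where "U n = mball (q (fst (prod_decode n))) (1 / Suc (snd (prod_decode n)))" for n
  have U_near: "\<exists>n. x \<in> U n \<and> U n \<subseteq> mball x e" if xe: "x \<in> space N" "e > 0" for x e
  proof -
    obtain j where j: "1 / Suc j < e / 2" using xe(2) nat_approx_posE[of "e/2"] by auto
    obtain i where i: "d x (q i) < 1 / Suc j" using q(2)[OF xe(1), of "1 / Suc j"] by auto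
    have qi: "q i \<in> space N" using q(1) xe by auto
    have "mball (q i) (1 / Suc j) \<subseteq> mball x e"
    proof
      fix y assume y: "y \<in> mball (q i) (1 / Suc j)"
      then have "d x y \<le> d x (q i) + d (q i) y" by (intro triangle xe qi) simp
      then show "y \<in> mball x e" using y i j xe(1) by (simp del: of_nat_Suc)
    qed
    moreover have "x \<in> mball (q i) (1 / Suc j)" using i qi xe(1) by (simp add: commute)
    moreover have "U (prod_encode (i, j)) = mball (q i) (1 / Suc j)" by (simp add: U_def)
    ultimately show ?thesis by metis
  qed
  have U_open: "openin mtopology (U n)" for n unfolding U_def by (rule openin_mball)
  show thesis
  proof (rule that[of U])
    show U_sets: "U n \<in> sets N" for n using U_open sets_N by auto
    show "sets N = sigma_sets (space N) (range U)"
    proof (rule antisym)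
      show "sigma_sets (space N) (range U) \<subseteq> sets N"
        by (rule sets.sigma_sets_subset) (use U_sets in auto)
      have "V \<in> sigma_sets (space N) (range U)" if "openin mtopology V" for V
      proof -
        have "V = (\<Union>n\<in>{n. U n \<subseteq> V}. U n)"
        proof (intro equalityI subsetI)
          fix x assume "x \<in> V"
          then obtain e where e: "e > 0" "mball x e \<subseteq> V" "x \<in> space N"
            using \<open>openin mtopology V\<close> unfolding openin_mtopology by blast
          then show "x \<in> (\<Union>n\<in>{n. U n \<subseteq> V}. U n)" using U_near[OF e(3) e(1)] by blast
        qed auto
        moreover have "(\<Union>n\<in>{n. U n \<subseteq> V}. U n) = \<Union> (U ` {n. U n \<subseteq> V})" by simp
        moreover have "\<Union> (U ` {n. U n \<subseteq> V}) \<in> sigma_sets (space N) (range U)"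
          by (rule sigma_sets_UNION) auto
        ultimately show ?thesis by simp
      qed
      then show "sets N \<subseteq> sigma_sets (space N) (range U)"
        unfolding sets_N by (intro sigma_sets_mono) auto
    qed
    fix F x assume F: "finite F" "F \<subseteq> space N" and x: "x \<in> space N" "x \<notin> F"
    define e where "e = Min (insert 1 (d x ` F))"
    have "e > 0" unfolding e_def using F x by (subst Min_gr_iff) (auto simp: subset_eq)
    moreover have "mball x e \<inter> F = {}"
    proof -
      have "e \<le> d x y" if "y \<in> F" for y unfolding e_def using F that by (intro Min_le) auto
      then show ?thesis by fastforce
    qed
    ultimately show "\<exists>n. x \<in> U n \<and> U n \<inter> F = {}" using U_near[OF x(1)] by blast
  qed
qed

section \<open>Mass transport for enumerated relations\<close>

lemma separated_eq_measurable:
  fixes U :: "nat \<Rightarrow> 'a set"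
  assumes [measurable]: "\<And>n. U n \<in> sets M"
    and sep: "\<And>x y. x \<in> space M \<Longrightarrow> y \<in> space M \<Longrightarrow> x \<noteq> y \<Longrightarrow> \<exists>n. x \<in> U n \<and> y \<notin> U n"
    and [measurable]: "f \<in> N \<rightarrow>\<^sub>M M" "g \<in> N \<rightarrow>\<^sub>M M"
  shows "Measurable.pred N (\<lambda>x. f x = g x)"
proof -
  have "f x = g x \<longleftrightarrow> (\<forall>n. f x \<in> U n \<longrightarrow> g x \<in> U n)" if "x \<in> space N" for x
  proof (cases "f x = g x")
    case False
    have "f x \<in> space M" "g x \<in> space M"
      using measurable_space[OF assms(3) that] measurable_space[OF assms(4) that] by auto
    from sep[OF this False] show ?thesis using False by blast
  qed simp
  moreover have "Measurable.pred N (\<lambda>x. \<forall>n. f x \<in> U n \<longrightarrow> g x \<in> U n)" by measurable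
  ultimately show ?thesis
    using measurable_cong[of N "\<lambda>x. f x = g x" "\<lambda>x. \<forall>n. f x \<in> U n \<longrightarrow> g x \<in> U n" "count_space UNIV"] by blast
qed

text \<open>An invariant relation whose classes are enumerated by Borel functions \<open>h j\<close>, with repetitions, on an
invariant conull Borel set \<open>X\<close>. The sets \<open>U n\<close> are a countable base of the space.\<close>
locale enumerated_relation = prob_space M
  for M :: "'x measure" +
  fixes R :: "('x \<times> 'x) set" and X :: "'x set" and h :: "nat \<Rightarrow> 'x \<Rightarrow> 'x" and U :: "nat \<Rightarrow> 'x set"
  assumes equiv_R: "equiv (space M) R"
    and R_sets [measurable]: "R \<in> sets (M \<Otimes>\<^sub>M M)"
    and invariant: "invariant_measure M R"
    and U_sets [measurable]: "\<And>n. U n \<in> sets M"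
    and U_isolates: "\<And>F x. finite F \<Longrightarrow> F \<subseteq> space M \<Longrightarrow> x \<in> space M \<Longrightarrow> x \<notin> F \<Longrightarrow> \<exists>n. x \<in> U n \<and> U n \<inter> F = {}"
    and X_sets [measurable]: "X \<in> sets M"
    and X_conull: "AE x in M. x \<in> X"
    and X_saturated: "\<And>x y. x \<in> X \<Longrightarrow> (x, y) \<in> R \<Longrightarrow> y \<in> X"
    and h_measurable [measurable]: "\<And>j. h j \<in> M \<rightarrow>\<^sub>M M"
    and h_R: "\<And>j x. x \<in> space M \<Longrightarrow> (x, h j x) \<in> R"
    and h_range: "\<And>x. x \<in> X \<Longrightarrow> R `` {x} = range (\<lambda>j. h j x)"
begin

lemma R_space: "(x, y) \<in> R \<Longrightarrow> x \<in> space M \<and> y \<in> space M"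
  using equiv_R unfolding equiv_def by auto

lemma R_refl: "x \<in> space M \<Longrightarrow> (x, x) \<in> R"
  using equiv_R unfolding equiv_def refl_on_def by auto

lemma R_sym: "(x, y) \<in> R \<Longrightarrow> (y, x) \<in> R"
  using equiv_R unfolding equiv_def by (meson symD)

lemma R_trans: "(x, y) \<in> R \<Longrightarrow> (y, z) \<in> R \<Longrightarrow> (x, z) \<in> R"
  using equiv_R unfolding equiv_def by (meson transD)

lemma X_space: "x \<in> X \<Longrightarrow> x \<in> space M"
  using sets.sets_into_space[OF X_sets] by auto

lemma R_enum: "x \<in> X \<Longrightarrow> (x, y) \<in> R \<Longrightarrow> \<exists>j. y = h j x"
  using h_range[of x] by auto

lemma class_all: "x \<in> X \<Longrightarrow> (\<forall>y\<in>R `` {x}. P y) \<longleftrightarrow> (\<forall>j. P (h j x))"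
  by (simp add: h_range)

lemma class_ex: "x \<in> X \<Longrightarrow> (\<exists>y\<in>R `` {x}. P y) \<longleftrightarrow> (\<exists>j. P (h j x))"
  by (simp add: h_range)

lemma separated_points: "x \<in> space M \<Longrightarrow> y \<in> space M \<Longrightarrow> x \<noteq> y \<Longrightarrow> \<exists>n. x \<in> U n \<and> y \<notin> U n"
  using U_isolates[of "{y}" x] by auto

lemma measurable_eq [measurable (raw)]:
  "f \<in> N \<rightarrow>\<^sub>M M \<Longrightarrow> g \<in> N \<rightarrow>\<^sub>M M \<Longrightarrow> Measurable.pred N (\<lambda>x. f x = g x)"
  by (rule separated_eq_measurable[OF U_sets separated_points])

text \<open>Because \<open>S\<close> is disjoint from its image, \<open>f\<close> on \<open>S\<close> and its inverse \<open>g\<close> on the image combine to an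
involution of the whole space, to which the invariance of the measure applies. The image is written
as a preimage under \<open>g\<close> so that its measurability is evident.\<close>
lemma displaced_isomorphism_preserves:
  assumes [measurable]: "S \<in> sets M" "f \<in> M \<rightarrow>\<^sub>M M" "g \<in> M \<rightarrow>\<^sub>M M"
    and gf: "\<And>x. x \<in> S \<Longrightarrow> g (f x) = x" and fR: "\<And>x. x \<in> S \<Longrightarrow> (x, f x) \<in> R"
    and disj: "\<And>x. x \<in> S \<Longrightarrow> f x \<notin> S"
  shows "emeasure M {y \<in> space M. g y \<in> S \<and> f (g y) = y} = emeasure M S"
proof -
  define I where "I = {y \<in> space M. g y \<in> S \<and> f (g y) = y}"
  have I[measurable]: "I \<in> sets M" unfolding I_def by measurable
  have S_space: "x \<in> S \<Longrightarrow> x \<in> space M" for x using sets.sets_into_space[OF assms(1)] by auto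
  have fS: "x \<in> S \<Longrightarrow> f x \<in> I" for x
    using R_space[OF fR[of x]] gf[of x] by (auto simp: I_def)
  have gI: "y \<in> I \<Longrightarrow> g y \<in> S \<and> f (g y) = y" for y by (auto simp: I_def)
  have SI: "S \<inter> I = {}" using disj gI by force
  define \<phi> where "\<phi> x = (if x \<in> S then f x else if x \<in> I then g x else x)" for x
  have \<phi>_meas: "\<phi> \<in> M \<rightarrow>\<^sub>M M" unfolding \<phi>_def by measurable
  have \<phi>\<phi>: "\<phi> (\<phi> x) = x" for x
    using fS[of x] gI[of x] gf[of x] SI by (auto simp: \<phi>_def)
  have \<phi>R: "(x, \<phi> x) \<in> R" if "x \<in> space M" for x
    using fR[of x] fR[of "g x"] gI[of x] that by (auto simp: \<phi>_def intro: R_refl R_sym)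
  have \<phi>_space: "\<phi> x \<in> space M" if "x \<in> space M" for x using R_space[OF \<phi>R[OF that]] by simp
  have bij: "bij_betw \<phi> (space M) (space M)"
    by (rule bij_betw_byWitness[where f' = \<phi>]) (use \<phi>\<phi> \<phi>_space in auto)
  have "the_inv_into (space M) \<phi> x = \<phi> x" if "x \<in> space M" for x
    using bij that \<phi>\<phi> \<phi>_space by (intro the_inv_into_f_eq) (auto simp: bij_betw_def)
  then have "the_inv_into (space M) \<phi> \<in> M \<rightarrow>\<^sub>M M"
    using \<phi>_meas by (subst measurable_cong) auto
  then have "distr M M \<phi> = M"
    using invariant bij \<phi>_meas \<phi>R unfolding invariant_measure_def borel_isomorphism_def by blast
  then have "emeasure M I = emeasure (distr M M \<phi>) I" by simp
  also have "\<dots> = emeasure M (\<phi> -` I \<inter> space M)" by (rule emeasure_distr[OF \<phi>_meas I])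
  also have "\<phi> -` I \<inter> space M = S"
  proof (intro equalityI subsetI)
    fix x assume "x \<in> \<phi> -` I \<inter> space M"
    then have "\<phi> x \<in> I" by simp
    moreover have "\<phi> x \<notin> S" using \<open>\<phi> x \<in> I\<close> SI by auto
    ultimately have "\<phi> (\<phi> x) = g (\<phi> x)" "g (\<phi> x) \<in> S" using gI by (auto simp: \<phi>_def)
    then show "x \<in> S" using \<phi>\<phi> by simp
  next
    fix x assume "x \<in> S" then show "x \<in> \<phi> -` I \<inter> space M" using fS S_space by (auto simp: \<phi>_def)
  qed
  finally show ?thesis unfolding I_def .
qed

text \<open>A point moved by \<open>f\<close> is separated from its image by some set \<open>U m\<close>. This cuts \<open>S\<close> into the fixed points
and countably many pieces that are disjoint from their images.\<close>
lemma partial_isomorphism_preserves: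
  assumes [measurable]: "S \<in> sets M" "f \<in> M \<rightarrow>\<^sub>M M" "g \<in> M \<rightarrow>\<^sub>M M"
    and gf: "\<And>x. x \<in> S \<Longrightarrow> g (f x) = x" and fR: "\<And>x. x \<in> S \<Longrightarrow> (x, f x) \<in> R"
  shows "emeasure M {y \<in> space M. g y \<in> S \<and> f (g y) = y} = emeasure M S"
proof -
  define moved where "moved m x \<longleftrightarrow> x \<in> U m \<and> f x \<notin> U m" for m x
  define P where "P n = (if n = 0 then {x \<in> S. f x = x}
      else {x \<in> S. moved (n - 1) x \<and> (\<forall>m < n - 1. \<not> moved m x)})" for n
  have P_meas[measurable]: "P n \<in> sets M" for n
    unfolding P_def moved_def by (cases n) simp_all
  have S_space: "x \<in> S \<Longrightarrow> x \<in> space M" for x using sets.sets_into_space[OF assms(1)] by auto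
  have P_sub: "P n \<subseteq> S" for n by (auto simp: P_def)
  have not_moved: "f x \<noteq> x" if "moved m x" for m x using that by (auto simp: moved_def)
  have P_disj: "disjoint_family P"
    unfolding disjoint_family_on_def
  proof (intro ballI impI)
    fix a b :: nat assume "a \<noteq> b"
    then consider "a < b" | "b < a" by linarith
    then show "P a \<inter> P b = {}"
      by cases (auto simp: P_def not_moved split: if_splits)
  qed
  have P_cover: "S = (\<Union>n. P n)"
  proof (intro equalityI subsetI)
    fix x assume x: "x \<in> S"
    show "x \<in> (\<Union>n. P n)"
    proof (cases "f x = x")
      case True then show ?thesis using x by (intro UN_I[of 0]) (auto simp: P_def)
    next
      case False
      then have "\<exists>m. moved m x"
        using separated_points[of x "f x"] R_space[OF fR[OF x]] by (auto simp: moved_def)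
      then obtain m where m: "moved m x" "\<And>k. k < m \<Longrightarrow> \<not> moved k x"
        using exists_least_iff[of "\<lambda>m. moved m x"] by blast
      then have "x \<in> P (Suc m)" using x by (simp add: P_def)
      then show ?thesis by blast
    qed
  qed (use P_sub in auto)
  define I where "I n = {y \<in> space M. g y \<in> P n \<and> f (g y) = y}" for n
  have I_meas[measurable]: "I n \<in> sets M" for n unfolding I_def by measurable
  have I_eq: "emeasure M (I n) = emeasure M (P n)" for n
  proof (cases n)
    case 0
    have "I 0 = P 0"
    proof (intro equalityI subsetI)
      fix y assume "y \<in> I 0"
      then have y: "g y \<in> P 0" "f (g y) = y" by (simp_all add: I_def)
      then have "g y = y" by (simp add: P_def)
      then show "y \<in> P 0" using y(1) by simp
    next
      fix y assume "y \<in> P 0"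
      then have y: "y \<in> S" "f y = y" by (simp_all add: P_def)
      moreover have "g y = y" using gf[OF y(1)] y(2) by simp
      ultimately show "y \<in> I 0" using S_space by (simp add: I_def P_def)
    qed
    then show ?thesis using 0 by simp
  next
    case (Suc m)
    show ?thesis unfolding I_def
    proof (rule displaced_isomorphism_preserves)
      show "g (f x) = x" "(x, f x) \<in> R" if "x \<in> P n" for x using that P_sub gf fR by auto
      show "f x \<notin> P n" if "x \<in> P n" for x using that Suc by (auto simp: P_def moved_def)
    qed auto
  qed
  have "{y \<in> space M. g y \<in> S \<and> f (g y) = y} = (\<Union>n. I n)"
    unfolding I_def by (subst P_cover) auto
  moreover have "disjoint_family I"
    using P_disj unfolding disjoint_family_on_def I_def by blast
  ultimately have "emeasure M {y \<in> space M. g y \<in> S \<and> f (g y) = y} = (\<Sum>n. emeasure M (I n))"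
    by (simp add: suminf_emeasure image_subset_iff)
  also have "\<dots> = (\<Sum>n. emeasure M (P n))" by (simp add: I_eq)
  also have "\<dots> = emeasure M S"
    using suminf_emeasure[of P M] P_disj P_cover by (simp add: image_subset_iff)
  finally show ?thesis .
qed

text \<open>The points sent into \<open>N\<close> by \<open>h i\<close> and back by \<open>h j\<close> are mapped injectively into \<open>N\<close>, so they form a null
set. Every equivalence to a point of \<open>N\<close> is of this kind.\<close>
lemma null_set_saturation:
  assumes N: "N \<in> null_sets M"
  shows "AE x in M. \<forall>y\<in>R `` {x}. y \<notin> N"
proof -
  have [measurable]: "N \<in> sets M" using N by auto
  have "AE x in M. \<not> (h i x \<in> N \<and> h j (h i x) = x)" for i j
  proof -
    let ?S = "{x \<in> space M. h i x \<in> N \<and> h j (h i x) = x}"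
    have "emeasure M {y \<in> space M. h j y \<in> ?S \<and> h i (h j y) = y} = emeasure M ?S"
      by (rule partial_isomorphism_preserves) (auto intro: h_R)
    moreover have "emeasure M {y \<in> space M. h j y \<in> ?S \<and> h i (h j y) = y} \<le> emeasure M N"
      by (rule emeasure_mono) auto
    ultimately have "emeasure M ?S = 0" using N by (simp add: null_setsD1)
    then show ?thesis by (subst AE_iff_measurable[OF _ refl]) auto
  qed
  then have "AE x in M. \<forall>i j. \<not> (h i x \<in> N \<and> h j (h i x) = x)"
    unfolding AE_all_countable by blast
  with X_conull show ?thesis
  proof eventually_elim
    case (elim x)
    show ?case
    proof
      fix y assume "y \<in> R `` {x}"
      then have xy: "(x, y) \<in> R" by simp
      obtain i where i: "y = h i x" using R_enum[OF elim(1) xy] by blast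
      obtain j where "x = h j y" using R_enum[OF X_saturated[OF elim(1) xy] R_sym[OF xy]] by blast
      then show "y \<notin> N" using elim(2) i by metis
    qed
  qed
qed

lemma AE_saturate:
  assumes "AE x in M. P x"
  shows "AE x in M. \<forall>y\<in>R `` {x}. P y"
proof -
  obtain N where N: "{x \<in> space M. \<not> P x} \<subseteq> N" "N \<in> null_sets M"
    using AE_E[OF assms] by (metis null_setsI)
  from null_set_saturation[OF N(2)] show ?thesis
    by eventually_elim (use N(1) R_space in blast)
qed

lemma conull_saturated_subset:
  assumes "AE x in M. P x"
  obtains Y where "Y \<in> sets M" "Y \<subseteq> X" "AE x in M. x \<in> Y"
    "\<And>x y. x \<in> Y \<Longrightarrow> (x, y) \<in> R \<Longrightarrow> y \<in> Y" "\<And>x. x \<in> Y \<Longrightarrow> P x"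
proof -
  obtain N where N: "{x \<in> space M. \<not> P x} \<subseteq> N" "N \<in> null_sets M"
    using AE_E[OF assms] by (metis null_setsI)
  have [measurable]: "N \<in> sets M" using N by auto
  define Y where "Y = {x \<in> X. \<forall>j. h j x \<notin> N}"
  have Y_iff: "x \<in> Y \<longleftrightarrow> x \<in> X \<and> (\<forall>y\<in>R `` {x}. y \<notin> N)" for x
    by (cases "x \<in> X") (simp_all add: Y_def class_all)
  show thesis
  proof (rule that[of Y])
    show "Y \<in> sets M" unfolding Y_def by measurable
    show "Y \<subseteq> X" unfolding Y_def by auto
    show "AE x in M. x \<in> Y"
      using X_conull null_set_saturation[OF N(2)] by eventually_elim (simp add: Y_iff)
    show "y \<in> Y" if "x \<in> Y" "(x, y) \<in> R" for x y
      using that X_saturated[of x y] R_trans[of x y] unfolding Y_iff by blast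
    show "P x" if "x \<in> Y" for x
      using that N(1) R_refl[of x] X_space[of x] unfolding Y_iff by blast
  qed
qed

lemma restrict_enumeration:
  assumes "Y \<in> sets M" "Y \<subseteq> X" "AE x in M. x \<in> Y" "\<And>x y. x \<in> Y \<Longrightarrow> (x, y) \<in> R \<Longrightarrow> y \<in> Y"
  shows "enumerated_relation M R Y h U"
proof
  show "R `` {x} = range (\<lambda>j. h j x)" if "x \<in> Y" for x using h_range assms(2) that by blast
  show "y \<in> Y" if "x \<in> Y" "(x, y) \<in> R" for x y by (rule assms(4)[OF that])
qed (use equiv_R invariant U_isolates assms(1,3) h_R in auto)

text \<open>Let \<open>E i\<close> be the set of points \<open>z\<close> for which \<open>h i z\<close> is a new element of the fibre of \<open>p\<close> over \<open>z\<close>. The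
map \<open>h i\<close> is injective on \<open>E i\<close>, since \<open>p\<close> inverts it, and the images for different \<open>i\<close> are disjoint.
Thus the measures of the sets \<open>E i\<close> have a finite sum, and the Borel--Cantelli lemma applies.\<close>
lemma finite_fibres:
  assumes [measurable]: "p \<in> M \<rightarrow>\<^sub>M M" and pR: "\<And>x. x \<in> space M \<Longrightarrow> (x, p x) \<in> R"
  shows "AE z in M. finite {x \<in> space M. p x = z}"
proof -
  define E where "E i = {z \<in> X. p (h i z) = z \<and> (\<forall>j<i. h j z \<noteq> h i z)}" for i
  have E_meas[measurable]: "E i \<in> sets M" for i unfolding E_def by measurable
  define I where "I i = {y \<in> space M. p y \<in> E i \<and> h i (p y) = y}" for i
  have I_meas[measurable]: "I i \<in> sets M" for i unfolding I_def by measurable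
  have EI: "emeasure M (I i) = emeasure M (E i)" for i
    unfolding I_def by (rule partial_isomorphism_preserves) (auto simp: E_def intro: h_R X_space)
  have "disjoint_family I"
    unfolding disjoint_family_on_def
  proof (intro ballI impI)
    fix a b :: nat assume "a \<noteq> b"
    then consider "a < b" | "b < a" by linarith
    then show "I a \<inter> I b = {}"
      by cases (auto simp: I_def E_def)
  qed
  then have "summable (\<lambda>i. measure M (I i))"
    by (intro sums_summable[OF finite_measure_UNION]) auto
  then have "summable (\<lambda>i. measure M (E i))" using EI by (simp add: measure_def)
  then have "AE z in M. eventually (\<lambda>i. z \<in> space M - E i) sequentially"
    by (intro borel_cantelli_AE1) (auto simp: emeasure_finite less_top[symmetric])
  with X_conull show ?thesis
  proof eventually_elim
    case (elim z)
    obtain n where n: "\<And>i. i \<ge> n \<Longrightarrow> z \<notin> E i"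
      using elim(2) unfolding eventually_sequentially by auto
    have "{x \<in> space M. p x = z} \<subseteq> (\<lambda>i. h i z) ` {..<n}"
    proof
      fix x assume "x \<in> {x \<in> space M. p x = z}"
      then have x: "x \<in> space M" "p x = z" by auto
      then have "(z, x) \<in> R" using pR R_sym by blast
      then have ex: "\<exists>j. x = h j z" by (rule R_enum[OF elim(1)])
      define i where "i = (LEAST j. x = h j z)"
      have i: "x = h i z" unfolding i_def using ex by (rule LeastI_ex)
      moreover have "h j z \<noteq> h i z" if "j < i" for j
        using not_less_Least[of j "\<lambda>j. x = h j z"] that i unfolding i_def by auto
      ultimately have "z \<in> E i" using elim(1) x by (auto simp: E_def)
      then have "i < n" using n[of i] by (meson not_le)
      then show "x \<in> (\<lambda>i. h i z) ` {..<n}" using i by auto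
    qed
    then show ?case by (rule finite_subset) auto
  qed
qed

text \<open>The form in which mass transport is used: \<open>Q\<close> offers each \<open>y\<close> some targets in its class and \<open>y\<close> selects
the first one. A finite set \<open>F\<close> receives finite mass, so only finitely many points can have all
their targets in \<open>F\<close>.\<close>
lemma finite_selected:
  assumes [measurable]: "Q \<in> sets (M \<Otimes>\<^sub>M M)" and QR: "Q \<subseteq> R"
  shows "AE x in M. \<forall>F. finite F \<longrightarrow> finite {y \<in> R `` {x}. Q `` {y} \<noteq> {} \<and> Q `` {y} \<subseteq> F}"
proof -
  define p where "p y = (if \<exists>j. (y, h j y) \<in> Q then h (LEAST j. (y, h j y) \<in> Q) y else y)" for y
  have "(\<lambda>y. h (LEAST j. (y, h j y) \<in> Q) y) \<in> M \<rightarrow>\<^sub>M M"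
    by (rule measurable_compose_countable[where f = h]) measurable
  then have p_meas: "p \<in> M \<rightarrow>\<^sub>M M" unfolding p_def by measurable
  have pR: "(x, p x) \<in> R" if "x \<in> space M" for x
    using that by (auto simp: p_def intro: h_R R_refl)
  have pQ: "(y, p y) \<in> Q" if y: "y \<in> X" "Q `` {y} \<noteq> {}" for y
  proof -
    obtain z where "(y, z) \<in> Q" using y by auto
    then have ex: "\<exists>j. (y, h j y) \<in> Q" using R_enum[of y z] y QR by blast
    then show ?thesis using LeastI_ex[OF ex] by (simp add: p_def)
  qed
  have "AE z in M. finite {x \<in> space M. p x = z}"
    by (rule finite_fibres[OF p_meas pR])
  from AE_saturate[OF this] X_conull show ?thesis
  proof eventually_elim
    case (elim x)
    show ?case
    proof (intro allI impI)
      fix F :: "'x set" assume F: "finite F"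
      have "{y \<in> R `` {x}. Q `` {y} \<noteq> {} \<and> Q `` {y} \<subseteq> F} \<subseteq>
        (\<Union>z\<in>F \<inter> R `` {x}. {y \<in> space M. p y = z})"
      proof
        fix y assume "y \<in> {y \<in> R `` {x}. Q `` {y} \<noteq> {} \<and> Q `` {y} \<subseteq> F}"
        then have y: "(x, y) \<in> R" "Q `` {y} \<noteq> {}" "Q `` {y} \<subseteq> F" by auto
        then have "(y, p y) \<in> Q" using pQ X_saturated elim(2) by blast
        then show "y \<in> (\<Union>z\<in>F \<inter> R `` {x}. {y \<in> space M. p y = z})"
          using y(3) QR R_trans[OF y(1)] R_space[OF y(1)] by (intro UN_I[of "p y"]) auto
      qed
      moreover have "finite (\<Union>z\<in>F \<inter> R `` {x}. {y \<in> space M. p y = z})"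
        using F elim(1) by blast
      ultimately show "finite {y \<in> R `` {x}. Q `` {y} \<noteq> {} \<and> Q `` {y} \<subseteq> F}"
        by (rule finite_subset)
    qed
  qed
qed

text \<open>The saturation of \<open>A\<close> inside \<open>X\<close> is an invariant Borel set of positive measure.\<close>
lemma positive_set_meets_classes:
  assumes "ergodic_relation M R" and [measurable]: "A \<in> sets M" and pos: "emeasure M A > 0"
  shows "AE x in M. \<exists>y\<in>R `` {x}. y \<in> A"
proof -
  define Y where "Y = {x \<in> X. \<exists>j. h j x \<in> A}"
  have [measurable]: "Y \<in> sets M" unfolding Y_def by measurable
  have Y_iff: "x \<in> Y \<longleftrightarrow> x \<in> X \<and> (\<exists>y\<in>R `` {x}. y \<in> A)" for x
    by (cases "x \<in> X") (simp_all add: Y_def class_ex)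
  have "R `` Y = Y"
  proof (intro equalityI subsetI)
    fix y assume "y \<in> R `` Y"
    then obtain x where x: "x \<in> Y" "(x, y) \<in> R" by auto
    then obtain z where z: "(x, z) \<in> R" "z \<in> A" by (auto simp: Y_iff)
    have "(y, z) \<in> R" by (rule R_trans[OF R_sym[OF x(2)] z(1)])
    then show "y \<in> Y" using x z(2) X_saturated[of x y] unfolding Y_iff by auto
  next
    fix y assume y: "y \<in> Y"
    then have "y \<in> X" by (simp add: Y_iff)
    then show "y \<in> R `` Y" using R_refl[OF X_space] y by (intro ImageI)
  qed
  then have "measure M Y = 0 \<or> measure M Y = 1"
    using assms(1) \<open>Y \<in> sets M\<close> unfolding ergodic_relation_def by blast
  moreover have "measure M Y \<noteq> 0"
  proof
    assume "measure M Y = 0"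
    then have "AE x in M. x \<notin> Y"
      by (subst AE_iff_measurable[OF _ refl]) (auto simp: emeasure_eq_measure Collect_conj_eq Int_absorb1 sets.sets_into_space)
    with X_conull have "AE x in M. x \<notin> A"
      by eventually_elim (use R_refl X_space in \<open>auto simp: Y_iff\<close>)
    then have "emeasure M A = 0"
      by (subst (asm) AE_iff_measurable[OF _ refl]) (auto simp: Collect_conj_eq Int_absorb1 sets.sets_into_space)
    then show False using pos by simp
  qed
  ultimately have "AE x in M. x \<in> Y" by (simp add: AE_in_set_eq_1)
  then show ?thesis by eventually_elim (simp add: Y_iff)
qed


text \<open>A point of \<open>A\<close> has finitely many neighbours within distance \<open>c\<close>, and some base set \<open>U n\<close> contains the
point but none of them. The points of \<open>A\<close> for which a given \<open>U n\<close> does this form a separated set, and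
these countably many sets cover \<open>A\<close>.\<close>
lemma separated_subset:
  fixes d :: "'x \<Rightarrow> 'x \<Rightarrow> real"
  assumes [measurable]: "(\<lambda>(x, y). d x y) \<in> borel_measurable (M \<Otimes>\<^sub>M M)" "A \<in> sets M"
    and "A \<subseteq> X" and pos: "emeasure M A > 0"
    and proper: "\<And>x c. x \<in> X \<Longrightarrow> finite {y \<in> R `` {x}. d x y \<le> c}"
  obtains A' where "A' \<in> sets M" "A' \<subseteq> A" "emeasure M A' > 0"
    "\<And>x y. x \<in> A' \<Longrightarrow> y \<in> A' \<Longrightarrow> (x, y) \<in> R \<Longrightarrow> x \<noteq> y \<Longrightarrow> d x y > c"
proof -
  define B where "B n = {x \<in> A \<inter> U n. \<forall>j. h j x \<noteq> x \<and> d x (h j x) \<le> c \<longrightarrow> h j x \<notin> U n}" for n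
  have A_space: "x \<in> A \<Longrightarrow> x \<in> space M" for x using sets.sets_into_space[OF assms(2)] by auto
  have B_meas[measurable]: "B n \<in> sets M" for n unfolding B_def by measurable
  have "A = (\<Union>n. B n)"
  proof (intro equalityI subsetI)
    fix x assume x: "x \<in> A"
    let ?F = "{y \<in> R `` {x}. d x y \<le> c} - {x}"
    have xX: "x \<in> X" using x \<open>A \<subseteq> X\<close> by auto
    have "finite ?F" using proper[OF xX] by auto
    moreover have "?F \<subseteq> space M" using R_space by auto
    ultimately obtain n where n: "x \<in> U n" "U n \<inter> ?F = {}"
      using U_isolates[of ?F x] A_space[OF x] by auto
    have "(x, h j x) \<in> R" for j using h_R A_space[OF x] by auto
    then have "x \<in> B n" using x n unfolding B_def by auto
    then show "x \<in> (\<Union>n. B n)" by auto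
  qed (auto simp: B_def)
  have "\<exists>n. emeasure M (B n) > 0"
  proof (rule ccontr)
    assume "\<not> ?thesis"
    then have "\<And>n. emeasure M (B n) = 0" by (simp add: zero_less_iff_neq_zero)
    then have "(\<Union>n. B n) \<in> null_sets M" by (intro null_sets_UN) (auto simp: null_sets_def)
    then show False using pos \<open>A = (\<Union>n. B n)\<close> by (simp add: null_setsD1)
  qed
  then obtain n where n: "emeasure M (B n) > 0" ..
  show thesis
  proof (rule that[of "B n"])
    fix x y assume xy: "x \<in> B n" "y \<in> B n" "(x, y) \<in> R" "x \<noteq> y"
    then have "x \<in> X" using \<open>A \<subseteq> X\<close> by (auto simp: B_def)
    then obtain j where "y = h j x" using R_enum xy(3) by blast
    then show "d x y > c" using xy unfolding B_def by force
  qed (use n in \<open>auto simp: B_def\<close>)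
qed

section \<open>Tail equivalence relations\<close>

lemma measurable_funpow [measurable]:
  assumes "f \<in> M \<rightarrow>\<^sub>M M"
  shows "(f ^^ n) \<in> M \<rightarrow>\<^sub>M M"
proof (induction n)
  case (Suc n)
  then show ?case using measurable_comp[OF _ assms, of "f ^^ n" M] by (simp add: comp_def)
qed (simp add: measurable_ident[unfolded id_def] id_def)

lemma INFM_shift: "(\<exists>\<^sub>\<infinity>j::nat. P (j + m)) \<longleftrightarrow> (\<exists>\<^sub>\<infinity>j. P j)"
  unfolding INFM_nat
proof (intro iffI allI)
  fix a assume "\<forall>b. \<exists>j>b. P (j + m)"
  then obtain j where "j > a" "P (j + m)" by blast
  then show "\<exists>j>a. P j" by (intro exI[of _ "j + m"]) simp
next
  fix a assume "\<forall>b. \<exists>j>b. P j"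
  then obtain j where "j > a + m" "P j" by blast
  then show "\<exists>j>a. P (j + m)" by (intro exI[of _ "j - m"]) simp
qed

text \<open>Markers on the forward orbits of \<open>f\<close>. The sets \<open>U 0, U 1, \<dots>\<close> are treated as digits: the first \<open>n\<close>
digits accepted for the orbit of \<open>x\<close> are chosen so that infinitely many points \<open>(f ^^ j) x\<close> have them,
preferring membership in \<open>U i\<close>, and \<open>marker f n k x\<close> says that \<open>(f ^^ k) x\<close> has the chosen digits. The
choice depends on the tail of the orbit only.\<close>
fun marker :: "('x \<Rightarrow> 'x) \<Rightarrow> nat \<Rightarrow> nat \<Rightarrow> 'x \<Rightarrow> bool" where
  "marker f 0 k x \<longleftrightarrow> True"
| "marker f (Suc n) k x \<longleftrightarrow> marker f n k x \<and>
     ((f ^^ k) x \<in> U n \<longleftrightarrow> (\<exists>\<^sub>\<infinity>j. marker f n j x \<and> (f ^^ j) x \<in> U n))"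

lemma marker_shift: "marker f n k (f x) = marker f n (Suc k) x"
proof (induction n arbitrary: k)
  case (Suc n)
  have "(\<exists>\<^sub>\<infinity>j. marker f n j (f x) \<and> (f ^^ j) (f x) \<in> U n) \<longleftrightarrow>
    (\<exists>\<^sub>\<infinity>j. marker f n (Suc j) x \<and> (f ^^ Suc j) x \<in> U n)"
    by (simp only: Suc funpow_Suc_right comp_apply)
  also have "\<dots> \<longleftrightarrow> (\<exists>\<^sub>\<infinity>j. marker f n j x \<and> (f ^^ j) x \<in> U n)"
    using INFM_shift[of "\<lambda>j. marker f n j x \<and> (f ^^ j) x \<in> U n" 1] by simp
  finally show ?case
    by (simp only: marker.simps Suc funpow_Suc_right comp_apply)
qed simp

lemma marker_funpow: "marker f n k ((f ^^ m) x) = marker f n (k + m) x"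
proof (induction m arbitrary: x)
  case (Suc m)
  have "marker f n k ((f ^^ Suc m) x) = marker f n k ((f ^^ m) (f x))"
    by (simp only: funpow_Suc_right comp_apply)
  also have "\<dots> = marker f n (k + m) (f x)" by (rule Suc)
  also have "\<dots> = marker f n (k + Suc m) x" by (simp add: marker_shift)
  finally show ?case .
qed simp

lemma marker_infinitely_often: "\<exists>\<^sub>\<infinity>k. marker f n k x"
proof (induction n)
  case (Suc n)
  show ?case
  proof (cases "\<exists>\<^sub>\<infinity>j. marker f n j x \<and> (f ^^ j) x \<in> U n")
    case True
    then show ?thesis by (rule INFM_mono) (use True in simp)
  next
    case False
    have "\<exists>\<^sub>\<infinity>j. marker f n j x \<and> (f ^^ j) x \<notin> U n"
    proof -
      have "\<exists>\<^sub>\<infinity>j. (marker f n j x \<and> (f ^^ j) x \<in> U n) \<or> (marker f n j x \<and> (f ^^ j) x \<notin> U n)"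
        using Suc by (rule INFM_mono) blast
      then show ?thesis using False unfolding INFM_disj_distrib by blast
    qed
    then show ?thesis by (rule INFM_mono) (use False in simp)
  qed
qed (simp add: INFM_nat gt_ex)

lemma marker_measurable:
  assumes [measurable]: "f \<in> M \<rightarrow>\<^sub>M M"
  shows "Measurable.pred M (marker f n k)"
proof (induction n arbitrary: k)
  case (Suc n)
  note [measurable] = Suc
  have "marker f (Suc n) k = (\<lambda>x. marker f n k x \<and>
     ((f ^^ k) x \<in> U n \<longleftrightarrow> (\<exists>\<^sub>\<infinity>j. marker f n j x \<and> (f ^^ j) x \<in> U n)))"
    by (rule ext) simp
  then show ?case unfolding INFM_nat by simp
next
  case 0
  have "marker f 0 k = (\<lambda>_. True)" by (rule ext) simp
  then show ?case by simp
qed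

lemma marker_decreasing: "m \<le> n \<Longrightarrow> marker f n k x \<Longrightarrow> marker f m k x"
  by (induction n) (auto simp: le_Suc_eq)

text \<open>Points of the same tail class that are marked at all levels have the same digits, and the sets
\<open>U i\<close> separate points.\<close>
lemma marker_tail_unique:
  assumes "(f ^^ m) x = (f ^^ n) y" "\<And>i. marker f i 0 x" "\<And>i. marker f i 0 y" "x \<in> space M" "y \<in> space M"
  shows "x = y"
proof (rule ccontr)
  assume "x \<noteq> y"
  have tail: "(\<exists>\<^sub>\<infinity>j. marker f i j x \<and> (f ^^ j) x \<in> U i) \<longleftrightarrow>
      (\<exists>\<^sub>\<infinity>j. marker f i j ((f ^^ m) x) \<and> (f ^^ j) ((f ^^ m) x) \<in> U i)" for i m x
    using INFM_shift[of "\<lambda>j. marker f i j x \<and> (f ^^ j) x \<in> U i" m]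
    by (simp add: marker_funpow funpow_add)
  have "x \<in> U i \<longleftrightarrow> y \<in> U i" for i
    using assms(2)[of "Suc i"] assms(3)[of "Suc i"] tail[of i x m] tail[of i y n] assms(1) by simp
  then show False using separated_points[OF assms(4,5) \<open>x \<noteq> y\<close>] by blast
qed

text \<open>Let \<open>r n\<close> send a point to the first point of its forward orbit that is marked at level \<open>n\<close>. The
relations of equality under \<open>r n\<close> increase with \<open>n\<close>, because the markers decrease. They exhaust the tail
equivalence relation, because a point marked at all levels is alone in its class with this property,
so that the set of these points is null by mass transport and the finite segments before a
merging point contain no marker of high level. Their classes are finite, again by mass transport. Points
outside \<open>A\<close> are first sent to a point of \<open>A\<close> in their class.\<close>
theorem tail_relation_hyperfinite:
  assumes A_sets [measurable]: "A \<in> sets M" and "A \<subseteq> X" and f_meas [measurable]: "f \<in> M \<rightarrow>\<^sub>M M"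
    and fA: "\<And>x. x \<in> A \<Longrightarrow> f x \<in> A \<and> (x, f x) \<in> R"
    and aperiodic: "\<And>x. x \<in> A \<Longrightarrow> infinite (range (\<lambda>n. (f ^^ n) x))"
    and tail: "\<And>x y. x \<in> A \<Longrightarrow> y \<in> A \<Longrightarrow> (x, y) \<in> R \<Longrightarrow> \<exists>m n. (f ^^ m) x = (f ^^ n) y"
    and meets: "AE x in M. \<exists>y\<in>R `` {x}. y \<in> A"
  shows "hyperfinite M R"
proof -
  note marker_measurable[OF f_meas, measurable]
  have A_space: "x \<in> A \<Longrightarrow> x \<in> space M" for x using sets.sets_into_space[OF A_sets] by auto
  have fnA: "(f ^^ n) x \<in> A \<and> (x, (f ^^ n) x) \<in> R" if "x \<in> A" for x n
    using that by (induction n) (auto intro: R_refl A_space R_trans dest: fA)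
  define Z where "Z = {x \<in> A. \<forall>n. marker f n 0 x}"
  have Z_meas [measurable]: "Z \<in> sets M" unfolding Z_def by measurable
  have Z_unique: "x = y" if "x \<in> Z" "y \<in> Z" "(x, y) \<in> R" for x y
    using that tail[of x y] marker_tail_unique[of _ f x _ y] A_space unfolding Z_def by blast
  have Z_null: "AE x in M. x \<notin> Z"
  proof -
    define Q where "Q = {(y, z) \<in> R. z \<in> Z}"
    have "Q = R \<inter> (space M \<times> Z)" using R_space by (auto simp: Q_def)
    then have "Q \<in> sets (M \<Otimes>\<^sub>M M)" by simp
    from finite_selected[OF this] show ?thesis
    proof (rule AE_mp, goal_cases)
      case 2
      show ?case
      proof (rule AE_I2, intro impI notI)
        fix x assume fin: "\<forall>F. finite F \<longrightarrow> finite {y \<in> R `` {x}. Q `` {y} \<noteq> {} \<and> Q `` {y} \<subseteq> F}" and x: "x \<in> Z"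
        have xA: "x \<in> A" using x by (simp add: Z_def)
        have "range (\<lambda>n. (f ^^ n) x) \<subseteq> {y \<in> R `` {x}. Q `` {y} \<noteq> {} \<and> Q `` {y} \<subseteq> {x}}"
        proof
          fix y assume "y \<in> range (\<lambda>n. (f ^^ n) x)"
          then have xy: "(x, y) \<in> R" using fnA[OF xA] by auto
          have "z = x" if "(y, z) \<in> Q" for z
            using that Z_unique[OF x, of z] R_trans[OF xy, of z] by (auto simp: Q_def)
          moreover have "(y, x) \<in> Q" using R_sym[OF xy] x by (simp add: Q_def)
          ultimately have "Q `` {y} = {x}" by blast
          then show "y \<in> {y \<in> R `` {x}. Q `` {y} \<noteq> {} \<and> Q `` {y} \<subseteq> {x}}" using xy by simp
        qed
        moreover have "finite {y \<in> R `` {x}. Q `` {y} \<noteq> {} \<and> Q `` {y} \<subseteq> {x}}" using fin by simp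
        ultimately show False using aperiodic[OF xA] finite_subset by blast
      qed
    qed (auto simp: Q_def)
  qed
  define r where "r n x = (f ^^ (LEAST k. marker f n k x)) x" for n x
  have hit: "\<exists>k. marker f n k x" for n x
    using marker_infinitely_often[of f n x] unfolding INFM_nat by blast
  have r_step: "r n x = r n (f x)" if "\<not> marker f n 0 x" for n x
  proof -
    have "(LEAST k. marker f n k x) = Suc (LEAST k. marker f n (Suc k) x)"
    proof -
      obtain k where "marker f n k x" using hit by blast
      then show ?thesis using that by (rule Least_Suc[of "\<lambda>k. marker f n k x"])
    qed
    then show ?thesis unfolding r_def marker_shift by (simp only: funpow_Suc_right comp_apply)
  qed
  have r_steps: "r n x = r n ((f ^^ m) x)" if "\<forall>i<m. \<not> marker f n i x" for n m x
    using that
  proof (induction m)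
    case (Suc m)
    then have "r n x = r n ((f ^^ m) x)" by simp
    also have "\<dots> = r n (f ((f ^^ m) x))" by (rule r_step) (simp add: marker_funpow Suc.prems)
    finally show ?case by simp
  qed simp
  define p where "p x = h (LEAST j. h j x \<in> A) x" for x
  have p_meas [measurable]: "p \<in> M \<rightarrow>\<^sub>M M"
    unfolding p_def by (rule measurable_compose_countable[where f = h]) measurable
  have pR: "(x, p x) \<in> R" if "x \<in> space M" for x using that by (auto simp: p_def intro: h_R)
  have pA: "p x \<in> A" if "x \<in> X" "\<exists>y\<in>R `` {x}. y \<in> A" for x
  proof -
    have "\<exists>j. h j x \<in> A" using that(2) class_ex[OF that(1), of "\<lambda>y. y \<in> A"] by simp
    then show ?thesis unfolding p_def by (rule LeastI_ex)
  qed
  define \<rho>' where "\<rho>' n x = r n (p x)" for n x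
  define \<rho> where "\<rho> n x = (if p x \<in> A then \<rho>' n x else x)" for n x
  have r_meas [measurable]: "r n \<in> M \<rightarrow>\<^sub>M M" for n
    unfolding r_def by (rule measurable_compose_countable[where f = "\<lambda>k. f ^^ k"]) measurable
  have \<rho>_meas [measurable]: "\<rho> n \<in> M \<rightarrow>\<^sub>M M" for n unfolding \<rho>_def \<rho>'_def by measurable
  have rR: "(x, r n x) \<in> R" if "x \<in> A" for n x using fnA[OF that] by (simp add: r_def)
  have \<rho>R: "(x, \<rho> n x) \<in> R" if "x \<in> space M" for n x
    using that pR[OF that] rR[of "p x" n] R_refl R_trans by (auto simp: \<rho>_def \<rho>'_def)
  have "AE z in M. \<forall>n. finite {x \<in> space M. \<rho> n x = z}"
    unfolding AE_all_countable by (intro allI finite_fibres \<rho>R \<rho>_meas)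
  with Z_null meets have "AE x in M. x \<notin> Z \<and> (\<exists>y\<in>R `` {x}. y \<in> A) \<and> (\<forall>n. finite {y \<in> space M. \<rho> n y = x})"
    by eventually_elim blast
  then obtain Y where Y_meas [measurable]: "Y \<in> sets M" and Y: "Y \<subseteq> X" "AE x in M. x \<in> Y"
    "\<And>x y. x \<in> Y \<Longrightarrow> (x, y) \<in> R \<Longrightarrow> y \<in> Y"
    "\<And>x. x \<in> Y \<Longrightarrow> x \<notin> Z \<and> (\<exists>y\<in>R `` {x}. y \<in> A) \<and> (\<forall>n. finite {y \<in> space M. \<rho> n y = x})"
    by (rule conull_saturated_subset) (rule that)
  have Y_space: "x \<in> Y \<Longrightarrow> x \<in> space M" for x using Y(1) X_space by auto
  have Yp: "p x \<in> A" "\<rho> n x = r n (p x)" if "x \<in> Y" for x n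
    using pA[of x] Y(1) Y(4)[OF that] that by (auto simp: \<rho>_def \<rho>'_def)
  define S where "S n = {(x, y) \<in> R. x \<in> Y \<and> y \<in> Y \<and> \<rho> n x = \<rho> n y}" for n
  have S_meas: "S n \<in> sets (M \<Otimes>\<^sub>M M)" for n
  proof -
    have "S n = {q \<in> space (M \<Otimes>\<^sub>M M). q \<in> R \<and> fst q \<in> Y \<and> snd q \<in> Y \<and> \<rho> n (fst q) = \<rho> n (snd q)}"
      using R_space by (auto simp: S_def space_pair_measure)
    also have "\<dots> \<in> sets (M \<Otimes>\<^sub>M M)" by measurable
    finally show ?thesis .
  qed
  have S_equiv: "equiv Y (S n)" for n
  proof (rule equivI)
    show "S n \<subseteq> Y \<times> Y" by (auto simp: S_def)
    show "refl_on Y (S n)" by (auto simp: refl_on_def S_def intro: R_refl Y_space)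
    show "sym (S n)" by (rule symI) (auto simp: S_def intro: R_sym)
    show "trans (S n)"
    proof (rule transI)
      fix x y z assume "(x, y) \<in> S n" "(y, z) \<in> S n"
      then show "(x, z) \<in> S n" using R_trans[of x y z] by (simp add: S_def)
    qed
  qed
  have S_finite: "finite (S n `` {x})" if "x \<in> Y" for n x
  proof (rule finite_subset)
    show "S n `` {x} \<subseteq> {y \<in> space M. \<rho> n y = \<rho> n x}" using Y_space by (auto simp: S_def)
    have "\<rho> n x \<in> Y" using Y(3)[OF that \<rho>R[OF Y_space[OF that]]] .
    then show "finite {y \<in> space M. \<rho> n y = \<rho> n x}" using Y(4) by blast
  qed
  have S_mono: "S n \<subseteq> S (Suc n)" for n
  proof -
    have "\<rho> (Suc n) x = r (Suc n) (\<rho> n x)" if "x \<in> Y" for x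
    proof -
      have "\<forall>i<(LEAST k. marker f n k (p x)). \<not> marker f (Suc n) i (p x)"
        using not_less_Least by fastforce
      from r_steps[OF this] show ?thesis unfolding Yp(2)[OF that] by (simp add: r_def)
    qed
    then show ?thesis by (auto simp: S_def)
  qed
  have "R \<inter> (Y \<times> Y) = (\<Union>n. S n)"
  proof (intro equalityI subsetI)
    fix q assume "q \<in> R \<inter> (Y \<times> Y)"
    then obtain x y where q: "q = (x, y)" and xy: "(x, y) \<in> R" "x \<in> Y" "y \<in> Y" by auto
    have "(p x, p y) \<in> R" using pR[OF Y_space[OF xy(2)]] pR[OF Y_space[OF xy(3)]] xy(1)
      by (meson R_sym R_trans)
    then obtain k l where kl: "(f ^^ k) (p x) = (f ^^ l) (p y)"
      using tail[OF Yp(1)[OF xy(2)] Yp(1)[OF xy(3)]] by blast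
    have unmark: "\<exists>n. \<not> marker f n i (p z)" if z: "z \<in> Y" for i z
    proof -
      have "(z, (f ^^ i) (p z)) \<in> R" using fnA[OF Yp(1)[OF z]] pR[OF Y_space[OF z]] R_trans by blast
      then have "(f ^^ i) (p z) \<notin> Z" using Y(3,4) z by blast
      moreover have "(f ^^ i) (p z) \<in> A" using fnA[OF Yp(1)[OF z]] by blast
      ultimately show ?thesis by (auto simp: Z_def marker_funpow)
    qed
    define N where "N i z = (SOME n. \<not> marker f n i (p z))" for i z
    have N: "\<not> marker f (N i z) i (p z)" if "z \<in> Y" for i z
      unfolding N_def by (rule someI_ex[OF unmark[OF that]])
    define n where "n = Max ((\<lambda>i. N i x) ` {..k} \<union> (\<lambda>i. N i y) ` {..l})"
    have "N i x \<le> n" if "i < k" for i unfolding n_def using that by (intro Max_ge) auto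
    then have "\<forall>i<k. \<not> marker f n i (p x)" using N[OF xy(2)] marker_decreasing by blast
    from r_steps[OF this] have 1: "r n (p x) = r n ((f ^^ k) (p x))" .
    have "N i y \<le> n" if "i < l" for i unfolding n_def using that by (intro Max_ge) auto
    then have "\<forall>i<l. \<not> marker f n i (p y)" using N[OF xy(3)] marker_decreasing by blast
    from r_steps[OF this] have 2: "r n (p y) = r n ((f ^^ l) (p y))" .
    have "\<rho> n x = \<rho> n y" using 1 2 kl Yp(2) xy by simp
    then show "q \<in> (\<Union>n. S n)" using xy q by (auto simp: S_def)
  qed (auto simp: S_def)
  then show ?thesis
    unfolding hyperfinite_def using Y_meas Y(2) S_equiv S_meas S_finite S_mono by blast
qed

end

section \<open>Relations that fix a point at infinity\<close>

text \<open>The geometry of a class whose orbit points lie in a hyperbolic space with a distinguished boundary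
point \<open>\<xi>\<close>: \<open>d x y\<close> is the distance of the orbit points and \<open>G w y\<close> is \<open>(y|\<xi>)\<close> based at \<open>w\<close>. The inequality
\<open>G_hyperbolic\<close> is hyperbolicity for the three points \<open>p\<close>, \<open>q\<close> and \<open>\<xi>\<close> seen from \<open>w\<close>, and \<open>G_opposite\<close>
expresses that \<open>(p|\<xi>)\<close> at \<open>w\<close> and \<open>(w|\<xi>)\<close> at \<open>p\<close> add up to the distance. If \<open>G w y\<close> is small, \<open>w\<close> is
near the ray from \<open>y\<close> to \<open>\<xi>\<close>.\<close>
locale horospherical_relation = enumerated_relation M R X h U
  for M :: "'x measure" and R X h U +
  fixes d G :: "'x \<Rightarrow> 'x \<Rightarrow> real" and \<delta> :: real
  assumes d_measurable [measurable]: "(\<lambda>(x, y). d x y) \<in> borel_measurable (M \<Otimes>\<^sub>M M)"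
    and G_measurable [measurable]: "(\<lambda>(x, y). G x y) \<in> borel_measurable (M \<Otimes>\<^sub>M M)"
    and \<delta>_nonneg: "\<delta> \<ge> 0"
    and d_proper: "\<And>x c. x \<in> X \<Longrightarrow> finite {y \<in> R `` {x}. d x y \<le> c}"
    and d_nonneg: "\<And>x y. x \<in> X \<Longrightarrow> (x, y) \<in> R \<Longrightarrow> 0 \<le> d x y"
    and d_self: "\<And>x. x \<in> X \<Longrightarrow> d x x = 0"
    and d_sym: "\<And>x y. x \<in> X \<Longrightarrow> (x, y) \<in> R \<Longrightarrow> d x y = d y x"
    and d_triangle: "\<And>x y z. x \<in> X \<Longrightarrow> (x, y) \<in> R \<Longrightarrow> (x, z) \<in> R \<Longrightarrow> d x z \<le> d x y + d y z"
    and G_hyperbolic: "\<And>w p q. w \<in> X \<Longrightarrow> (w, p) \<in> R \<Longrightarrow> (w, q) \<in> R \<Longrightarrow>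
      G w p \<le> G w q + \<delta> \<or> d p w + d q w - d p q \<le> 2 * (G w q + \<delta>)"
    and G_opposite: "\<And>w p. w \<in> X \<Longrightarrow> (w, p) \<in> R \<Longrightarrow> d w p - \<delta> \<le> G w p + G p w"
begin

text \<open>The set \<open>T y\<close> consists of the points of \<open>A\<close> near the ray from \<open>y\<close>, and \<open>y\<close> sends its mass to the farthest
of them. Suppose that the ray from \<open>x \<in> A\<close> meets \<open>A\<close> in a bounded set only. Infinitely many points \<open>y\<close>
have a ray passing near \<open>x\<close>. Beyond \<open>x\<close> this ray follows the ray from \<open>x\<close>, so \<open>T y\<close> is finite and its
farthest point is near \<open>x\<close> or among the finitely many points of \<open>A\<close> on the ray from \<open>x\<close>. Finitely many
points would receive infinite mass.\<close>
lemma conical: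
  assumes A_sets [measurable]: "A \<in> sets M" and "A \<subseteq> X"
    and many: "\<And>x c. x \<in> A \<Longrightarrow> \<exists>y\<in>R `` {x}. G x y \<le> r \<and> d x y > c"
  shows "AE x in M. x \<in> A \<longrightarrow> (\<forall>c. \<exists>w\<in>R `` {x}. w \<in> A \<and> G w x \<le> r + \<delta> \<and> d x w > c)"
proof -
  define T where "T y = {w \<in> R `` {y}. w \<in> A \<and> G w y \<le> r}" for y
  define Q where "Q = {(y, w). y \<in> X \<and> w \<in> T y \<and> (\<forall>w'\<in>T y. d y w' \<le> d y w)}"
  have QR: "Q \<subseteq> R" by (auto simp: Q_def T_def)
  have "Q \<in> sets (M \<Otimes>\<^sub>M M)"
  proof -
    have "(\<forall>w'\<in>T y. d y w' \<le> d y w) \<longleftrightarrow> (\<forall>j. h j y \<in> A \<and> G (h j y) y \<le> r \<longrightarrow> d y (h j y) \<le> d y w)" if "y \<in> X" for y w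
      using class_all[OF that, of "\<lambda>w'. w' \<in> A \<and> G w' y \<le> r \<longrightarrow> d y w' \<le> d y w"] by (auto simp: T_def)
    then have Q_iff: "(y, w) \<in> Q \<longleftrightarrow> y \<in> X \<and> (y, w) \<in> R \<and> w \<in> A \<and> G w y \<le> r \<and>
        (\<forall>j. h j y \<in> A \<and> G (h j y) y \<le> r \<longrightarrow> d y (h j y) \<le> d y w)" for y w
      by (cases "y \<in> X") (simp_all add: Q_def, simp add: T_def)
    have "Q = {q \<in> space (M \<Otimes>\<^sub>M M). fst q \<in> X \<and> q \<in> R \<and> snd q \<in> A \<and> G (snd q) (fst q) \<le> r \<and>
       (\<forall>j. h j (fst q) \<in> A \<and> G (h j (fst q)) (fst q) \<le> r \<longrightarrow> d (fst q) (h j (fst q)) \<le> d (fst q) (snd q))}"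
    proof (rule set_eqI)
      fix q :: "'x \<times> 'x" obtain a b where q: "q = (a, b)" by (cases q)
      show "q \<in> Q \<longleftrightarrow> q \<in> {q \<in> space (M \<Otimes>\<^sub>M M). fst q \<in> X \<and> q \<in> R \<and> snd q \<in> A \<and> G (snd q) (fst q) \<le> r \<and>
       (\<forall>j. h j (fst q) \<in> A \<and> G (h j (fst q)) (fst q) \<le> r \<longrightarrow> d (fst q) (h j (fst q)) \<le> d (fst q) (snd q))}"
        unfolding q Q_iff using R_space[of a b] by (auto simp: space_pair_measure)
    qed
    also have "\<dots> \<in> sets (M \<Otimes>\<^sub>M M)" by measurable
    finally show ?thesis .
  qed
  from finite_selected[OF this QR] show ?thesis
  proof (rule AE_mp, intro AE_I2 impI allI)
    fix x c assume fin: "\<forall>F. finite F \<longrightarrow> finite {y \<in> R `` {x}. Q `` {y} \<noteq> {} \<and> Q `` {y} \<subseteq> F}" and xA: "x \<in> A"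
    show "\<exists>w\<in>R `` {x}. w \<in> A \<and> G w x \<le> r + \<delta> \<and> d x w > c"
    proof (rule ccontr)
      assume "\<not> ?thesis"
      then have bound: "d x w \<le> c" if "(x, w) \<in> R" "w \<in> A" "G w x \<le> r + \<delta>" for w
        using that by force
      have xX: "x \<in> X" using xA \<open>A \<subseteq> X\<close> by auto
      define F where "F = {w \<in> R `` {x}. d x w \<le> max c (2 * (r + \<delta>))}"
      have "finite F" unfolding F_def by (rule d_proper[OF xX])
      with fin have fin': "finite {y \<in> R `` {x}. Q `` {y} \<noteq> {} \<and> Q `` {y} \<subseteq> F}" by blast
      have sub: "{y \<in> R `` {x}. G x y \<le> r} \<subseteq> {y \<in> R `` {x}. Q `` {y} \<noteq> {} \<and> Q `` {y} \<subseteq> F}"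
      proof
        fix y assume "y \<in> {y \<in> R `` {x}. G x y \<le> r}"
        then have xy: "(x, y) \<in> R" "G x y \<le> r" by auto
        have yX: "y \<in> X" using X_saturated[OF xX xy(1)] .
        have xT: "x \<in> T y" using R_sym[OF xy(1)] xA xy(2) by (simp add: T_def)
        \<comment> \<open>A point of \<open>A\<close> near the ray from \<open>y\<close> lies beyond \<open>x\<close>, and then near the ray from \<open>x\<close>,
          or near the segment from \<open>y\<close> to \<open>x\<close>.\<close>
        have dich: "d x w \<le> c \<or> d y w + d x w - d x y \<le> 2 * (r + \<delta>)" if w: "w \<in> T y" for w
        proof -
          have w': "(y, w) \<in> R" "w \<in> A" "G w y \<le> r" using w by (auto simp: T_def)
          have xw: "(x, w) \<in> R" by (rule R_trans[OF xy(1) w'(1)])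
          have "G w x \<le> G w y + \<delta> \<or> d x w + d y w - d x y \<le> 2 * (G w y + \<delta>)"
            using w' xw by (intro G_hyperbolic X_saturated[OF xX]) (auto intro: R_sym)
          then show ?thesis
          proof
            assume "G w x \<le> G w y + \<delta>"
            then show ?thesis using bound[OF xw w'(2)] w'(3) by simp
          qed (use w'(3) in simp)
        qed
        have "T y \<subseteq> {w \<in> R `` {x}. d x w \<le> c} \<union> {w \<in> R `` {y}. d y w \<le> 2 * (r + \<delta>) + d x y}"
        proof
          fix w assume w: "w \<in> T y"
          then have yw: "(y, w) \<in> R" by (simp add: T_def)
          have xw: "(x, w) \<in> R" by (rule R_trans[OF xy(1) yw])
          show "w \<in> {w \<in> R `` {x}. d x w \<le> c} \<union> {w \<in> R `` {y}. d y w \<le> 2 * (r + \<delta>) + d x y}"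
            using dich[OF w] d_nonneg[OF xX xw] xw yw by auto
        qed
        then have finT: "finite (T y)"
          by (rule finite_subset) (intro finite_UnI d_proper xX yX)
        have "Max (d y ` T y) \<in> d y ` T y" using finT xT by (intro Max_in) auto
        then obtain w where w: "w \<in> T y" "d y w = Max (d y ` T y)" by force
        have "d y w' \<le> d y w" if "w' \<in> T y" for w' using w(2) finT that by simp
        then have "(y, w) \<in> Q" using w(1) yX by (simp add: Q_def)
        moreover have "Q `` {y} \<subseteq> F"
        proof
          fix w assume "w \<in> Q `` {y}"
          then have w: "w \<in> T y" "d y x \<le> d y w" using xT by (auto simp: Q_def)
          then have yw: "(y, w) \<in> R" by (simp add: T_def)
          have xw: "(x, w) \<in> R" by (rule R_trans[OF xy(1) yw])
          show "w \<in> F" using dich[OF w(1)] w(2) d_sym[OF xX xy(1)] xw unfolding F_def by auto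
        qed
        ultimately show "y \<in> {y \<in> R `` {x}. Q `` {y} \<noteq> {} \<and> Q `` {y} \<subseteq> F}" using xy(1) by blast
      qed
      have finY: "finite {y \<in> R `` {x}. G x y \<le> r}" by (rule finite_subset[OF sub fin'])
      obtain y where "y \<in> R `` {x}" "G x y \<le> r" "d x y > Max (d x ` {y \<in> R `` {x}. G x y \<le> r})"
        using many[OF xA] by blast
      moreover from this have "d x y \<le> Max (d x ` {y \<in> R `` {x}. G x y \<le> r})"
        using finY by (intro Max_ge) auto
      ultimately show False by simp
    qed
  qed
qed

text \<open>The hypothesis on \<open>r\<close> says that for a non-null set of \<open>x\<close> the rays from infinitely many points of the
class pass near \<open>x\<close>. The heart of the proof is the fact \<open>reach\<close>: the \<open>f\<close>-orbit of \<open>y\<close> hits every point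
\<open>x\<close> of \<open>A\<close> that is \<open>r2\<close>-near the ray from \<open>y\<close>.\<close>
theorem horospherical_hyperfinite:
  assumes erg: "ergodic_relation M R"
    and pos: "\<not> (AE x in M. \<not> (\<forall>c. \<exists>y\<in>R `` {x}. G x y \<le> r \<and> d x y > c))"
  shows "hyperfinite M R"
proof -
  define A0 where "A0 = {x \<in> X. \<forall>n::nat. \<exists>j. G x (h j x) \<le> r \<and> d x (h j x) > real n}"
  have A0_meas [measurable]: "A0 \<in> sets M" unfolding A0_def by measurable
  have A0_iff: "x \<in> A0 \<longleftrightarrow> (\<forall>c. \<exists>y\<in>R `` {x}. G x y \<le> r \<and> d x y > c)" if "x \<in> X" for x
  proof -
    have "x \<in> A0 \<longleftrightarrow> (\<forall>n::nat. \<exists>y\<in>R `` {x}. G x y \<le> r \<and> d x y > real n)"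
      using that class_ex[OF that, of "\<lambda>y. G x y \<le> r \<and> d x y > real n" for n] by (simp add: A0_def)
    also have "\<dots> \<longleftrightarrow> (\<forall>c. \<exists>y\<in>R `` {x}. G x y \<le> r \<and> d x y > c)"
      by (meson reals_Archimedean2 less_trans)
    finally show ?thesis .
  qed
  have A0_pos: "emeasure M A0 > 0"
  proof (rule ccontr)
    assume "\<not> ?thesis"
    then have "A0 \<in> null_sets M" by (simp add: null_sets_def)
    then have "AE x in M. x \<notin> A0" by (rule AE_not_in)
    with X_conull have "AE x in M. \<not> (\<forall>c. \<exists>y\<in>R `` {x}. G x y \<le> r \<and> d x y > c)"
      by eventually_elim (simp add: A0_iff)
    then show False using pos by simp
  qed
  \<comment> \<open>Rays meet \<open>A\<close> with precision \<open>r1\<close>; seen from another point of the class the precision is \<open>r2\<close>.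
    The map \<open>f\<close> uses the weaker precision \<open>K\<close>, so that it cannot jump over a point met with precision
    \<open>r2\<close>. Distances between points of \<open>A\<close> exceed \<open>D\<close>, which dominates all error terms.\<close>
  define r1 r2 K D where "r1 = r + \<delta>" and "r2 = r1 + \<delta>" and "K = r2 + \<delta>" and "D = 2 * K + 10 * \<delta> + 1"
  have "A0 \<subseteq> X" by (auto simp: A0_def)
  obtain A' where A'_meas [measurable]: "A' \<in> sets M" and A': "A' \<subseteq> A0" "emeasure M A' > 0"
    "\<And>x y. x \<in> A' \<Longrightarrow> y \<in> A' \<Longrightarrow> (x, y) \<in> R \<Longrightarrow> x \<noteq> y \<Longrightarrow> d x y > D"
    using separated_subset[OF d_measurable A0_meas \<open>A0 \<subseteq> X\<close> A0_pos d_proper] by blast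
  have "AE x in M. x \<in> A' \<longrightarrow> (\<forall>c. \<exists>w\<in>R `` {x}. w \<in> A' \<and> G w x \<le> r1 \<and> d x w > c)"
    unfolding r1_def
  proof (rule conical)
    show "A' \<subseteq> X" using A'(1) \<open>A0 \<subseteq> X\<close> by blast
    show "\<exists>y\<in>R `` {x}. G x y \<le> r \<and> d x y > c" if "x \<in> A'" for x c
    proof -
      have x: "x \<in> A0" using that A'(1) by blast
      then have "\<forall>c. \<exists>y\<in>R `` {x}. G x y \<le> r \<and> d x y > c" using A0_iff \<open>A0 \<subseteq> X\<close> by blast
      then show ?thesis ..
    qed
  qed simp
  then obtain Y where Y_meas [measurable]: "Y \<in> sets M" and Y: "Y \<subseteq> X" "AE x in M. x \<in> Y"
    "\<And>x y. x \<in> Y \<Longrightarrow> (x, y) \<in> R \<Longrightarrow> y \<in> Y"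
    "\<And>x. x \<in> Y \<Longrightarrow> x \<in> A' \<longrightarrow> (\<forall>c. \<exists>w\<in>R `` {x}. w \<in> A' \<and> G w x \<le> r1 \<and> d x w > c)"
    by (rule conull_saturated_subset) (rule that)
  define A where "A = A' \<inter> Y"
  have A_meas [measurable]: "A \<in> sets M" unfolding A_def by measurable
  have AX: "x \<in> X" if "x \<in> A" for x using that Y(1) by (auto simp: A_def)
  have A_sep: "d x y > D" if "x \<in> A" "y \<in> A" "(x, y) \<in> R" "x \<noteq> y" for x y
    using that A'(3) by (auto simp: A_def)
  have A_conical: "\<exists>w\<in>R `` {x}. w \<in> A \<and> G w x \<le> r1 \<and> d x w > c" if "x \<in> A" for x c
    using that Y(3)[of x] Y(4)[of x] unfolding A_def by blast
  define cand where "cand y w \<longleftrightarrow> w \<in> A \<and> w \<noteq> y \<and> G w y \<le> K" for y w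
  define best where "best j y \<longleftrightarrow> cand y (h j y) \<and> (\<forall>i. cand y (h i y) \<longrightarrow> d y (h j y) \<le> d y (h i y))" for j y
  define f where "f y = (if \<exists>j. best j y then h (LEAST j. best j y) y else y)" for y
  have best_meas [measurable]: "Measurable.pred M (best j)" for j
    unfolding best_def cand_def by measurable
  have "(\<lambda>y. h (LEAST j. best j y) y) \<in> M \<rightarrow>\<^sub>M M"
    by (rule measurable_compose_countable[where f = h]) measurable
  then have f_meas [measurable]: "f \<in> M \<rightarrow>\<^sub>M M" unfolding f_def by measurable
  have f: "cand y (f y)" "(y, f y) \<in> R" "\<And>w. (y, w) \<in> R \<Longrightarrow> cand y w \<Longrightarrow> d y (f y) \<le> d y w"
    if y: "y \<in> A" for y
  proof -
    have yX: "y \<in> X" using AX[OF y] .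
    obtain w where w: "(y, w) \<in> R" "w \<in> A" "G w y \<le> r1" "d y w > 0" using A_conical[OF y, of 0] by auto
    have "cand y w" using w d_self[OF yX] \<delta>_nonneg by (auto simp: cand_def K_def r2_def)
    let ?T = "{w' \<in> R `` {y}. cand y w' \<and> d y w' \<le> d y w}"
    have finT: "finite ?T" by (rule finite_subset[OF _ d_proper[OF yX, of "d y w"]]) auto
    have "w \<in> ?T" using w \<open>cand y w\<close> by auto
    then have "Min (d y ` ?T) \<in> d y ` ?T" using finT by (intro Min_in) auto
    then obtain v where v: "v \<in> ?T" "d y v = Min (d y ` ?T)" by force
    have v_min: "d y v \<le> d y w'" if w': "(y, w') \<in> R" "cand y w'" for w'
    proof (cases "d y w' \<le> d y w")
      case True
      then have "w' \<in> ?T" using w' by auto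
      then show ?thesis using v(2) finT by simp
    next
      case False then show ?thesis using v(1) by auto
    qed
    obtain j where "v = h j y" using R_enum[OF yX] v(1) by auto
    then have "best j y" using v(1) v_min h_R[OF X_space[OF yX]] by (auto simp: best_def)
    then have ex: "\<exists>j. best j y" ..
    then have "best (LEAST j. best j y) y" by (rule LeastI_ex)
    moreover have fy_eq: "f y = h (LEAST j. best j y) y" using ex by (simp add: f_def)
    ultimately have fy: "cand y (f y)" "\<forall>i. cand y (h i y) \<longrightarrow> d y (f y) \<le> d y (h i y)"
      by (simp_all add: best_def)
    show "cand y (f y)" by fact
    show "(y, f y) \<in> R" using fy_eq h_R[OF X_space[OF yX]] by simp
    show "d y (f y) \<le> d y w" if "(y, w) \<in> R" "cand y w" for w
      using fy(2) R_enum[OF yX that(1)] that(2) by auto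
  qed
  have fnA: "(f ^^ n) x \<in> A \<and> (x, (f ^^ n) x) \<in> R" if "x \<in> A" for x n
    using that by (induction n) (auto intro: R_refl X_space AX R_trans f(2) dest: f(1) simp: cand_def)
  have reach: "\<exists>n. (f ^^ n) y = x" if x: "x \<in> A" and y: "y \<in> A" and xy: "(x, y) \<in> R" and Gxy: "G x y \<le> r2" for x y
  proof (rule ccontr)
    assume "\<not> ?thesis"
    then have never: "(f ^^ n) y \<noteq> x" for n by blast
    have xX: "x \<in> X" using AX[OF x] .
    \<comment> \<open>The error does not accumulate along the \<open>f\<close>-orbit: each point \<open>(f ^^ n) y\<close> stays near the ray from
      the starting point \<open>y\<close> itself, up to one \<open>\<delta>\<close>, and it comes closer to \<open>x\<close> by at least 1 in each step.\<close>
    have inv: "G x ((f ^^ n) y) \<le> K \<and> d x ((f ^^ n) y) \<le> d x y - real n \<and> (n = 0 \<or> G ((f ^^ n) y) y \<le> K + \<delta>)" for n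
    proof (induction n)
      case 0 then show ?case using Gxy \<delta>_nonneg by (simp add: K_def)
    next
      case (Suc n)
      define u where "u = (f ^^ n) y"
      define w where "w = f u"
      have uA: "u \<in> A" and yu: "(y, u) \<in> R" using fnA[OF y] by (auto simp: u_def)
      have xu: "(x, u) \<in> R" by (rule R_trans[OF xy yu])
      have wA: "w \<in> A" and wu: "w \<noteq> u" and Gwu: "G w u \<le> K" using f(1)[OF uA] by (auto simp: cand_def w_def)
      have uw: "(u, w) \<in> R" using f(2)[OF uA] by (simp add: w_def)
      have xw: "(x, w) \<in> R" by (rule R_trans[OF xu uw])
      have uX: "u \<in> X" and wX: "w \<in> X" using AX uA wA by auto
      have ux: "(u, x) \<in> R" and wx: "(w, x) \<in> R" and wu': "(w, u) \<in> R" and wy: "(w, y) \<in> R" and uy: "(u, y) \<in> R"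
        using xu xw uw yu R_sym R_trans by blast+
      have w_not_x: "w \<noteq> x" using never[of "Suc n"] by (simp add: w_def u_def)
      have u_not_x: "u \<noteq> x" using never[of n] by (simp add: u_def)
      have IH: "G x u \<le> K" "d x u \<le> d x y - real n" "n = 0 \<or> G u y \<le> K + \<delta>"
        using Suc by (auto simp: u_def)
      have syms: "d u x = d x u" "d w x = d x w" "d w u = d u w" "d y x = d x y" "d u y = d y u" "d w y = d y w"
        using d_sym[OF xX xu] d_sym[OF xX xw] d_sym[OF uX uw] d_sym[OF xX xy] d_sym[OF uX uy] d_sym[OF wX wy] by simp_all
      have "cand u x" using x u_not_x IH(1) by (auto simp: cand_def)
      then have first: "d u w \<le> d x u" using f(3)[OF uA ux] syms(1) by (simp add: w_def)
      have sep: "d u w > D" "d x w > D" using A_sep[OF uA wA uw] A_sep[OF x wA xw] wu w_not_x by auto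
      have h1: "G w x \<le> G w u + \<delta> \<or> d x w + d u w - d x u \<le> 2 * (G w u + \<delta>)"
        by (rule G_hyperbolic[OF wX wx wu'])
      have h2: "G x w \<le> G x u + \<delta> \<or> d w x + d u x - d w u \<le> 2 * (G x u + \<delta>)"
        by (rule G_hyperbolic[OF xX xw xu])
      have h3: "d w x - \<delta> \<le> G w x + G x w" by (rule G_opposite[OF wX wx])
      have Gxw: "G x w \<le> K + \<delta>"
        using h2 first sep IH(1) \<delta>_nonneg unfolding D_def syms by (smt (verit))
      have Gwx: "G w x > K + 2 * \<delta>"
        using h3 Gxw sep(2) \<delta>_nonneg unfolding D_def syms by (smt (verit))
      have closer: "d x w \<le> d x u - 1"
        using h1 Gwx Gwu sep(1) \<delta>_nonneg unfolding D_def by (smt (verit))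
      have chain: "G w y \<le> K + \<delta>"
      proof (cases "n = 0")
        case True
        then have "u = y" by (simp add: u_def)
        then show ?thesis using Gwu \<delta>_nonneg by simp
      next
        case False
        then have Guy: "G u y \<le> K + \<delta>" using IH(3) by simp
        have "G w y \<le> G w u + \<delta> \<or> d y w + d u w - d y u \<le> 2 * (G w u + \<delta>)"
          by (rule G_hyperbolic[OF wX wy wu'])
        moreover have "G u w \<le> G u y + \<delta> \<or> d w u + d y u - d w y \<le> 2 * (G u y + \<delta>)"
          by (rule G_hyperbolic[OF uX uw uy])
        moreover have "d w u - \<delta> \<le> G w u + G u w" by (rule G_opposite[OF wX wu'])
        ultimately show ?thesis using Guy Gwu sep(1) \<delta>_nonneg unfolding D_def syms by (smt (verit))
      qed
      have "G w x \<le> G w y + \<delta> \<or> d x w + d y w - d x y \<le> 2 * (G w y + \<delta>)"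
        by (rule G_hyperbolic[OF wX wx wy])
      moreover have "G x w \<le> G x y + \<delta> \<or> d w x + d y x - d w y \<le> 2 * (G x y + \<delta>)"
        by (rule G_hyperbolic[OF xX xw xy])
      ultimately have "G x w \<le> K"
        using Gwx chain Gxy sep(2) \<delta>_nonneg unfolding D_def K_def syms by (smt (verit))
      then show ?case using closer IH(2) chain by (simp add: u_def w_def)
    qed
    obtain n :: nat where "real n > d x y" using reals_Archimedean2 by blast
    moreover have "d x ((f ^^ n) y) \<ge> 0" using d_nonneg[OF xX R_trans[OF xy]] fnA[OF y] by blast
    ultimately show False using inv[of n] by linarith
  qed
  show ?thesis
  proof (rule tail_relation_hyperfinite[OF A_meas _ f_meas])
    show "A \<subseteq> X" using AX by auto
    show "f x \<in> A \<and> (x, f x) \<in> R" if "x \<in> A" for x using f[OF that] by (auto simp: cand_def)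
    show "infinite (range (\<lambda>n. (f ^^ n) x))" if x: "x \<in> A" for x
    proof
      assume fin: "finite (range (\<lambda>n. (f ^^ n) x))"
      obtain w where w: "(x, w) \<in> R" "w \<in> A" "G w x \<le> r1" "d x w > Max (d x ` range (\<lambda>n. (f ^^ n) x))"
        using A_conical[OF x] by blast
      have "G w x \<le> r2" using w(3) \<delta>_nonneg by (simp add: r2_def)
      from reach[OF w(2) x R_sym[OF w(1)] this] have "w \<in> range (\<lambda>n. (f ^^ n) x)" by auto
      then have "d x w \<le> Max (d x ` range (\<lambda>n. (f ^^ n) x))" using fin by (intro Max_ge) auto
      then show False using w(4) by simp
    qed
    show "\<exists>m n. (f ^^ m) x = (f ^^ n) y" if x: "x \<in> A" and y: "y \<in> A" and xy: "(x, y) \<in> R" for x y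
    proof -
      have xX: "x \<in> X" using AX[OF x] .
      obtain w where w: "(x, w) \<in> R" "w \<in> A" "G w x \<le> r1" "d x w > d x y + r2"
        using A_conical[OF x] by blast
      have wX: "w \<in> X" using AX w(2) by auto
      have wx: "(w, x) \<in> R" and wy: "(w, y) \<in> R" and yw: "(y, w) \<in> R" using w(1) xy R_sym R_trans by blast+
      have "G w y \<le> G w x + \<delta> \<or> d y w + d x w - d y x \<le> 2 * (G w x + \<delta>)"
        by (rule G_hyperbolic[OF wX wy wx])
      moreover have "d x w \<le> d x y + d y w" by (rule d_triangle[OF xX xy w(1)])
      ultimately have "G w y \<le> r2"
        using w(3,4) d_sym[OF xX xy] unfolding r2_def by (smt (verit))
      from reach[OF w(2) y wy this] obtain n where n: "(f ^^ n) y = w" ..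
      have "G w x \<le> r2" using w(3) \<delta>_nonneg by (simp add: r2_def)
      from reach[OF w(2) x wx this] obtain m where "(f ^^ m) x = w" ..
      with n show ?thesis by metis
    qed
    have "emeasure M A = emeasure M A'"
      using Y(2) by (intro emeasure_eq_AE) (auto simp: A_def)
    then show "AE x in M. \<exists>y\<in>R `` {x}. y \<in> A"
      using A'(2) by (intro positive_set_meets_classes[OF erg]) auto
  qed
qed

end

section \<open>Gromov products with boundary points\<close>

lemma mdist_pos_less': "x \<noteq> y \<Longrightarrow> x \<in> mspace m \<Longrightarrow> y \<in> mspace m \<Longrightarrow> 0 < mdist m x y"
  using mdist_nonneg[of m x y] mdist_zero[of x m y] by linarith

lemma gromov_product_commute: "gromov_product m z x y = gromov_product m z y x"
  by (simp add: gromov_product_def mdist_commute)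

lemma gromov_product_nonneg:
  "x \<in> mspace m \<Longrightarrow> y \<in> mspace m \<Longrightarrow> z \<in> mspace m \<Longrightarrow> 0 \<le> gromov_product m z x y"
  using mdist_triangle[of x m z y] by (simp add: gromov_product_def mdist_commute)

lemma gromov_product_le:
  "x \<in> mspace m \<Longrightarrow> y \<in> mspace m \<Longrightarrow> z \<in> mspace m \<Longrightarrow> gromov_product m z x y \<le> mdist m y z"
  using mdist_triangle[of x m y z] by (simp add: gromov_product_def mdist_commute)

lemma gromov_product_change_base:
  assumes "x \<in> mspace m" "y \<in> mspace m" "z \<in> mspace m" "z' \<in> mspace m"
  shows "gromov_product m z x y \<le> gromov_product m z' x y + mdist m z z'"
  using mdist_triangle[OF assms(1,4,3)] mdist_triangle[OF assms(2,4,3)]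
  unfolding gromov_product_def mdist_commute[of m z' z] by argo

lemma gromov_product_change_point:
  assumes "x \<in> mspace m" "x' \<in> mspace m" "y \<in> mspace m" "z \<in> mspace m"
  shows "gromov_product m z x y \<le> gromov_product m z x' y + mdist m x x'"
  using mdist_triangle[OF assms(1,2,4)] mdist_triangle[OF assms(2,1,3)]
  unfolding gromov_product_def mdist_commute[of m x' x] by argo

text \<open>A change of the base point alters Gromov products by a bounded amount.\<close>
lemma gromov_asymptotic_iff:
  assumes "range s \<subseteq> mspace m" "range t \<subseteq> mspace m" "z \<in> mspace m"
  shows "gromov_asymptotic m s t \<longleftrightarrow> (\<forall>N. \<exists>n. \<forall>i\<ge>n. \<forall>j\<ge>n. N \<le> gromov_product m z (s i) (t j))"
proof -
  have st: "s i \<in> mspace m" "t i \<in> mspace m" for i using assms by auto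
  have base: "filterlim (\<lambda>(i, j). gromov_product m z (s i) (t j)) at_top (sequentially \<times>\<^sub>F sequentially) \<longleftrightarrow>
    (\<forall>N. \<exists>n. \<forall>i\<ge>n. \<forall>j\<ge>n. N \<le> gromov_product m z (s i) (t j))" for z
    unfolding filterlim_at_top eventually_prod_sequentially by (auto; blast)
  show ?thesis
    unfolding gromov_asymptotic_def base
  proof (intro iffI ballI allI)
    fix z' N assume z': "z' \<in> mspace m" and *: "\<forall>N. \<exists>n. \<forall>i\<ge>n. \<forall>j\<ge>n. N \<le> gromov_product m z (s i) (t j)"
    obtain n where n: "\<And>i j. i \<ge> n \<Longrightarrow> j \<ge> n \<Longrightarrow> N + mdist m z z' \<le> gromov_product m z (s i) (t j)"
      using * by blast
    have "N \<le> gromov_product m z' (s i) (t j)" if "i \<ge> n" "j \<ge> n" for i j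
      using n[OF that] gromov_product_change_base[OF st(1)[of i] st(2)[of j] assms(3) z'] by simp
    then show "\<exists>n. \<forall>i\<ge>n. \<forall>j\<ge>n. N \<le> gromov_product m z' (s i) (t j)" by blast
  qed (use assms(3) in blast)
qed

text \<open>Hyperbolicity is stated as a disjunction, which linear arithmetic handles better than a minimum.\<close>
locale hyperbolic_metric =
  fixes m :: "'h metric" and \<delta> :: real
  assumes \<delta>_nonneg: "\<delta> \<ge> 0"
    and hyperbolic: "\<And>x y z w. x \<in> mspace m \<Longrightarrow> y \<in> mspace m \<Longrightarrow> z \<in> mspace m \<Longrightarrow> w \<in> mspace m \<Longrightarrow>
      gromov_product m z x w \<le> gromov_product m z x y + \<delta> \<or> gromov_product m z w y \<le> gromov_product m z x y + \<delta>"
begin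

abbreviation gp where "gp \<equiv> gromov_product m"
abbreviation ext where "ext \<equiv> gromov_product_ext m"

lemma asymptotic_trans:
  assumes "range s \<subseteq> mspace m" "range t \<subseteq> mspace m" "range u \<subseteq> mspace m"
    and st: "gromov_asymptotic m s t" and tu: "gromov_asymptotic m t u"
  shows "gromov_asymptotic m s u"
proof -
  have inm: "s i \<in> mspace m" "t i \<in> mspace m" "u i \<in> mspace m" for i using assms by auto
  let ?z = "s 0"
  show ?thesis
    unfolding gromov_asymptotic_iff[OF assms(1,3) inm(1)[of 0]]
  proof
    fix N
    obtain a where a: "\<And>i j. i \<ge> a \<Longrightarrow> j \<ge> a \<Longrightarrow> N + \<delta> + 1 \<le> gp ?z (s i) (t j)"
      using st unfolding gromov_asymptotic_iff[OF assms(1,2) inm(1)[of 0]] by blast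
    obtain b where b: "\<And>i j. i \<ge> b \<Longrightarrow> j \<ge> b \<Longrightarrow> N + \<delta> + 1 \<le> gp ?z (t i) (u j)"
      using tu unfolding gromov_asymptotic_iff[OF assms(2,3) inm(1)[of 0]] by blast
    have "N \<le> gp ?z (s i) (u j)" if "i \<ge> max a b" "j \<ge> max a b" for i j
      using a[of i "max a b"] b[of "max a b" j] that
        hyperbolic[OF inm(1)[of i] inm(3)[of j] inm(1)[of 0] inm(2)[of "max a b"]] by auto
    then show "\<exists>n. \<forall>i\<ge>n. \<forall>j\<ge>n. N \<le> gp ?z (s i) (u j)" by blast
  qed
qed

lemma asymptotic_sym:
  assumes "range s \<subseteq> mspace m" "range t \<subseteq> mspace m" "gromov_asymptotic m s t"
  shows "gromov_asymptotic m t s"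
proof -
  have s0: "s 0 \<in> mspace m" using assms by auto
  show ?thesis
    using assms(3) unfolding gromov_asymptotic_iff[OF assms(1,2) s0] gromov_asymptotic_iff[OF assms(2,1) s0]
    by (subst gromov_product_commute) blast
qed

definition class_of :: "(nat \<Rightarrow> 'h) \<Rightarrow> (nat \<Rightarrow> 'h) set" where
  "class_of s = {t \<in> gromov_sequences m. gromov_asymptotic m s t}"

lemma gromov_sequences_iff: "s \<in> gromov_sequences m \<longleftrightarrow> range s \<subseteq> mspace m \<and> gromov_asymptotic m s s"
  by (auto simp: gromov_sequences_def)

lemma boundary_iff: "c \<in> gromov_boundary m \<longleftrightarrow> (\<exists>s\<in>gromov_sequences m. c = class_of s)"
  unfolding gromov_boundary_def quotient_def class_of_def by (auto simp: Image_def)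

lemma boundary_seq:
  assumes "c \<in> gromov_boundary m" "s \<in> c"
  shows "range s \<subseteq> mspace m" "gromov_asymptotic m s s" "\<And>i. s i \<in> mspace m"
  using assms unfolding boundary_iff class_of_def gromov_sequences_iff by auto

lemma boundary_asymptotic:
  assumes "c \<in> gromov_boundary m" "s \<in> c" "t \<in> c"
  shows "gromov_asymptotic m s t"
proof -
  obtain u where u: "u \<in> gromov_sequences m" "c = class_of u" using assms unfolding boundary_iff by blast
  then have "range u \<subseteq> mspace m" "gromov_asymptotic m u s" "gromov_asymptotic m u t"
    using assms(2,3) by (auto simp: class_of_def gromov_sequences_iff)
  then show ?thesis
    using boundary_seq(1)[OF assms(1,2)] boundary_seq(1)[OF assms(1,3)] asymptotic_sym asymptotic_trans by metis
qed

text \<open>The sequence \<open>t\<close> is asymptotic to itself by transitivity through \<open>s\<close>.\<close>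
lemma boundary_mem:
  assumes "c \<in> gromov_boundary m" "s \<in> c" "range t \<subseteq> mspace m" "gromov_asymptotic m s t"
  shows "t \<in> c"
proof -
  obtain u where u: "u \<in> gromov_sequences m" "c = class_of u" using assms unfolding boundary_iff by blast
  then have u': "range u \<subseteq> mspace m" "gromov_asymptotic m u s"
    using assms(2) by (auto simp: class_of_def gromov_sequences_iff)
  have s: "range s \<subseteq> mspace m" by (rule boundary_seq(1)[OF assms(1,2)])
  have ut: "gromov_asymptotic m u t" by (rule asymptotic_trans[OF u'(1) s assms(3) u'(2) assms(4)])
  have "gromov_asymptotic m t t"
    by (rule asymptotic_trans[OF assms(3) s assms(3) asymptotic_sym[OF s assms(3,4)] assms(4)])
  then show ?thesis using ut assms(3) unfolding u(2) class_of_def gromov_sequences_iff by simp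
qed

lemma boundary_eq:
  assumes "c \<in> gromov_boundary m" "c' \<in> gromov_boundary m" "s \<in> c" "t \<in> c'" "gromov_asymptotic m s t"
  shows "c = c'"
proof (intro equalityI subsetI)
  fix u assume u: "u \<in> c"
  have "gromov_asymptotic m t u"
    using asymptotic_trans[OF boundary_seq(1)[OF assms(2,4)] boundary_seq(1)[OF assms(1,3)] boundary_seq(1)[OF assms(1) u]
      asymptotic_sym[OF boundary_seq(1)[OF assms(1,3)] boundary_seq(1)[OF assms(2,4)] assms(5)]
      boundary_asymptotic[OF assms(1,3) u]] .
  then show "u \<in> c'" by (rule boundary_mem[OF assms(2,4) boundary_seq(1)[OF assms(1) u]])
next
  fix u assume u: "u \<in> c'"
  have "gromov_asymptotic m s u"
    by (rule asymptotic_trans[OF boundary_seq(1)[OF assms(1,3)] boundary_seq(1)[OF assms(2,4)] boundary_seq(1)[OF assms(2) u]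
      assms(5) boundary_asymptotic[OF assms(2,4) u]])
  then show "u \<in> c" by (rule boundary_mem[OF assms(1,3) boundary_seq(1)[OF assms(2) u]])
qed

lemma boundary_class:
  assumes "s \<in> gromov_sequences m"
  shows "class_of s \<in> gromov_boundary m" "s \<in> class_of s"
  using assms unfolding boundary_iff by (auto simp: class_of_def gromov_sequences_iff)

lemma boundary_nonempty: "c \<in> gromov_boundary m \<Longrightarrow> \<exists>s. s \<in> c"
  unfolding boundary_iff using boundary_class(2) by blast

lemma boundary_far:
  assumes "c \<in> gromov_boundary m" "s \<in> c" "t \<in> c" "z \<in> mspace m"
  obtains n where "\<And>i j. i \<ge> n \<Longrightarrow> j \<ge> n \<Longrightarrow> N \<le> gp z (s i) (t j)"
  using boundary_asymptotic[OF assms(1-3)]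
  unfolding gromov_asymptotic_iff[OF boundary_seq(1)[OF assms(1,2)] boundary_seq(1)[OF assms(1,3)] assms(4)] by blast

lemma const_represents: "p \<in> mspace m \<Longrightarrow> (\<lambda>_. p) \<in> representing_sequences m (Inl p)"
  by (auto simp: limitin_const)

lemma point_represents:
  assumes "t \<in> representing_sequences m (Inl p)" "e > 0"
  shows "\<exists>n. \<forall>j\<ge>n. mdist m (t j) p < e" "\<And>j. t j \<in> mspace m"
proof -
  interpret Metric_space "mspace m" "mdist m" by (rule Metric_space_mspace_mdist)
  have "limitin mtopology t p sequentially" "range t \<subseteq> mspace m"
    using assms(1) by (simp_all add: mtopology_of_def)
  then show "\<exists>n. \<forall>j\<ge>n. mdist m (t j) p < e" "\<And>j. t j \<in> mspace m"
    using assms(2) unfolding limitin_metric eventually_sequentially by blast+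
qed

lemma ext_point_greaterD:
  assumes "c \<in> gromov_boundary m" "p \<in> mspace m" "ereal r < ext z (Inr c) (Inl p)" "s \<in> c"
  shows "\<exists>n. \<forall>i\<ge>n. r < gp z (s i) p"
proof -
  have "ext z (Inr c) (Inl p) \<le> Liminf (sequentially \<times>\<^sub>F sequentially) (\<lambda>(i, j). ereal (gp z (s i) p))"
    unfolding gromov_product_ext_def
    by (rule INF_lower2[of "(s, \<lambda>_. p)"]) (use assms const_represents in auto)
  with assms(3) have "ereal r < Liminf (sequentially \<times>\<^sub>F sequentially) (\<lambda>(i, j). ereal (gp z (s i) p))" by simp
  then have "\<forall>\<^sub>F x in sequentially \<times>\<^sub>F sequentially. ereal r < (\<lambda>(i, j). ereal (gp z (s i) p)) x"
    by (rule less_LiminfD)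
  then show ?thesis unfolding eventually_prod_sequentially by auto
qed

lemma ext_boundary_greaterD:
  assumes "ereal r < ext z (Inr c) (Inr c')" "s \<in> c" "t \<in> c'"
  shows "\<exists>n. \<forall>i\<ge>n. \<forall>j\<ge>n. r < gp z (s i) (t j)"
proof -
  have "ext z (Inr c) (Inr c') \<le> Liminf (sequentially \<times>\<^sub>F sequentially) (\<lambda>(i, j). ereal (gp z (s i) (t j)))"
    unfolding gromov_product_ext_def
    by (rule INF_lower2[of "(s, t)"]) (use assms in auto)
  with assms(1) have "ereal r < Liminf (sequentially \<times>\<^sub>F sequentially) (\<lambda>(i, j). ereal (gp z (s i) (t j)))" by simp
  then have "\<forall>\<^sub>F x in sequentially \<times>\<^sub>F sequentially. ereal r < (\<lambda>(i, j). ereal (gp z (s i) (t j))) x"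
    by (rule less_LiminfD)
  then show ?thesis unfolding eventually_prod_sequentially by auto
qed

lemma ext_lessD:
  assumes "ext z \<xi> \<eta> < ereal r"
  obtains s t where "s \<in> representing_sequences m \<xi>" "t \<in> representing_sequences m \<eta>"
    "\<And>n. \<exists>i\<ge>n. \<exists>j\<ge>n. gp z (s i) (t j) < r"
proof -
  obtain s t where st: "s \<in> representing_sequences m \<xi>" "t \<in> representing_sequences m \<eta>"
    "Liminf (sequentially \<times>\<^sub>F sequentially) (\<lambda>(i, j). ereal (gp z (s i) (t j))) < ereal r"
    using assms unfolding gromov_product_ext_def INF_less_iff by auto
  have "\<exists>i\<ge>n. \<exists>j\<ge>n. gp z (s i) (t j) < r" for n
  proof (rule ccontr)
    assume "\<not> ?thesis"
    then have "\<forall>\<^sub>F x in sequentially \<times>\<^sub>F sequentially. ereal r \<le> (\<lambda>(i, j). ereal (gp z (s i) (t j))) x"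
      unfolding eventually_prod_sequentially by (intro exI[of _ n]) (auto simp: not_less)
    then have "ereal r \<le> Liminf (sequentially \<times>\<^sub>F sequentially) (\<lambda>(i, j). ereal (gp z (s i) (t j)))"
      by (rule Liminf_bounded)
    then show False using st(3) by simp
  qed
  then show thesis using st that by blast
qed

text \<open>The extended product is an infimum over all representing sequences, so it bounds the products along a
fixed representing sequence from below, by \<open>ext_point_greaterD\<close>, but from above only up to \<open>\<delta>\<close>:
a representing sequence that nearly attains the infimum is compared with \<open>s\<close>.\<close>
lemma ext_point_lessD:
  assumes c: "c \<in> gromov_boundary m" and p: "p \<in> mspace m" and z: "z \<in> mspace m"
    and less: "ext z (Inr c) (Inl p) < ereal r" and s: "s \<in> c"
  shows "\<exists>n. \<forall>i\<ge>n. gp z (s i) p < r + \<delta>"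
proof -
  obtain r' where "ext z (Inr c) (Inl p) < ereal r'" "r' < r"
    using ereal_dense2[OF less] by auto
  then obtain s' t where s': "s' \<in> c" and t: "t \<in> representing_sequences m (Inl p)"
    and fr: "\<And>n. \<exists>i\<ge>n. \<exists>j\<ge>n. gp z (s' i) (t j) < r'"
    by (auto elim!: ext_lessD)
  note inm = boundary_seq(3)[OF c s] boundary_seq(3)[OF c s'] point_represents(2)[OF t, of 1]
  obtain a where a: "\<And>j. j \<ge> a \<Longrightarrow> mdist m (t j) p < r - r'"
    using point_represents(1)[OF t, of "r - r'"] \<open>r' < r\<close> by auto
  obtain b where b: "\<And>i j. i \<ge> b \<Longrightarrow> j \<ge> b \<Longrightarrow> r + \<delta> + 1 \<le> gp z (s' i) (s j)"
    by (rule boundary_far[OF c s' s z, of "r + \<delta> + 1"]) (rule that)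
  obtain i j where ij: "i \<ge> max a b" "j \<ge> max a b" "gp z (s' i) (t j) < r'" using fr by blast
  have "gp z p (s' i) \<le> gp z (t j) (s' i) + mdist m p (t j)"
    using inm p z by (intro gromov_product_change_point) auto
  then have small: "gp z (s' i) p < r"
    using ij a[of j] by (simp add: gromov_product_commute[of m z p] gromov_product_commute[of m z "t j"] mdist_commute[of m p])
  have "gp z (s k) p < r + \<delta>" if "k \<ge> b" for k
    using hyperbolic[OF inm(2)[of i] p z inm(1)[of k]] b[of i k] small ij that \<delta>_nonneg by auto
  then show ?thesis by blast
qed

lemma ext_boundary_lessD:
  assumes c: "c \<in> gromov_boundary m" and c': "c' \<in> gromov_boundary m" and z: "z \<in> mspace m"
    and less: "ext z (Inr c) (Inr c') < ereal r" and s: "s \<in> c" and t: "t \<in> c'"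
  shows "\<exists>n. \<forall>i\<ge>n. \<forall>j\<ge>n. gp z (s i) (t j) < r + 2 * \<delta>"
proof -
  obtain s' t' where "s' \<in> representing_sequences m (Inr c)" "t' \<in> representing_sequences m (Inr c')"
    and fr: "\<And>n. \<exists>i\<ge>n. \<exists>j\<ge>n. gp z (s' i) (t' j) < r"
    by (rule ext_lessD[OF less]) (rule that)
  then have s': "s' \<in> c" and t': "t' \<in> c'" by simp_all
  note inm = boundary_seq(3)[OF c s] boundary_seq(3)[OF c s'] boundary_seq(3)[OF c' t] boundary_seq(3)[OF c' t']
  obtain a where a: "\<And>i j. i \<ge> a \<Longrightarrow> j \<ge> a \<Longrightarrow> r + 2 * \<delta> + 1 \<le> gp z (s' i) (s j)"
    by (rule boundary_far[OF c s' s z, of "r + 2 * \<delta> + 1"]) (rule that)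
  obtain b where b: "\<And>i j. i \<ge> b \<Longrightarrow> j \<ge> b \<Longrightarrow> r + 2 * \<delta> + 1 \<le> gp z (t i) (t' j)"
    by (rule boundary_far[OF c' t t' z, of "r + 2 * \<delta> + 1"]) (rule that)
  obtain i j where ij: "i \<ge> max a b" "j \<ge> max a b" "gp z (s' i) (t' j) < r" using fr by blast
  have "gp z (s k) (t l) < r + 2 * \<delta>" if "k \<ge> max a b" "l \<ge> max a b" for k l
    using hyperbolic[OF inm(2)[of i] inm(4)[of j] z inm(1)[of k]] a[of i k]
      hyperbolic[OF inm(1)[of k] inm(4)[of j] z inm(3)[of l]] b[of l j] ij that \<delta>_nonneg by auto
  then show ?thesis by blast
qed

lemma ext_point_nonneg:
  assumes c: "c \<in> gromov_boundary m" and p: "p \<in> mspace m" and z: "z \<in> mspace m"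
  shows "0 \<le> ext z (Inr c) (Inl p)"
  unfolding gromov_product_ext_def
proof (intro INF_greatest, clarify)
  fix s t assume st: "s \<in> representing_sequences m (Inr c)" "t \<in> representing_sequences m (Inl p)"
  have "0 \<le> gp z (s i) (t j)" for i j
    using st point_represents(2)[OF st(2), of 1] boundary_seq(3)[OF c] z
    by (intro gromov_product_nonneg) auto
  then show "0 \<le> Liminf (sequentially \<times>\<^sub>F sequentially) (\<lambda>(i, j). ereal (gp z (s i) (t j)))"
    by (intro Liminf_bounded always_eventually) auto
qed

lemma ext_point_le:
  assumes c: "c \<in> gromov_boundary m" and p: "p \<in> mspace m" and z: "z \<in> mspace m"
  shows "ext z (Inr c) (Inl p) \<le> ereal (mdist m p z)"
proof (rule ccontr)
  assume "\<not> ?thesis"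
  then have *: "ereal (mdist m p z) < ext z (Inr c) (Inl p)" by simp
  obtain s where s: "s \<in> c" using boundary_nonempty[OF c] ..
  obtain n where "\<forall>i\<ge>n. mdist m p z < gp z (s i) p" using ext_point_greaterD[OF c p * s] ..
  then show False using gromov_product_le[OF boundary_seq(3)[OF c s, of n] p z] by force
qed

text \<open>The Gromov product of a boundary point and a point of the space, as a real number.\<close>
definition boundary_product :: "'h \<Rightarrow> (nat \<Rightarrow> 'h) set \<Rightarrow> 'h \<Rightarrow> real" where
  "boundary_product z c p = real_of_ereal (ext z (Inr c) (Inl p))"

lemma ext_boundary_product:
  assumes "c \<in> gromov_boundary m" "p \<in> mspace m" "z \<in> mspace m"
  shows "ext z (Inr c) (Inl p) = ereal (boundary_product z c p)"
  using ext_point_nonneg[OF assms] ext_point_le[OF assms] unfolding boundary_product_def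
  by (intro ereal_real'[symmetric]) (auto simp: abs_ereal_ge0)

context
  fixes c s assumes c: "c \<in> gromov_boundary m" and s: "s \<in> c"
begin

lemma boundary_product_eventually_greater:
  assumes "p \<in> mspace m" "z \<in> mspace m" "r < boundary_product z c p"
  shows "\<exists>n. \<forall>i\<ge>n. r < gp z (s i) p"
  by (rule ext_point_greaterD[OF c assms(1) _ s]) (use ext_boundary_product[OF c] assms in simp)

lemma boundary_product_eventually_less:
  assumes "p \<in> mspace m" "z \<in> mspace m" "boundary_product z c p < r"
  shows "\<exists>n. \<forall>i\<ge>n. gp z (s i) p < r + \<delta>"
  by (rule ext_point_lessD[OF c assms(1,2) _ s]) (use ext_boundary_product[OF c] assms in simp)

end

lemma boundary_product_hyperbolic:
  assumes c: "c \<in> gromov_boundary m" and w: "w \<in> mspace m" and p: "p \<in> mspace m" and q: "q \<in> mspace m"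
  shows "boundary_product w c p \<le> boundary_product w c q + 2 * \<delta> \<or> gp w p q \<le> boundary_product w c q + 2 * \<delta>"
proof (rule ccontr)
  assume "\<not> ?thesis"
  then have less: "boundary_product w c q + 2 * \<delta> < boundary_product w c p" "boundary_product w c q + 2 * \<delta> < gp w p q" by simp_all
  define e where "e = (min (boundary_product w c p) (gp w p q) - (boundary_product w c q + 2 * \<delta>)) / 2"
  have e: "e > 0" "boundary_product w c q + 2 * \<delta> + e < boundary_product w c p" "boundary_product w c q + 2 * \<delta> + e < gp w p q"
    using less by (auto simp: e_def min_def field_simps)
  obtain s where s: "s \<in> c" using boundary_nonempty[OF c] ..
  obtain a where a: "\<And>i. i \<ge> a \<Longrightarrow> boundary_product w c q + 2 * \<delta> + e < gp w (s i) p"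
    using boundary_product_eventually_greater[OF c s p w e(2)] by blast
  obtain b where b: "\<And>i. i \<ge> b \<Longrightarrow> gp w (s i) q < boundary_product w c q + e + \<delta>"
    using boundary_product_eventually_less[OF c s q w, of "boundary_product w c q + e"] e(1) by auto
  show False
    using a[of "max a b"] b[of "max a b"] e(3) hyperbolic[OF boundary_seq(3)[OF c s, of "max a b"] q w p] by auto
qed

text \<open>For a point \<open>q\<close> of the space in place of the boundary point the two products add up to the distance
exactly.\<close>
lemma boundary_product_opposite:
  assumes c: "c \<in> gromov_boundary m" and w: "w \<in> mspace m" and p: "p \<in> mspace m"
  shows "mdist m w p - 2 * \<delta> \<le> boundary_product w c p + boundary_product p c w"
proof (rule field_le_epsilon)
  fix e :: real assume e: "e > 0"
  obtain s where s: "s \<in> c" using boundary_nonempty[OF c] ..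
  obtain a where a: "\<And>i. i \<ge> a \<Longrightarrow> gp w (s i) p < boundary_product w c p + e / 2 + \<delta>"
    using boundary_product_eventually_less[OF c s p w, of "boundary_product w c p + e/2"] e by auto
  obtain b where b: "\<And>i. i \<ge> b \<Longrightarrow> gp p (s i) w < boundary_product p c w + e / 2 + \<delta>"
    using boundary_product_eventually_less[OF c s w p, of "boundary_product p c w + e/2"] e by auto
  have "gp w (s i) p + gp p (s i) w = mdist m w p" for i
    by (simp add: gromov_product_def mdist_commute[of m p w] mdist_commute[of m "s i"] field_simps)
  from this[of "max a b"] show "mdist m w p - 2 * \<delta> \<le> boundary_product w c p + boundary_product p c w + e"
    using a[of "max a b"] b[of "max a b"] by simp
qed

lemma ext_isometry:
  assumes iso: "isometry_between m m' f" and c: "c \<in> gromov_boundary m" and z: "z \<in> mspace m" and p: "p \<in> mspace m"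
  shows "gromov_product_ext m' (f z) (Inr ((\<lambda>s. f \<circ> s) ` c)) (Inl (f p)) = ext z (Inr c) (Inl p)"
proof -
  have f: "f ` mspace m = mspace m'" "\<And>x y. x \<in> mspace m \<Longrightarrow> y \<in> mspace m \<Longrightarrow> mdist m' (f x) (f y) = mdist m x y"
    using iso by (auto simp: isometry_between_def)
  have gp: "gromov_product m' (f z) (f x) (f y) = gp z x y" if "x \<in> mspace m" "y \<in> mspace m" for x y
    using that z by (simp add: gromov_product_def f(2))
  have lim: "limitin (mtopology_of m') (f \<circ> t) (f p) sequentially \<longleftrightarrow> limitin (mtopology_of m) t p sequentially"
    if t: "range t \<subseteq> mspace m" for t
  proof -
    interpret A: Metric_space "mspace m" "mdist m" by (rule Metric_space_mspace_mdist)
    interpret B: Metric_space "mspace m'" "mdist m'" by (rule Metric_space_mspace_mdist)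
    have tm: "t i \<in> mspace m" for i using t by auto
    have fm: "f x \<in> mspace m'" if "x \<in> mspace m" for x using that f(1) by auto
    show ?thesis
      unfolding mtopology_of_def A.limitin_metric B.limitin_metric by (simp add: comp_def tm fm p f(2))
  qed
  have L: "Liminf (sequentially \<times>\<^sub>F sequentially) (\<lambda>(i, j). ereal (gromov_product m' (f z) ((f \<circ> s) i) ((f \<circ> t) j)))
      = Liminf (sequentially \<times>\<^sub>F sequentially) (\<lambda>(i, j). ereal (gp z (s i) (t j)))"
    if "s \<in> c" "range t \<subseteq> mspace m" for s t
    using that boundary_seq(3)[OF c] by (intro arg_cong[where f = "Liminf _"] ext) (auto simp: gp subset_eq)
  show ?thesis
    unfolding gromov_product_ext_def
  proof (rule INF_eq)
    fix q assume "q \<in> representing_sequences m' (Inr ((\<lambda>s. f \<circ> s) ` c)) \<times> representing_sequences m' (Inl (f p))"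
    then obtain s t' where q: "q = (f \<circ> s, t')" "s \<in> c" "range t' \<subseteq> mspace m'" "limitin (mtopology_of m') t' (f p) sequentially"
      by auto
    have "\<forall>i. \<exists>x\<in>mspace m. t' i = f x" using q(3) f(1) by (auto simp: subset_eq image_iff)
    then obtain t where t: "\<And>i. t i \<in> mspace m" "\<And>i. t' i = f (t i)" by metis
    then have t': "t' = f \<circ> t" "range t \<subseteq> mspace m" by auto
    then have "(s, t) \<in> representing_sequences m (Inr c) \<times> representing_sequences m (Inl p)"
      using q lim by auto
    then show "\<exists>q'\<in>representing_sequences m (Inr c) \<times> representing_sequences m (Inl p).
        (case q' of (s, t) \<Rightarrow> Liminf (sequentially \<times>\<^sub>F sequentially) (\<lambda>(i, j). ereal (gp z (s i) (t j))))
        \<le> (case q of (s, t) \<Rightarrow> Liminf (sequentially \<times>\<^sub>F sequentially) (\<lambda>(i, j). ereal (gromov_product m' (f z) (s i) (t j))))"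
      using L[OF q(2) t'(2)] unfolding q(1) t'(1) by (intro bexI[of _ "(s, t)"]) auto
  next
    fix q assume "q \<in> representing_sequences m (Inr c) \<times> representing_sequences m (Inl p)"
    then obtain s t where q: "q = (s, t)" "s \<in> c" "range t \<subseteq> mspace m" "limitin (mtopology_of m) t p sequentially"
      by auto
    have "(f \<circ> s, f \<circ> t) \<in> representing_sequences m' (Inr ((\<lambda>s. f \<circ> s) ` c)) \<times> representing_sequences m' (Inl (f p))"
      using q lim[OF q(3)] f(1) by auto
    then show "\<exists>q'\<in>representing_sequences m' (Inr ((\<lambda>s. f \<circ> s) ` c)) \<times> representing_sequences m' (Inl (f p)).
        (case q' of (s, t) \<Rightarrow> Liminf (sequentially \<times>\<^sub>F sequentially) (\<lambda>(i, j). ereal (gromov_product m' (f z) (s i) (t j))))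
        \<le> (case q of (s, t) \<Rightarrow> Liminf (sequentially \<times>\<^sub>F sequentially) (\<lambda>(i, j). ereal (gp z (s i) (t j))))"
      using L[OF q(2,3)] unfolding q(1) by (intro bexI[of _ "(f \<circ> s, f \<circ> t)"]) auto
  qed
qed

text \<open>This turns the infimum over uncountably many sequences into a countable formula, the lower limit of
\<open>(q|p)\<close> for \<open>q\<close> in the dense set tending to the boundary point. A neighbourhood base is given by the
conditions that \<open>(q|s i)\<close> is eventually at least \<open>N\<close>. Points \<open>q\<^sub>N\<close> of the \<open>N\<close>-th neighbourhood that nearly
attain the infimum form a representing sequence.\<close>
lemma ext_point_countable:
  fixes \<tau> :: "nat \<Rightarrow> 'h"
  assumes dense: "\<And>x e. x \<in> mspace m \<Longrightarrow> e > 0 \<Longrightarrow> \<exists>k. mdist m x (\<tau> k) < e" and \<tau>: "\<And>k. \<tau> k \<in> mspace m"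
    and c: "c \<in> gromov_boundary m" and s: "s \<in> c" and z: "z \<in> mspace m" and p: "p \<in> mspace m"
  shows "ext z (Inr c) (Inl p) =
    (SUP N::nat. INF k. if \<exists>n. \<forall>i\<ge>n. real N \<le> gp z (\<tau> k) (s i) then ereal (gp z (\<tau> k) p) else \<infinity>)"
proof -
  define V where "V N k \<longleftrightarrow> (\<exists>n. \<forall>i\<ge>n. real N \<le> gp z (\<tau> k) (s i))" for N k
  define I where "I N = (INF k. if V N k then ereal (gp z (\<tau> k) p) else \<infinity>)" for N
  note inm = boundary_seq(3)[OF c s]
  have lower: "I N \<le> ext z (Inr c) (Inl p)" for N
    unfolding gromov_product_ext_def
  proof (intro INF_greatest, clarify)
    fix s' t assume s': "s' \<in> representing_sequences m (Inr c)" and t: "t \<in> representing_sequences m (Inl p)"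
    then have s': "s' \<in> c" by simp
    note inm' = boundary_seq(3)[OF c s'] point_represents(2)[OF t, of 1, simplified]
    show "I N \<le> Liminf (sequentially \<times>\<^sub>F sequentially) (\<lambda>(i, j). ereal (gp z (s' i) (t j)))"
    proof (rule ereal_le_epsilon2)
      fix e :: real assume e: "e > 0"
      define e' where "e' = min 1 (e / 2)"
      have e': "e' > 0" "e' \<le> 1" "2 * e' \<le> e" using e by (auto simp: e'_def)
      obtain a where a: "\<And>j. j \<ge> a \<Longrightarrow> mdist m (t j) p < e'" using point_represents(1)[OF t e'(1)] by blast
      obtain b where b: "\<And>i j. i \<ge> b \<Longrightarrow> j \<ge> b \<Longrightarrow> real N + 1 \<le> gp z (s' i) (s j)"
        by (rule boundary_far[OF c s' s z, of "real N + 1"]) (rule that)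
      have "I N - ereal e \<le> ereal (gp z (s' i) (t j))" if ij: "i \<ge> max a b" "j \<ge> max a b" for i j
      proof -
        obtain k where k: "mdist m (s' i) (\<tau> k) < e'" using dense[OF inm'(1) e'(1)] by blast
        have "real N \<le> gp z (\<tau> k) (s l)" if "l \<ge> b" for l
          using gromov_product_change_point[OF inm'(1)[of i] \<tau>[of k] inm[of l] z] b[of i l] that ij k e' by auto
        then have "V N k" unfolding V_def by blast
        then have "I N \<le> ereal (gp z (\<tau> k) p)" unfolding I_def by (intro INF_lower2[of k]) auto
        also have "gp z (\<tau> k) p \<le> gp z (s' i) p + e'"
          using gromov_product_change_point[OF \<tau>[of k] inm'(1)[of i] p z] k by (simp add: mdist_commute)
        also have "gp z (s' i) p \<le> gp z (s' i) (t j) + e'"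
          using gromov_product_change_point[OF p inm'(2)[of j] inm'(1)[of i] z] a[of j] ij
          by (simp add: gromov_product_commute[of m z _ "s' i"] mdist_commute)
        finally have "I N \<le> ereal (gp z (s' i) (t j) + e' + e')" by (simp add: add_right_mono)
        then have "I N \<le> ereal (gp z (s' i) (t j)) + ereal e"
          using e'(3) by (elim order_trans) simp
        then show ?thesis by (simp add: ereal_minus_le_iff add.commute)
      qed
      then have "\<forall>\<^sub>F x in sequentially \<times>\<^sub>F sequentially. I N - ereal e \<le> (\<lambda>(i, j). ereal (gp z (s' i) (t j))) x"
        unfolding eventually_prod_sequentially by (intro exI[of _ "max a b"]) auto
      then have "I N - ereal e \<le> Liminf (sequentially \<times>\<^sub>F sequentially) (\<lambda>(i, j). ereal (gp z (s' i) (t j)))"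
        by (rule Liminf_bounded)
      then show "I N \<le> Liminf (sequentially \<times>\<^sub>F sequentially) (\<lambda>(i, j). ereal (gp z (s' i) (t j))) + ereal e"
        by (simp add: ereal_minus_le_iff add.commute)
    qed
  qed
  have upper: "ext z (Inr c) (Inl p) \<le> (SUP N. I N)"
  proof (rule ereal_le_epsilon2)
    fix e :: real assume e: "e > 0"
    have I_finite: "\<bar>I N\<bar> \<noteq> \<infinity>" for N
    proof -
      have "0 \<le> I N" unfolding I_def using gromov_product_nonneg[OF \<tau> p z] by (intro INF_greatest) simp
      moreover have "I N \<le> ereal (mdist m p z)" using lower ext_point_le[OF c p z] order_trans by blast
      ultimately show ?thesis by auto
    qed
    have "\<exists>k. V N k \<and> ereal (gp z (\<tau> k) p) < I N + ereal e" for N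
    proof -
      have "I N < I N + ereal e" using I_finite[of N] e by (cases "I N") auto
      then obtain k where "(if V N k then ereal (gp z (\<tau> k) p) else \<infinity>) < I N + ereal e"
        unfolding I_def INF_less_iff by blast
      then show ?thesis by (cases "V N k") auto
    qed
    then obtain k where k: "\<And>N. V N (k N)" "\<And>N. ereal (gp z (\<tau> (k N)) p) < I N + ereal e" by metis
    define t where "t N = \<tau> (k N)" for N
    have tm: "range t \<subseteq> mspace m" using \<tau> by (auto simp: t_def)
    have "gromov_asymptotic m s t"
      unfolding gromov_asymptotic_iff[OF boundary_seq(1)[OF c s] tm z]
    proof
      fix N :: real
      obtain a where a: "\<And>i j. i \<ge> a \<Longrightarrow> j \<ge> a \<Longrightarrow> N + \<delta> + 1 \<le> gp z (s i) (s j)"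
        by (rule boundary_far[OF c s s z, of "N + \<delta> + 1"]) (rule that)
      obtain N' :: nat where N': "N + \<delta> + 1 < real N'" using reals_Archimedean2 by blast
      have "N \<le> gp z (s i) (t j)" if ij: "i \<ge> max a N'" "j \<ge> max a N'" for i j
      proof -
        obtain n where n: "\<And>l. l \<ge> n \<Longrightarrow> real j \<le> gp z (t j) (s l)" using k(1)[of j] by (auto simp: V_def t_def)
        have "real N' \<le> real j" using ij by simp
        then show ?thesis
          using n[of "max n a"] a[of i "max n a"] ij N'
            hyperbolic[OF inm[of i] \<tau>[of "k j"] z inm[of "max n a"]]
          by (auto simp: t_def gromov_product_commute[of m z "\<tau> _"])
      qed
      then show "\<exists>n. \<forall>i\<ge>n. \<forall>j\<ge>n. N \<le> gp z (s i) (t j)" by blast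
    qed
    then have "t \<in> c" by (rule boundary_mem[OF c s tm])
    then have "ext z (Inr c) (Inl p) \<le> Liminf (sequentially \<times>\<^sub>F sequentially) (\<lambda>(i, j). ereal (gp z (t i) p))"
      unfolding gromov_product_ext_def
      by (intro INF_lower2[of "(t, \<lambda>_. p)"]) (use const_represents[OF p] in auto)
    also have "\<dots> \<le> Limsup (sequentially \<times>\<^sub>F sequentially) (\<lambda>(i, j). ereal (gp z (t i) p))"
      by (rule Liminf_le_Limsup) (simp add: prod_filter_eq_bot)
    also have "\<dots> \<le> (SUP N. I N) + ereal e"
    proof (intro Limsup_bounded always_eventually allI, clarify)
      fix i j
      have "ereal (gp z (t i) p) \<le> I i + ereal e" using k(2)[of i] by (simp add: t_def less_imp_le)
      also have "\<dots> \<le> (SUP N. I N) + ereal e" by (intro add_right_mono SUP_upper) simp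
      finally show "ereal (gp z (t i) p) \<le> (SUP N. I N) + ereal e" .
    qed
    finally show "ext z (Inr c) (Inl p) \<le> (SUP N. I N) + ereal e" .
  qed
  have "ext z (Inr c) (Inl p) = (SUP N. I N)"
    by (rule antisym[OF upper]) (intro SUP_least lower)
  then show ?thesis unfolding I_def V_def .
qed

lemma openin_mtopology_of_iff:
  "openin (mtopology_of m) V \<longleftrightarrow> V \<subseteq> mspace m \<and> (\<forall>x\<in>V. \<exists>r>0. mball_of m x r \<subseteq> V)"
proof -
  interpret Metric_space "mspace m" "mdist m" by (rule Metric_space_mspace_mdist)
  show ?thesis unfolding mtopology_of_def openin_mtopology mball_of_def by auto
qed

text \<open>The sets \<open>{\<eta>. (c|\<eta>) > r}\<close> need not be open, so an open neighbourhood missing the orbit has to be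
constructed: it consists of the points outside the orbit, boundary points being admitted only if
their products with the points of the orbit are bounded.\<close>
lemma closure_point_approached:
  assumes O: "Or \<subseteq> mspace m" and loc_fin: "\<And>x r. x \<in> mspace m \<Longrightarrow> finite (Or \<inter> mball_of m x r)"
    and c: "c \<in> gromov_boundary m" and cl: "Inr c \<in> gromov_topology m closure_of (Inl ` Or)" and z: "z \<in> mspace m"
  shows "\<exists>y\<in>Or. r < boundary_product z c y"
proof (rule ccontr)
  assume "\<not> ?thesis"
  then have none: "boundary_product z c y \<le> r" if "y \<in> Or" for y using that by force
  define U where "U = {\<eta> \<in> gromov_completion m. \<eta> \<notin> Inl ` Or \<and> (\<forall>c'. \<eta> = Inr c' \<longrightarrow> (\<exists>r. \<forall>y\<in>Or. boundary_product z c' y \<le> r))}"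
  have bd: "c' \<in> gromov_boundary m" if "Inr c' \<in> U" for c' using that by (auto simp: U_def gromov_completion_def)
  have "gromov_open m U"
    unfolding gromov_open_def
  proof (intro conjI allI impI ballI)
    show "U \<subseteq> gromov_completion m" by (auto simp: U_def)
    have "{p. Inl p \<in> U} = mspace m - Or" by (auto simp: U_def gromov_completion_def)
    moreover have "openin (mtopology_of m) (mspace m - Or)"
      unfolding openin_mtopology_of_iff
    proof (intro conjI ballI)
      fix x assume x: "x \<in> mspace m - Or"
      define e where "e = Min (insert 1 (mdist m x ` (Or \<inter> mball_of m x 1)))"
      have fin: "finite (insert 1 (mdist m x ` (Or \<inter> mball_of m x 1)))" using loc_fin x by auto
      have "e > 0" unfolding e_def using fin x O by (subst Min_gr_iff) (auto intro!: mdist_pos_less' simp: subset_eq)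
      moreover have "mball_of m x e \<subseteq> mspace m - Or"
      proof
        fix y assume y: "y \<in> mball_of m x e"
        interpret Metric_space "mspace m" "mdist m" by (rule Metric_space_mspace_mdist)
        have y': "y \<in> mspace m" "mdist m x y < e" using y by (auto simp: mball_of_def)
        have "e \<le> 1" unfolding e_def using fin by (intro Min_le) auto
        have "y \<notin> Or"
        proof
          assume "y \<in> Or"
          then have "y \<in> Or \<inter> mball_of m x 1" using y' \<open>e \<le> 1\<close> x by (auto simp: mball_of_def)
          then have "e \<le> mdist m x y" unfolding e_def using fin by (intro Min_le) auto
          then show False using y' by simp
        qed
        then show "y \<in> mspace m - Or" using y' by simp
      qed
      ultimately show "\<exists>r>0. mball_of m x r \<subseteq> mspace m - Or" by blast
    qed auto
    ultimately show "openin (mtopology_of m) {p. Inl p \<in> U}" by simp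
    fix c' z' assume c'U: "Inr c' \<in> U" and z': "z' \<in> mspace m"
    note c' = bd[OF c'U]
    obtain b where b: "\<And>y. y \<in> Or \<Longrightarrow> boundary_product z c' y \<le> b" using c'U by (auto simp: U_def)
    obtain s where s: "s \<in> c'" using boundary_nonempty[OF c'] ..
    define r' where "r' = b + 2 * \<delta> + 1 + mdist m z z'"
    show "\<exists>r. {\<eta> \<in> gromov_completion m. ereal r < gromov_product_ext m z' (Inr c') \<eta>} \<subseteq> U"
    proof (intro exI[of _ r'] subsetI, clarify)
      fix \<eta> assume \<eta>: "\<eta> \<in> gromov_completion m" "ereal r' < ext z' (Inr c') \<eta>"
      show "\<eta> \<in> U"
      proof (cases \<eta>)
        case (Inl p)
        have "p \<notin> Or"
        proof
          assume p: "p \<in> Or"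
          then have pm: "p \<in> mspace m" using O by auto
          obtain n where n: "\<forall>i\<ge>n. r' < gp z' (s i) p"
            using ext_point_greaterD[OF c' pm _ s] \<eta>(2) Inl by blast
          obtain n' where n': "\<forall>i\<ge>n'. gp z (s i) p < b + 1 + \<delta>"
            using boundary_product_eventually_less[OF c' s pm z, of "b + 1"] b[OF p] by auto
          have "r' < gp z' (s (max n n')) p" "gp z (s (max n n')) p < b + 1 + \<delta>" using n n' by auto
          then show False
            using gromov_product_change_base[OF boundary_seq(3)[OF c' s, of "max n n'"] pm z' z] \<delta>_nonneg
            unfolding r'_def by (simp add: mdist_commute)
        qed
        then show ?thesis using Inl \<eta>(1) by (auto simp: U_def)
      next
        case (Inr c'')
        then have c'': "c'' \<in> gromov_boundary m" using \<eta>(1) by (auto simp: gromov_completion_def)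
        obtain t where t: "t \<in> c''" using boundary_nonempty[OF c''] ..
        obtain n where n: "\<forall>i\<ge>n. \<forall>j\<ge>n. r' < gp z' (s i) (t j)"
          using ext_boundary_greaterD[OF _ s t] \<eta>(2) Inr by blast
        have "boundary_product z c'' y \<le> b + 2 * \<delta> + 1" if y: "y \<in> Or" for y
        proof (rule ccontr)
          assume "\<not> ?thesis"
          then have far: "b + 2 * \<delta> + 1 < boundary_product z c'' y" by simp
          have ym: "y \<in> mspace m" using y O by auto
          obtain k where k: "\<forall>i\<ge>k. b + 2 * \<delta> + 1 < gp z (t i) y"
            using boundary_product_eventually_greater[OF c'' t ym z far] by blast
          obtain n' where n': "\<forall>i\<ge>n'. gp z (s i) y < b + 1 + \<delta>"
            using boundary_product_eventually_less[OF c' s ym z, of "b + 1"] b[OF y] by auto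
          let ?M = "max n (max k n')"
          have "r' < gp z' (s ?M) (t ?M)" "b + 2 * \<delta> + 1 < gp z (t ?M) y" "gp z (s ?M) y < b + 1 + \<delta>"
            using n k n' by auto
          then show False
            using gromov_product_change_base[OF boundary_seq(3)[OF c' s, of ?M] boundary_seq(3)[OF c'' t, of ?M] z' z] \<delta>_nonneg
              hyperbolic[OF boundary_seq(3)[OF c' s, of ?M] ym z boundary_seq(3)[OF c'' t, of ?M]]
            unfolding r'_def by (auto simp: mdist_commute)
        qed
        then show ?thesis using Inr \<eta>(1) by (auto simp: U_def)
      qed
    qed
  qed
  moreover have "Inr c \<in> U" using c none by (auto simp: U_def gromov_completion_def)
  ultimately obtain \<eta> where "\<eta> \<in> Inl ` Or" "\<eta> \<in> U"
    using cl unfolding in_closure_of openin_gromov_topology by blast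
  then show False by (simp add: U_def)
qed

lemma closed_set_separated:
  assumes K: "closedin (gromov_topology m) K" and c: "c \<in> gromov_boundary m" and "Inr c \<notin> K" and z: "z \<in> mspace m"
  obtains r where "\<And>\<eta>. \<eta> \<in> K \<Longrightarrow> ext z (Inr c) \<eta> \<le> ereal r"
proof -
  have "gromov_open m (gromov_completion m)"
    unfolding gromov_open_def
  proof (intro conjI allI impI ballI)
    have "{p. Inl p \<in> gromov_completion m} = mspace m" by (auto simp: gromov_completion_def)
    then show "openin (mtopology_of m) {p. Inl p \<in> gromov_completion m}"
      using openin_topspace[of "mtopology_of m"] by simp
  qed auto
  then have top: "gromov_completion m \<subseteq> topspace (gromov_topology m)"
    unfolding openin_gromov_topology[symmetric] by (rule openin_subset)
  have "gromov_open m (topspace (gromov_topology m) - K)"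
    using K unfolding closedin_def openin_gromov_topology by blast
  moreover have "Inr c \<in> topspace (gromov_topology m) - K"
    using top c assms(3) by (auto simp: gromov_completion_def)
  ultimately obtain r where r: "{\<eta> \<in> gromov_completion m. gromov_product_ext m z (Inr c) \<eta> > ereal r} \<subseteq> topspace (gromov_topology m) - K"
    using z unfolding gromov_open_def by blast
  have K_sub: "K \<subseteq> gromov_completion m"
  proof -
    have "gromov_open m (topspace (gromov_topology m))"
      unfolding openin_gromov_topology[symmetric] by simp
    then show ?thesis using closedin_subset[OF K] by (auto simp: gromov_open_def)
  qed
  have "ext z (Inr c) \<eta> \<le> ereal r" if "\<eta> \<in> K" for \<eta>
  proof (rule ccontr)
    assume "\<not> ext z (Inr c) \<eta> \<le> ereal r"
    then have "\<eta> \<in> {\<eta> \<in> gromov_completion m. gromov_product_ext m z (Inr c) \<eta> > ereal r}"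
      using K_sub that by auto
    then show False using subsetD[OF r] that by blast
  qed
  then show thesis by (rule that)
qed

end

section \<open>Enumerating the classes of the relation\<close>

lemma completion_measurable_modification:
  assumes f: "f \<in> completion M \<rightarrow>\<^sub>M N" and g [measurable]: "g \<in> M \<rightarrow>\<^sub>M N" and N: "standard_borel N"
  obtains N0 where "N0 \<in> null_sets M" "(\<lambda>x. if x \<in> N0 then g x else f x) \<in> M \<rightarrow>\<^sub>M N"
proof -
  obtain U :: "nat \<Rightarrow> _ set" where U [measurable]: "\<And>n. U n \<in> sets N" and gen: "sets N = sigma_sets (space N) (range U)"
    by (rule standard_borel_base[OF N]) (rule that)
  have "\<exists>S Z. f -` U n \<inter> space M \<subseteq> S \<union> Z \<and> S \<subseteq> f -` U n \<inter> space M \<and> S \<in> sets M \<and> Z \<in> null_sets M" for n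
  proof -
    have "f -` U n \<inter> space M \<in> sets (completion M)" using measurable_sets[OF f U] by simp
    then show ?thesis by (elim sets_completionE) blast
  qed
  then obtain S Z where S: "\<And>n. f -` U n \<inter> space M \<subseteq> S n \<union> Z n" "\<And>n. S n \<subseteq> f -` U n \<inter> space M"
    "\<And>n. S n \<in> sets M" and Z: "\<And>n. Z n \<in> null_sets M"
    by metis
  define N0 where "N0 = (\<Union>n. Z n)"
  have N0: "N0 \<in> null_sets M" unfolding N0_def using Z by (rule null_sets_UN)
  note [measurable] = S(3) null_setsD2[OF N0]
  have "(\<lambda>x. if x \<in> N0 then g x else f x) \<in> M \<rightarrow>\<^sub>M N"
  proof (rule measurable_sigma_sets[OF gen])
    show "range U \<subseteq> Pow (space N)" using sets.sets_into_space[OF U] by auto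
    show "(\<lambda>x. if x \<in> N0 then g x else f x) \<in> space M \<rightarrow> space N"
      using measurable_space[OF f] measurable_space[OF g] by auto
    fix A assume "A \<in> range U"
    then obtain n where A: "A = U n" by auto
    have "(\<lambda>x. if x \<in> N0 then g x else f x) -` A \<inter> space M = {x \<in> space M. x \<in> N0 \<and> g x \<in> U n} \<union> (S n - N0)"
    proof (rule set_eqI)
      fix x
      show "x \<in> (\<lambda>x. if x \<in> N0 then g x else f x) -` A \<inter> space M \<longleftrightarrow>
        x \<in> {x \<in> space M. x \<in> N0 \<and> g x \<in> U n} \<union> (S n - N0)"
      proof (cases "x \<in> N0")
        case False
        then have "x \<notin> Z n" by (auto simp: N0_def)
        then have "x \<in> f -` U n \<inter> space M \<longleftrightarrow> x \<in> S n" using S(1,2)[of n] by blast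
        then show ?thesis using False A by simp
      qed (use A in auto)
    qed
    then show "(\<lambda>x. if x \<in> N0 then g x else f x) -` A \<inter> space M \<in> sets M" by simp
  qed
  with N0 show thesis by (rule that)
qed

lemma standard_borel_eq_measurable:
  assumes M: "standard_borel M" and "f \<in> N \<rightarrow>\<^sub>M M" "g \<in> N \<rightarrow>\<^sub>M M"
  shows "Measurable.pred N (\<lambda>x. f x = g x)"
proof -
  obtain U :: "nat \<Rightarrow> _ set" where U: "\<And>n. U n \<in> sets M"
    and iso: "\<And>F x. finite F \<Longrightarrow> F \<subseteq> space M \<Longrightarrow> x \<in> space M \<Longrightarrow> x \<notin> F \<Longrightarrow> \<exists>n. x \<in> U n \<and> U n \<inter> F = {}"
    by (rule standard_borel_base[OF M]) (rule that)
  have "\<exists>n. x \<in> U n \<and> y \<notin> U n" if "x \<in> space M" "y \<in> space M" "x \<noteq> y" for x y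
    using iso[of "{y}" x] that by auto
  from separated_eq_measurable[OF U this assms(2,3)] show ?thesis .
qed

text \<open>The relation \<open>F n\<close> has a spare variable \<open>p\<close>, which is projected away. A point of a finite section is
isolated in it by a base set \<open>U k\<close>; on the set \<open>D n k\<close> where the section has exactly one point in \<open>U k\<close>,
this point is a measurable function of \<open>x\<close>, for the completed measure and hence, off a null set, in the
Borel sense.\<close>
lemma enumerate_finite_sections:
  fixes F :: "nat \<Rightarrow> ('x \<times> ('x \<times> 'h)) set"
  assumes M: "standard_borel M" and \<nu>: "finite_measure \<nu>" "sets \<nu> = sets M" and B: "souslin_space B" and sM: "souslin_space M"
    and F [measurable]: "\<And>n. F n \<in> sets (M \<Otimes>\<^sub>M (M \<Otimes>\<^sub>M B))"
    and FR: "\<And>n x y p. (x, (y, p)) \<in> F n \<Longrightarrow> (x, y) \<in> R" and R_refl: "\<And>x. x \<in> space M \<Longrightarrow> (x, x) \<in> R"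
  obtains g :: "nat \<Rightarrow> 'x \<Rightarrow> 'x" and N where "\<And>i. g i \<in> M \<rightarrow>\<^sub>M M" "\<And>i x. x \<in> space M \<Longrightarrow> (x, g i x) \<in> R"
    "N \<in> null_sets \<nu>"
    "\<And>n x y. x \<in> space M \<Longrightarrow> x \<notin> N \<Longrightarrow> finite {y. \<exists>p. (x, (y, p)) \<in> F n} \<Longrightarrow> \<exists>p. (x, (y, p)) \<in> F n \<Longrightarrow> \<exists>i. y = g i x"
proof -
  have sp: "space \<nu> = space M" by (rule sets_eq_imp_space_eq[OF \<nu>(2)])
  obtain U :: "nat \<Rightarrow> _ set" where U [measurable]: "\<And>n. U n \<in> sets M"
    and sep: "\<And>F x. finite F \<Longrightarrow> F \<subseteq> space M \<Longrightarrow> x \<in> space M \<Longrightarrow> x \<notin> F \<Longrightarrow> \<exists>n. x \<in> U n \<and> U n \<inter> F = {}"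
    by (rule standard_borel_base[OF M]) (rule that)
  define P where "P n x y \<longleftrightarrow> (\<exists>p. (x, (y, p)) \<in> F n)" for n x y
  have P_space: "x \<in> space M \<and> y \<in> space M" if "P n x y" for n x y
    using that sets.sets_into_space[OF F, of n] unfolding P_def by (auto simp: space_pair_measure)
  define T where "T n k A = {x. \<exists>y\<in>A \<inter> U k. P n x y}" for n k A
  have T_meas: "T n k A \<in> sets (completion \<nu>)" if [measurable]: "A \<in> sets M" for n k A
  proof -
    let ?E = "F n \<inter> (space M \<times> ((A \<inter> U k) \<times> space B))"
    have "?E \<in> sets (M \<Otimes>\<^sub>M (M \<Otimes>\<^sub>M B))" by measurable
    then have E: "?E \<in> sets (\<nu> \<Otimes>\<^sub>M (M \<Otimes>\<^sub>M B))"
      using sets_pair_measure_cong[OF \<nu>(2) refl, of "M \<Otimes>\<^sub>M B"] by simp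
    have "T n k A = {x. \<exists>q. (x, q) \<in> ?E}"
      using sets.sets_into_space[OF F, of n] by (auto simp: T_def P_def space_pair_measure)
    then show ?thesis
      using measurable_projection[OF \<nu>(1) souslin_space_pair[OF sM B] E] by simp
  qed
  define D where "D n k = T n k (space M) - (\<Union>l. T n k (U l) \<inter> T n k (space M - U l))" for n k
  have D_meas: "D n k \<in> sets (completion \<nu>)" for n k
    unfolding D_def by (intro sets.Diff sets.countable_UN'' sets.Int T_meas) auto
  have D_iff: "x \<in> D n k \<longleftrightarrow> (\<exists>!y. y \<in> U k \<and> P n x y)" for x n k
  proof
    assume x: "x \<in> D n k"
    then obtain y where y: "y \<in> U k" "P n x y" by (auto simp: D_def T_def)
    show "\<exists>!y. y \<in> U k \<and> P n x y"
    proof (rule ex1I[of _ y])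
      fix y' assume y': "y' \<in> U k \<and> P n x y'"
      show "y' = y"
      proof (rule ccontr)
        assume "y' \<noteq> y"
        then obtain l where l: "y' \<in> U l" "y \<notin> U l" using sep[of "{y}" y'] P_space y y' by blast
        then have "x \<in> T n k (U l) \<inter> T n k (space M - U l)" using y y' P_space by (auto simp: T_def)
        then show False using x by (auto simp: D_def)
      qed
    qed (use y in simp)
  next
    assume ex1: "\<exists>!y. y \<in> U k \<and> P n x y"
    then show "x \<in> D n k" using P_space unfolding D_def T_def by blast
  qed
  define g0 where "g0 n k x = (if x \<in> D n k then THE y. y \<in> U k \<and> P n x y else x)" for n k x
  have g0D: "g0 n k x \<in> U k" "P n x (g0 n k x)" if "x \<in> D n k" for n k x
    using theI'[OF D_iff[THEN iffD1, OF that]] that by (auto simp: g0_def)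
  have g0_unique: "y = g0 n k x" if "x \<in> D n k" "y \<in> U k" "P n x y" for n k x y
    using D_iff[THEN iffD1, OF that(1)] g0D[OF that(1)] that by blast
  have D_space: "x \<in> D n k \<Longrightarrow> x \<in> space M" for x n k using P_space g0D(2) by blast
  have g0_meas: "g0 n k \<in> completion \<nu> \<rightarrow>\<^sub>M M" for n k
  proof (rule measurableI)
    show "g0 n k x \<in> space M" if "x \<in> space (completion \<nu>)" for x
      using that P_space[OF g0D(2)[of x n k]] sp by (cases "x \<in> D n k") (auto simp: g0_def)
    fix A assume A: "A \<in> sets M"
    have "g0 n k -` A \<inter> space (completion \<nu>) = (D n k \<inter> T n k A) \<union> (A - D n k)"
    proof (intro equalityI subsetI)
      fix x assume x: "x \<in> g0 n k -` A \<inter> space (completion \<nu>)"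
      show "x \<in> (D n k \<inter> T n k A) \<union> (A - D n k)"
      proof (cases "x \<in> D n k")
        case True
        then show ?thesis using x g0D[OF True] by (auto simp: T_def)
      qed (use x in \<open>auto simp: g0_def\<close>)
    next
      fix x assume x: "x \<in> (D n k \<inter> T n k A) \<union> (A - D n k)"
      then have xs: "x \<in> space (completion \<nu>)"
        using D_space sets.sets_into_space[OF A] sp by auto
      show "x \<in> g0 n k -` A \<inter> space (completion \<nu>)"
      proof (cases "x \<in> D n k")
        case True
        then obtain y where "y \<in> A" "y \<in> U k" "P n x y" using x by (auto simp: T_def)
        then show ?thesis using g0_unique[OF True] xs by auto
      qed (use x xs in \<open>auto simp: g0_def\<close>)
    qed
    moreover have "A \<in> sets (completion \<nu>)" using A \<nu>(2) by (intro sets_completionI_sets) simp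
    ultimately show "g0 n k -` A \<inter> space (completion \<nu>) \<in> sets (completion \<nu>)"
      using D_meas T_meas[OF A] by auto
  qed
  have "\<exists>N0. N0 \<in> null_sets \<nu> \<and> (\<lambda>x. if x \<in> N0 then x else g0 n k x) \<in> M \<rightarrow>\<^sub>M M" for n k
  proof -
    have "(\<lambda>x. x) \<in> \<nu> \<rightarrow>\<^sub>M M" by (rule measurable_ident_sets[OF \<nu>(2)])
    then obtain N0 where "N0 \<in> null_sets \<nu>" "(\<lambda>x. if x \<in> N0 then x else g0 n k x) \<in> \<nu> \<rightarrow>\<^sub>M M"
      by (rule completion_measurable_modification[OF g0_meas[of n k] _ M])
    then show ?thesis using measurable_cong_sets[OF \<nu>(2) refl] by blast
  qed
  then obtain N0 where N0: "\<And>n k. N0 n k \<in> null_sets \<nu>"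
    "\<And>n k. (\<lambda>x. if x \<in> N0 n k then x else g0 n k x) \<in> M \<rightarrow>\<^sub>M M"
    by metis
  define g where "g i x = (if x \<in> N0 (fst (prod_decode i)) (snd (prod_decode i)) then x
    else g0 (fst (prod_decode i)) (snd (prod_decode i)) x)" for i x
  show thesis
  proof (rule that[of g "\<Union>i. N0 (fst (prod_decode i)) (snd (prod_decode i))"])
    show "g i \<in> M \<rightarrow>\<^sub>M M" for i unfolding g_def by (rule N0)
    have "(x, g0 n k x) \<in> R" if "x \<in> space M" for n k x
    proof (cases "x \<in> D n k")
      case True
      then show ?thesis using g0D(2) FR unfolding P_def by blast
    qed (use that R_refl in \<open>simp add: g0_def\<close>)
    then show "(x, g i x) \<in> R" if "x \<in> space M" for i x
      using that R_refl by (simp add: g_def)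
    show "(\<Union>i. N0 (fst (prod_decode i)) (snd (prod_decode i))) \<in> null_sets \<nu>"
      by (intro null_sets_UN N0)
    fix n x y assume x: "x \<in> space M" "x \<notin> (\<Union>i. N0 (fst (prod_decode i)) (snd (prod_decode i)))"
      and fin: "finite {y. \<exists>p. (x, (y, p)) \<in> F n}" and y: "\<exists>p. (x, (y, p)) \<in> F n"
    have fin': "finite ({y. P n x y} - {y})" using fin by (simp add: P_def)
    have Py: "P n x y" using y by (simp add: P_def)
    obtain k where k: "y \<in> U k" "U k \<inter> ({y. P n x y} - {y}) = {}"
      using sep[OF fin', of y] P_space P_space[OF Py] by blast
    have "\<exists>!y. y \<in> U k \<and> P n x y" by (rule ex1I[of _ y]) (use k Py in auto)
    then have "x \<in> D n k" by (simp add: D_iff)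
    from g0_unique[OF this k(1) Py] have "y = g0 n k x" .
    moreover have "x \<notin> N0 n k" using x(2) by (metis UN_I UNIV_I fst_conv snd_conv prod_encode_inverse)
    ultimately have "y = g (prod_encode (n, k)) x" by (simp add: g_def)
    then show "\<exists>i. y = g i x" ..
  qed
qed

text \<open>A finite measure whose null sets are exactly the sets that are avoided by almost every \<open>g i x\<close>: the
average of the image measures with geometric weights.\<close>
lemma mixture_measure:
  fixes g :: "nat \<Rightarrow> 'x \<Rightarrow> 'x"
  assumes "prob_space M" and g: "\<And>i. g i \<in> M \<rightarrow>\<^sub>M M"
  obtains \<nu> where "finite_measure \<nu>" "sets \<nu> = sets M"
    "\<And>S. S \<in> null_sets \<nu> \<longleftrightarrow> S \<in> sets M \<and> (\<forall>i. AE x in M. g i x \<notin> S)"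
proof -
  interpret prob_space M by fact
  let ?K = "measure_pmf (geometric_pmf (1/2))"
  interpret K: prob_space ?K by (rule measure_pmf.prob_space_axioms)
  interpret pair_prob_space ?K M ..
  have m: "(\<lambda>p. g (fst p) (snd p)) \<in> ?K \<Otimes>\<^sub>M M \<rightarrow>\<^sub>M M"
  proof -
    have "(\<lambda>p. g (fst p) (snd p)) \<in> count_space UNIV \<Otimes>\<^sub>M M \<rightarrow>\<^sub>M M"
      by (rule measurable_pair_measure_countable1) (use g in auto)
    then show ?thesis
      by (subst measurable_cong_sets[OF sets_pair_measure_cong[OF sets_measure_pmf_count_space refl] refl])
  qed
  define \<nu> where "\<nu> = distr (?K \<Otimes>\<^sub>M M) M (\<lambda>p. g (fst p) (snd p))"
  show thesis
  proof (rule that[of \<nu>])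
    show "finite_measure \<nu>" unfolding \<nu>_def using m
      by (intro prob_space.finite_measure prob_space_distr) 
    show "sets \<nu> = sets M" by (simp add: \<nu>_def)
    fix S
    show "S \<in> null_sets \<nu> \<longleftrightarrow> S \<in> sets M \<and> (\<forall>i. AE x in M. g i x \<notin> S)"
    proof (cases "S \<in> sets M")
      case True
      have "S \<in> null_sets \<nu> \<longleftrightarrow> (AE x in \<nu>. x \<notin> S)"
        using True by (subst AE_iff_null_sets[symmetric]) (simp_all add: \<nu>_def)
      also have "\<dots> \<longleftrightarrow> (AE p in ?K \<Otimes>\<^sub>M M. g (fst p) (snd p) \<notin> S)"
        unfolding \<nu>_def using True m by (subst AE_distr_iff) auto
      also have "\<dots> \<longleftrightarrow> (AE i in ?K. AE x in M. g i x \<notin> S)"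
      proof (rule AE_pair_iff[symmetric])
        show "{p \<in> space (?K \<Otimes>\<^sub>M M). g (fst p) (snd p) \<notin> S} \<in> sets (?K \<Otimes>\<^sub>M M)"
        proof -
          have "{p \<in> space (?K \<Otimes>\<^sub>M M). g (fst p) (snd p) \<notin> S} =
              (\<lambda>p. g (fst p) (snd p)) -` (space M - S) \<inter> space (?K \<Otimes>\<^sub>M M)"
            using measurable_space[OF m] by auto
          then show ?thesis using measurable_sets[OF m sets.compl_sets[OF True]] by simp
        qed
      qed
      also have "\<dots> \<longleftrightarrow> (\<forall>i. AE x in M. g i x \<notin> S)"
        by (simp add: AE_measure_pmf_iff set_pmf_geometric)
      finally show ?thesis using True by simp
    qed (auto simp: \<nu>_def)
  qed
qed

locale hyperbolic_action =
  fixes M :: "'x measure" and R :: "('x \<times> 'x) set"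
    and B :: "'h measure" and \<pi> :: "'h \<Rightarrow> 'x" and H :: "'x \<Rightarrow> 'h metric"
    and \<alpha> :: "'x \<Rightarrow> 'x \<Rightarrow> 'h \<Rightarrow> 'h" and \<sigma> :: "'x \<Rightarrow> 'h"
  assumes main: "main_assumption M R B \<pi> H \<alpha> \<sigma>"
begin

lemma M_standard: "standard_borel M" and M_prob: "prob_space M" and
  R_equiv: "equiv (space M) R" and R_borel [measurable]: "R \<in> sets (M \<Otimes>\<^sub>M M)" and
  R_invariant: "invariant_measure M R" and R_ergodic: "ergodic_relation M R" and
  \<sigma>_section: "borel_section M B \<pi> \<sigma>" and
  proper_AE: "metrically_proper M R H \<alpha> \<sigma>" and action: "isometric_action R B \<pi> H \<alpha>"
  using main unfolding main_assumption_def borel_equivalence_relation_def by blast+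

lemma B_standard: "standard_borel B" and \<pi>_measurable [measurable]: "\<pi> \<in> B \<rightarrow>\<^sub>M M" and \<pi>_surj: "\<pi> ` space B = space M"
  and fibre: "\<And>x. x \<in> space M \<Longrightarrow> mspace (H x) = {p \<in> space B. \<pi> p = x}"
  and mdist_measurable: "(\<lambda>(p, q). mdist (H (\<pi> p)) p q) \<in>
       borel_measurable (restrict_space (B \<Otimes>\<^sub>M B) {(p, q). \<pi> p = \<pi> q})"
  and fibre_hyperbolic: "\<And>x. x \<in> space M \<Longrightarrow> gromov_hyperbolic (H x)"
  using main unfolding main_assumption_def hyperbolic_bundle_def metric_bundle_def borel_bundle_def by blast+

lemma \<sigma>_measurable [measurable]: "\<sigma> \<in> M \<rightarrow>\<^sub>M B" and \<pi>_\<sigma>: "x \<in> space M \<Longrightarrow> \<pi> (\<sigma> x) = x"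
  using \<sigma>_section unfolding borel_section_def by auto

lemma section_fibre: "borel_section M B \<pi> s \<Longrightarrow> x \<in> space M \<Longrightarrow> s x \<in> mspace (H x)"
  using fibre unfolding borel_section_def by (auto dest: measurable_space)

lemma R_in_space: "(x, y) \<in> R \<Longrightarrow> x \<in> space M \<and> y \<in> space M"
  using R_equiv unfolding equiv_def by auto

lemma R_reflexive: "x \<in> space M \<Longrightarrow> (x, x) \<in> R"
  using R_equiv unfolding equiv_def refl_on_def by auto

lemma R_symmetric: "(x, y) \<in> R \<Longrightarrow> (y, x) \<in> R"
  using R_equiv unfolding equiv_def by (meson symD)

lemma R_transitive: "(x, y) \<in> R \<Longrightarrow> (y, z) \<in> R \<Longrightarrow> (x, z) \<in> R"
  using R_equiv unfolding equiv_def by (meson transD)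

lemma \<alpha>_isometry: "(x, y) \<in> R \<Longrightarrow> isometry_between (H y) (H x) (\<alpha> x y)"
  and \<alpha>_comp: "(x, y) \<in> R \<Longrightarrow> (y, z) \<in> R \<Longrightarrow> p \<in> mspace (H z) \<Longrightarrow> \<alpha> x y (\<alpha> y z p) = \<alpha> x z p"
  and graph_sets: "{(p, q) \<in> space B \<times> space B. (\<pi> p, \<pi> q) \<in> R \<and> \<alpha> (\<pi> p) (\<pi> q) q = p} \<in> sets (B \<Otimes>\<^sub>M B)"
  using action unfolding isometric_action_def by blast+

lemma \<alpha>_fibre: "(x, y) \<in> R \<Longrightarrow> p \<in> mspace (H y) \<Longrightarrow> \<alpha> x y p \<in> mspace (H x)"
  and \<alpha>_dist: "(x, y) \<in> R \<Longrightarrow> p \<in> mspace (H y) \<Longrightarrow> q \<in> mspace (H y) \<Longrightarrow>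
    mdist (H x) (\<alpha> x y p) (\<alpha> x y q) = mdist (H y) p q"
  using \<alpha>_isometry[of x y] unfolding isometry_between_def by auto

lemma \<alpha>_id: assumes "x \<in> space M" "p \<in> mspace (H x)" shows "\<alpha> x x p = p"
proof -
  have xx: "(x, x) \<in> R" using R_reflexive assms(1) .
  have "mdist (H x) (\<alpha> x x p) p = mdist (H x) (\<alpha> x x (\<alpha> x x p)) (\<alpha> x x p)"
    using \<alpha>_dist[OF xx \<alpha>_fibre[OF xx assms(2)] assms(2)] by simp
  also have "\<dots> = 0" using \<alpha>_comp[OF xx xx assms(2)] \<alpha>_fibre[OF xx assms(2)] by simp
  finally show ?thesis using \<alpha>_fibre[OF xx assms(2)] assms(2) by simp
qed

text \<open>The point \<open>\<sigma>\<^sub>x(y)\<close> of the fibre over \<open>x\<close>.\<close>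
definition orbit_point :: "'x \<Rightarrow> 'x \<Rightarrow> 'h" where "orbit_point x y = \<alpha> x y (\<sigma> y)"

lemma \<sigma>_fibre: "x \<in> space M \<Longrightarrow> \<sigma> x \<in> mspace (H x)" by (rule section_fibre[OF \<sigma>_section])

lemma orbit_point_fibre: "(x, y) \<in> R \<Longrightarrow> orbit_point x y \<in> mspace (H x)"
  unfolding orbit_point_def using \<alpha>_fibre[of x y "\<sigma> y"] \<sigma>_fibre R_in_space by blast

lemma orbit_point_self: "x \<in> space M \<Longrightarrow> orbit_point x x = \<sigma> x"
  unfolding orbit_point_def using \<alpha>_id \<sigma>_fibre by blast

lemma orbit_point_move: "(x, y) \<in> R \<Longrightarrow> (y, z) \<in> R \<Longrightarrow> \<alpha> x y (orbit_point y z) = orbit_point x z"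
  unfolding orbit_point_def using \<alpha>_comp[of x y z "\<sigma> z"] \<sigma>_fibre R_in_space by blast

definition orbit_dist :: "'x \<Rightarrow> 'x \<Rightarrow> real" where "orbit_dist x y = mdist (H x) (\<sigma> x) (orbit_point x y)"

text \<open>Orbit points of \<open>y\<close> and \<open>z\<close> have the same distance in every fibre of the class, since the action is
isometric.\<close>
lemma mdist_orbit_point: 
  assumes "(x, y) \<in> R" "(x, z) \<in> R"
  shows "mdist (H x) (orbit_point x y) (orbit_point x z) = orbit_dist y z"
proof -
  have yz: "(y, z) \<in> R" using assms R_symmetric R_transitive by blast
  have ysp: "y \<in> space M" using R_in_space yz by blast
  have "mdist (H x) (orbit_point x y) (orbit_point x z) = mdist (H x) (\<alpha> x y (\<sigma> y)) (\<alpha> x y (orbit_point y z))"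
    using orbit_point_move[OF assms(1) yz] by (simp add: orbit_point_def)
  then show ?thesis using \<alpha>_dist[OF assms(1) \<sigma>_fibre[OF ysp] orbit_point_fibre[OF yz]] by (simp add: orbit_dist_def)
qed

definition proper_at :: "'x \<Rightarrow> bool" where
  "proper_at x \<longleftrightarrow> (\<forall>c. finite {y \<in> R `` {x}. orbit_dist x y \<le> c})"

lemma AE_proper_at: "AE x in M. proper_at x"
proof -
  have "AE x in M. x \<in> space M" by simp
  with proper_AE[unfolded metrically_proper_def] show ?thesis
  proof eventually_elim
    case (elim x)
    show ?case unfolding proper_at_def
    proof
      fix c
      interpret Metric_space "mspace (H x)" "mdist (H x)" by (rule Metric_space_mspace_mdist)
      have "{y \<in> R `` {x}. orbit_dist x y \<le> c} \<subseteq> {y \<in> R `` {x}. \<alpha> x y (\<sigma> y) \<in> mball_of (H x) (\<sigma> x) (c + 1)}"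
        using orbit_point_fibre[of x] \<sigma>_fibre[OF elim(2)] by (auto simp: mball_of_def orbit_dist_def orbit_point_def[symmetric])
      moreover have "finite {y \<in> R `` {x}. \<alpha> x y (\<sigma> y) \<in> mball_of (H x) (\<sigma> x) (c + 1)}"
        using elim(1) \<sigma>_fibre[OF elim(2)] by blast
      ultimately show "finite {y \<in> R `` {x}. orbit_dist x y \<le> c}" by (rule finite_subset)
    qed
  qed
qed

lemma orbit_dist_triangle: "(x, y) \<in> R \<Longrightarrow> (x, z) \<in> R \<Longrightarrow> orbit_dist x z \<le> orbit_dist x y + orbit_dist y z"
  using mdist_triangle[of "\<sigma> x" "H x" "orbit_point x y" "orbit_point x z"] mdist_orbit_point[of x y z] \<sigma>_fibre[of x] orbit_point_fibre R_in_space
  by (simp add: orbit_dist_def)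

lemma orbit_dist_sym: "(x, y) \<in> R \<Longrightarrow> orbit_dist x y = orbit_dist y x"
  using mdist_orbit_point[of x x y] mdist_orbit_point[of x y x] mdist_commute[of "H x"] R_in_space[of x y] R_reflexive by metis

lemma proper_at_invariant: assumes "proper_at x" "(x, y) \<in> R" shows "proper_at y"
  unfolding proper_at_def
proof
  fix c
  have "{z \<in> R `` {y}. orbit_dist y z \<le> c} \<subseteq> {z \<in> R `` {x}. orbit_dist x z \<le> c + orbit_dist x y}"
    using assms(2) orbit_dist_triangle[of x y] R_transitive[of x y] by force
  then show "finite {z \<in> R `` {y}. orbit_dist y z \<le> c}"
    using assms(1) unfolding proper_at_def by (meson finite_subset)
qed

text \<open>The fibrewise distance is measurable on the fibre product only; that fibre product is itself a
measurable set.\<close>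
lemma mdist_sets:
  assumes [measurable]: "a \<in> N \<rightarrow>\<^sub>M B" "b \<in> N \<rightarrow>\<^sub>M B" and V: "V \<in> sets borel"
  shows "{q \<in> space N. \<pi> (a q) = \<pi> (b q) \<and> mdist (H (\<pi> (a q))) (a q) (b q) \<in> V} \<in> sets N"
proof -
  let ?D = "{(p, q). \<pi> p = \<pi> q}"
  let ?f = "\<lambda>(p, q). mdist (H (\<pi> p)) p q"
  have "Measurable.pred (B \<Otimes>\<^sub>M B) (\<lambda>w. \<pi> (fst w) = \<pi> (snd w))"
    by (rule standard_borel_eq_measurable[OF M_standard]) measurable
  then have "{w \<in> space (B \<Otimes>\<^sub>M B). \<pi> (fst w) = \<pi> (snd w)} \<in> sets (B \<Otimes>\<^sub>M B)" by measurable
  moreover have "?D \<inter> space (B \<Otimes>\<^sub>M B) = {w \<in> space (B \<Otimes>\<^sub>M B). \<pi> (fst w) = \<pi> (snd w)}" by auto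
  ultimately have D: "?D \<inter> space (B \<Otimes>\<^sub>M B) \<in> sets (B \<Otimes>\<^sub>M B)" by simp
  have "?f -` V \<inter> space (restrict_space (B \<Otimes>\<^sub>M B) ?D) \<in> sets (restrict_space (B \<Otimes>\<^sub>M B) ?D)"
    by (rule measurable_sets[OF mdist_measurable V])
  then have S: "?f -` V \<inter> space (restrict_space (B \<Otimes>\<^sub>M B) ?D) \<in> sets (B \<Otimes>\<^sub>M B)"
    using sets_restrict_space_iff[of ?D "B \<Otimes>\<^sub>M B"] D by (simp add: Int_commute)
  have "(\<lambda>q. (a q, b q)) \<in> N \<rightarrow>\<^sub>M B \<Otimes>\<^sub>M B" by measurable
  from measurable_sets[OF this S] show ?thesis
    by (rule back_subst[of "\<lambda>S. S \<in> sets N"])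
      (auto simp: space_restrict_space space_pair_measure dest: measurable_space[OF assms(1)] measurable_space[OF assms(2)])
qed

lemma M_souslin: "souslin_space M" and B_souslin: "souslin_space B"
proof -
  have "space M \<noteq> {}" using prob_space.not_empty[OF M_prob] .
  moreover from this have "space B \<noteq> {}" using \<pi>_surj by auto
  ultimately show "souslin_space M" "souslin_space B"
    using standard_borel_souslin M_standard B_standard by auto
qed

text \<open>Properness makes the relation a countable union of relations with finite sections, so it is enumerated
almost everywhere. The null set of exceptions must be avoided by whole classes, although it is not
yet known that classes meeting a null set form a null set. Therefore a first enumeration \<open>g0\<close> is used to
spread \<open>M\<close> over the classes by \<open>mixture_measure\<close>, and a second enumeration \<open>h\<close> is made with respect to
the measure \<open>\<nu>\<close> so obtained: a \<open>\<nu>\<close>-null set is avoided by almost every class.\<close>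
lemma enumeration:
  obtains X h U where "enumerated_relation M R X h U"
    "\<And>x. x \<in> X \<Longrightarrow> proper_at x"
proof -
  interpret prob_space M by (rule M_prob)
  define Gr where "Gr = {(p, q) \<in> space B \<times> space B. (\<pi> p, \<pi> q) \<in> R \<and> \<alpha> (\<pi> p) (\<pi> q) q = p}"
  have Gr [measurable]: "Gr \<in> sets (B \<Otimes>\<^sub>M B)" unfolding Gr_def by (rule graph_sets)
  define F where "F n = {w \<in> space (M \<Otimes>\<^sub>M (M \<Otimes>\<^sub>M B)). (snd (snd w), \<sigma> (fst (snd w))) \<in> Gr \<and>
    \<pi> (\<sigma> (fst w)) = \<pi> (snd (snd w)) \<and> mdist (H (\<pi> (\<sigma> (fst w)))) (\<sigma> (fst w)) (snd (snd w)) \<in> {..real n}}" for n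
  have F_sets: "F n \<in> sets (M \<Otimes>\<^sub>M (M \<Otimes>\<^sub>M B))" for n
  proof -
    have "F n = {w \<in> space (M \<Otimes>\<^sub>M (M \<Otimes>\<^sub>M B)). (snd (snd w), \<sigma> (fst (snd w))) \<in> Gr} \<inter>
      {w \<in> space (M \<Otimes>\<^sub>M (M \<Otimes>\<^sub>M B)). \<pi> (\<sigma> (fst w)) = \<pi> (snd (snd w)) \<and>
        mdist (H (\<pi> (\<sigma> (fst w)))) (\<sigma> (fst w)) (snd (snd w)) \<in> {..real n}}"
      by (auto simp: F_def)
    also have "\<dots> \<in> sets (M \<Otimes>\<^sub>M (M \<Otimes>\<^sub>M B))"
      by (intro sets.Int mdist_sets) measurable
    finally show ?thesis .
  qed
  have F_iff: "(\<exists>p. (x, (y, p)) \<in> F n) \<longleftrightarrow> (x, y) \<in> R \<and> orbit_dist x y \<le> real n" for x y n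
  proof
    assume "\<exists>p. (x, (y, p)) \<in> F n"
    then obtain p where p: "x \<in> space M" "y \<in> space M" "p \<in> space B" "(p, \<sigma> y) \<in> Gr" "\<pi> p = x"
      "mdist (H x) (\<sigma> x) p \<le> real n"
      by (auto simp: F_def space_pair_measure \<pi>_\<sigma>)
    then have "(x, y) \<in> R" "p = orbit_point x y" by (auto simp: Gr_def \<pi>_\<sigma> orbit_point_def)
    then show "(x, y) \<in> R \<and> orbit_dist x y \<le> real n" using p by (simp add: orbit_dist_def)
  next
    assume xy: "(x, y) \<in> R \<and> orbit_dist x y \<le> real n"
    then have sp: "x \<in> space M" "y \<in> space M" using R_in_space by auto
    have o: "orbit_point x y \<in> space B" "\<pi> (orbit_point x y) = x" using orbit_point_fibre[of x y] xy fibre[OF sp(1)] by auto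
    have "(x, (y, orbit_point x y)) \<in> F n"
      using xy sp o measurable_space[OF \<sigma>_measurable sp(2)]
      by (auto simp: F_def space_pair_measure \<pi>_\<sigma> Gr_def orbit_dist_def) (simp add: orbit_point_def)
    then show "\<exists>p. (x, (y, p)) \<in> F n" ..
  qed
  have FR: "(x, (y, p)) \<in> F n \<Longrightarrow> (x, y) \<in> R" for n x y p using F_iff by blast
  have proper_fin: "finite {y. \<exists>p. (x, (y, p)) \<in> F n}" if "proper_at x" for x n
  proof -
    have "{y. (x, y) \<in> R \<and> orbit_dist x y \<le> real n} = {y \<in> R `` {x}. orbit_dist x y \<le> real n}" by blast
    then show ?thesis using that unfolding F_iff proper_at_def by simp
  qed
  have enum: "\<exists>g N. (\<forall>i. g i \<in> M \<rightarrow>\<^sub>M M) \<and> (\<forall>i. \<forall>x\<in>space M. (x, g i x) \<in> R) \<and> N \<in> null_sets \<nu> \<and>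
      (\<forall>x\<in>space M - N. proper_at x \<longrightarrow> (\<forall>y. (x, y) \<in> R \<longrightarrow> (\<exists>i::nat. y = g i x)))"
    if \<nu>: "finite_measure \<nu>" "sets \<nu> = sets M" for \<nu>
  proof -
    obtain g :: "nat \<Rightarrow> 'x \<Rightarrow> 'x" and N where gN: "\<And>i. g i \<in> M \<rightarrow>\<^sub>M M" "\<And>i x. x \<in> space M \<Longrightarrow> (x, g i x) \<in> R"
      "N \<in> null_sets \<nu>"
      "\<And>n x y. x \<in> space M \<Longrightarrow> x \<notin> N \<Longrightarrow> finite {y. \<exists>p. (x, (y, p)) \<in> F n} \<Longrightarrow> \<exists>p. (x, (y, p)) \<in> F n \<Longrightarrow> \<exists>i. y = g i x"
      by (rule enumerate_finite_sections[where F = F and R = R and M = M and \<nu> = \<nu> and B = B,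
          OF M_standard \<nu> B_souslin M_souslin F_sets FR R_reflexive]) (assumption, assumption, rule that)
    have "\<exists>i. y = g i x" if x: "x \<in> space M - N" "proper_at x" "(x, y) \<in> R" for x y
    proof -
      obtain n :: nat where "orbit_dist x y \<le> real n" using real_arch_simple by blast
      then have "\<exists>p. (x, (y, p)) \<in> F n" using F_iff x(3) by blast
      then show ?thesis using gN(4)[of x n y] x(1) proper_fin[OF x(2)] by blast
    qed
    then show ?thesis using gN(1-3) by blast
  qed
  obtain g0 N1 where g0: "\<And>i. g0 i \<in> M \<rightarrow>\<^sub>M M" "\<And>i x. x \<in> space M \<Longrightarrow> (x, g0 i x) \<in> R" "N1 \<in> null_sets M"
    "\<And>x y. x \<in> space M - N1 \<Longrightarrow> proper_at x \<Longrightarrow> (x, y) \<in> R \<Longrightarrow> \<exists>i::nat. y = g0 i x"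
    using enum[of M] finite_measure_axioms by blast
  obtain \<nu> where \<nu>: "finite_measure \<nu>" "sets \<nu> = sets M"
    "\<And>S. S \<in> null_sets \<nu> \<longleftrightarrow> S \<in> sets M \<and> (\<forall>i. AE x in M. g0 i x \<notin> S)"
    by (rule mixture_measure[OF M_prob g0(1)]) (rule that)
  obtain h N2 where h: "\<And>i. h i \<in> M \<rightarrow>\<^sub>M M" "\<And>i x. x \<in> space M \<Longrightarrow> (x, h i x) \<in> R" "N2 \<in> null_sets \<nu>"
    "\<And>x y. x \<in> space M - N2 \<Longrightarrow> proper_at x \<Longrightarrow> (x, y) \<in> R \<Longrightarrow> \<exists>i::nat. y = h i x"
    using enum[OF \<nu>(1,2)] by blast
  note [measurable] = h(1)
  have AE_class: "AE x in M. \<forall>y\<in>R `` {x}. \<exists>i. y = g0 i x"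
    using AE_proper_at AE_not_in[OF g0(3)] AE_space
    by eventually_elim (use g0(4) in blast)
  \<comment> \<open>The points whose class is not exhausted by \<open>h\<close>. The set is a projection, and almost every class
    avoids its measurable kernel \<open>S\<close>, because properness passes from \<open>x\<close> to \<open>g0 i x\<close>.\<close>
  define Uncov where "Uncov = {x. \<exists>y. (x, y) \<in> {w \<in> space (M \<Otimes>\<^sub>M M). w \<in> R \<and> (\<forall>i. h i (fst w) \<noteq> snd w)}}"
  have eqm [measurable]: "Measurable.pred (M \<Otimes>\<^sub>M M) (\<lambda>w. h i (fst w) = snd w)" for i
    by (rule standard_borel_eq_measurable[OF M_standard]) measurable
  have "{w \<in> space (M \<Otimes>\<^sub>M M). w \<in> R \<and> (\<forall>i. h i (fst w) \<noteq> snd w)} \<in> sets (M \<Otimes>\<^sub>M M)" by measurable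
  then have "{w \<in> space (M \<Otimes>\<^sub>M M). w \<in> R \<and> (\<forall>i. h i (fst w) \<noteq> snd w)} \<in> sets (\<nu> \<Otimes>\<^sub>M M)"
    using sets_pair_measure_cong[OF \<nu>(2) refl, of M] by simp
  from measurable_projection[OF \<nu>(1) M_souslin this] have "Uncov \<in> sets (completion \<nu>)" unfolding Uncov_def .
  then obtain S Z Z' where SZ: "Uncov = S \<union> Z'" "Z' \<subseteq> Z" "S \<in> sets \<nu>" "Z \<in> null_sets \<nu>"
    by (elim sets_completionE) blast
  have Uncov_iff: "x \<in> Uncov \<longleftrightarrow> (\<exists>y. (x, y) \<in> R \<and> (\<forall>i. h i x \<noteq> y))" for x
    using R_in_space by (auto simp: Uncov_def space_pair_measure)
  have "S \<in> null_sets \<nu>"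
    unfolding \<nu>(3)
  proof (intro conjI allI)
    show "S \<in> sets M" using SZ(3) \<nu>(2) by simp
    fix i
    have "AE x in M. g0 i x \<notin> N2" using h(3) unfolding \<nu>(3) by blast
    with AE_proper_at AE_space show "AE x in M. g0 i x \<notin> S"
    proof eventually_elim
      case (elim x)
      have "proper_at (g0 i x)" using proper_at_invariant[OF elim(1)] g0(2)[OF elim(2)] by blast
      moreover have "g0 i x \<in> space M - N2" using g0(2)[OF elim(2)] R_in_space elim(3) by blast
      ultimately have "g0 i x \<notin> Uncov" using h(4) unfolding Uncov_iff by metis
      then show ?case using SZ(1) by blast
    qed
  qed
  then have N3: "S \<union> Z \<in> null_sets \<nu>" using SZ(4) by (rule null_sets.Un)
  define N3 where "N3 = S \<union> Z"
  have N3_sets [measurable]: "N3 \<in> sets M" using N3 \<nu>(2) unfolding N3_def by (metis null_setsD2)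
  have cover: "\<exists>i. y = h i x" if "x \<notin> N3" "(x, y) \<in> R" for x y
    using that SZ(1,2) Uncov_iff[of x] unfolding N3_def by blast
  have AE_N3: "AE x in M. \<forall>y\<in>R `` {x}. y \<notin> N3"
  proof -
    have "AE x in M. \<forall>i. g0 i x \<notin> N3" using N3 unfolding \<nu>(3) AE_all_countable N3_def by blast
    with AE_class show ?thesis by eventually_elim force
  qed
  define X0 where "X0 = {x \<in> space M. x \<notin> N3 \<and> (\<forall>i. h i x \<notin> N3)}"
  have X0_iff: "x \<in> X0 \<longleftrightarrow> x \<in> space M \<and> (\<forall>y\<in>R `` {x}. y \<notin> N3)" for x
  proof
    assume "x \<in> X0"
    then show "x \<in> space M \<and> (\<forall>y\<in>R `` {x}. y \<notin> N3)" using cover[of x] by (auto simp: X0_def)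
  next
    assume "x \<in> space M \<and> (\<forall>y\<in>R `` {x}. y \<notin> N3)"
    then show "x \<in> X0" using R_reflexive[of x] h(2)[of x] by (auto simp: X0_def)
  qed
  obtain U :: "nat \<Rightarrow> 'x set" where U: "\<And>n. U n \<in> sets M"
    "\<And>F x. finite F \<Longrightarrow> F \<subseteq> space M \<Longrightarrow> x \<in> space M \<Longrightarrow> x \<notin> F \<Longrightarrow> \<exists>n. x \<in> U n \<and> U n \<inter> F = {}"
    by (rule standard_borel_base[OF M_standard]) (rule that)
  have E: "enumerated_relation M R X0 h U"
  proof
    show "X0 \<in> sets M" unfolding X0_def by measurable
    show "AE x in M. x \<in> X0" using AE_N3 AE_space by eventually_elim (simp add: X0_iff)
    show "y \<in> X0" if "x \<in> X0" "(x, y) \<in> R" for x y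
      using that R_transitive[OF that(2)] R_in_space[OF that(2)] unfolding X0_iff by blast
    show "R `` {x} = range (\<lambda>j. h j x)" if "x \<in> X0" for x
    proof -
      have "x \<notin> N3" using that by (simp add: X0_def)
      then show ?thesis using cover[of x] h(2)[of x] that by (auto simp: X0_def)
    qed
  qed (use R_equiv R_invariant U h(1,2) in auto)
  interpret E: enumerated_relation M R X0 h U by (rule E)
  obtain Y where Y: "Y \<in> sets M" "Y \<subseteq> X0" "AE x in M. x \<in> Y"
    "\<And>x y. x \<in> Y \<Longrightarrow> (x, y) \<in> R \<Longrightarrow> y \<in> Y" "\<And>x. x \<in> Y \<Longrightarrow> proper_at x"
    by (rule E.conull_saturated_subset[OF AE_proper_at]) (rule that)
  have "enumerated_relation M R Y h U" by (rule E.restrict_enumeration[OF Y(1-4)])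
  then show thesis using Y(5) by (rule that)
qed

end

section \<open>Measurability on the bundle\<close>

context enumerated_relation
begin

text \<open>Functions of two equivalent points become measurable on the square of the space once their values
along the enumeration are measurable.\<close>
lemma class_function_measurable:
  fixes K :: "'x \<Rightarrow> 'x \<Rightarrow> real"
  assumes e [measurable]: "\<And>j. e j \<in> borel_measurable M" and K: "\<And>j x. x \<in> X \<Longrightarrow> K x (h j x) = e j x"
  shows "(\<lambda>(x, y). if x \<in> X \<and> (x, y) \<in> R then K x y else 0) \<in> borel_measurable (M \<Otimes>\<^sub>M M)"
proof (rule measurableI)
  fix V :: "real set" assume V [measurable]: "V \<in> sets borel"
  let ?f = "\<lambda>(x, y). if x \<in> X \<and> (x, y) \<in> R then K x y else 0"
  have "?f -` V \<inter> space (M \<Otimes>\<^sub>M M) =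
    (\<Union>j. {q \<in> space (M \<Otimes>\<^sub>M M). fst q \<in> X \<and> h j (fst q) = snd q \<and> e j (fst q) \<in> V}) \<union>
    {q \<in> space (M \<Otimes>\<^sub>M M). \<not> (fst q \<in> X \<and> q \<in> R) \<and> 0 \<in> V}" (is "?L = ?A \<union> ?B")
  proof (intro equalityI subsetI)
    fix q assume q: "q \<in> ?L"
    obtain x y where xy: "q = (x, y)" by (cases q)
    show "q \<in> ?A \<union> ?B"
    proof (cases "x \<in> X \<and> (x, y) \<in> R")
      case True
      then obtain j where j: "y = h j x" using R_enum by blast
      have "q \<in> {q \<in> space (M \<Otimes>\<^sub>M M). fst q \<in> X \<and> h j (fst q) = snd q \<and> e j (fst q) \<in> V}"
        using q True K[of x j] by (simp add: xy j)
      then show ?thesis by blast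
    next
      case False
      then have "0 \<in> V" using q by (auto simp: xy)
      then show ?thesis using q False by (simp add: xy)
    qed
  next
    fix q assume "q \<in> ?A \<union> ?B"
    then show "q \<in> ?L"
    proof
      assume "q \<in> ?A"
      then obtain j where j: "q \<in> space (M \<Otimes>\<^sub>M M)" "fst q \<in> X" "h j (fst q) = snd q" "e j (fst q) \<in> V" by blast
      have "(fst q, snd q) \<in> R" using h_R[OF X_space[OF j(2)], of j] j(3) by simp
      then show ?thesis using j K[OF j(2), of j] by (auto simp: split_beta)
    qed (auto simp: split_beta)
  qed
  also have "?A \<union> ?B \<in> sets (M \<Otimes>\<^sub>M M)" by measurable
  finally show "?f -` V \<inter> space (M \<Otimes>\<^sub>M M) \<in> sets (M \<Otimes>\<^sub>M M)" .
qed simp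

text \<open>The number of elements of the section \<open>F `` {x}\<close>, counted along the enumeration without repetitions.\<close>
definition section_count :: "('x \<times> 'x) set \<Rightarrow> 'x \<Rightarrow> ennreal" where
  "section_count F x = (\<Sum>j. indicator {x \<in> X. (\<forall>i<j. h i x \<noteq> h j x) \<and> (x, h j x) \<in> F} x)"

lemma section_count_measurable [measurable]:
  assumes [measurable]: "F \<in> sets (M \<Otimes>\<^sub>M M)"
  shows "section_count F \<in> borel_measurable M"
  unfolding section_count_def by measurable

lemma section_count_eq:
  assumes "F \<subseteq> R" "x \<in> X"
  shows "emeasure (count_space UNIV) (F `` {x}) = section_count F x"
proof -
  define A where "A j = (if (\<forall>i<j. h i x \<noteq> h j x) \<and> (x, h j x) \<in> F then {h j x} else {})" for j
  have "F `` {x} = (\<Union>j. A j)"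
  proof (intro equalityI subsetI)
    fix y assume y: "y \<in> F `` {x}"
    then have "\<exists>j. y = h j x" using assms R_enum by blast
    then obtain j where j: "y = h j x" "\<And>i. i < j \<Longrightarrow> y \<noteq> h i x"
      using exists_least_iff[of "\<lambda>j. y = h j x"] by blast
    then have "\<forall>i<j. h i x \<noteq> h j x" by metis
    then have "y \<in> A j" using y j(1) by (simp add: A_def)
    then show "y \<in> (\<Union>j. A j)" by blast
  qed (auto simp: A_def split: if_splits)
  moreover have "disjoint_family A"
    unfolding disjoint_family_on_def
  proof (intro ballI impI)
    fix a b :: nat assume "a \<noteq> b"
    then consider "a < b" | "b < a" by linarith
    then show "A a \<inter> A b = {}" by cases (auto simp: A_def)
  qed
  ultimately have "emeasure (count_space UNIV) (F `` {x}) = (\<Sum>j. emeasure (count_space UNIV) (A j))"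
    using suminf_emeasure[of A "count_space UNIV"] by simp
  also have "\<dots> = section_count F x"
    unfolding section_count_def by (intro arg_cong[where f = suminf] ext) (auto simp: A_def assms(2) one_ennreal_def)
  finally show ?thesis .
qed

text \<open>The function defining \<open>relation_measure\<close> is a measure because the sections are counted by measurable
functions; otherwise \<open>measure_of\<close> would be the zero measure and the hypothesis would be void.\<close>
lemma AE_relation_measure:
  assumes "AE (x, y) in relation_measure M R. P x y"
  shows "AE x in M. \<forall>y\<in>R `` {x}. P x y"
proof -
  let ?A = "{F \<in> sets (M \<Otimes>\<^sub>M M). F \<subseteq> R}"
  let ?\<mu> = "\<lambda>F. \<integral>\<^sup>+ x. emeasure (count_space UNIV) (F `` {x}) \<partial>M"
  have "sigma_algebra R ?A"
    unfolding sigma_algebra_iff2 by auto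
  then interpret A: sigma_algebra R ?A .
  have mu_eq: "?\<mu> F = (\<integral>\<^sup>+ x. section_count F x \<partial>M)" if "F \<in> ?A" for F
    using that X_conull by (intro nn_integral_cong_AE) (auto elim!: eventually_mono simp: section_count_eq)
  have "positive ?A ?\<mu>" by (simp add: positive_def)
  moreover have "countably_additive ?A ?\<mu>"
    unfolding countably_additive_def
  proof (intro allI impI)
    fix F :: "nat \<Rightarrow> _" assume F: "range F \<subseteq> ?A" "disjoint_family F" "(\<Union>i. F i) \<in> ?A"
    have Fi: "F i \<in> ?A" for i using F(1) by auto
    then have [measurable]: "F i \<in> sets (M \<Otimes>\<^sub>M M)" for i by auto
    have "?\<mu> (\<Union>i. F i) = (\<integral>\<^sup>+ x. (\<Sum>i. section_count (F i) x) \<partial>M)"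
    proof (rule nn_integral_cong_AE, use X_conull in eventually_elim)
      fix x assume x: "x \<in> X"
      have "disjoint_family (\<lambda>i. F i `` {x})" using F(2) unfolding disjoint_family_on_def by blast
      then have "emeasure (count_space UNIV) ((\<Union>i. F i) `` {x}) = (\<Sum>i. emeasure (count_space UNIV) (F i `` {x}))"
        using suminf_emeasure[of "\<lambda>i. F i `` {x}" "count_space UNIV"] by (simp add: UN_Image)
      also have "\<dots> = (\<Sum>i. section_count (F i) x)"
        using Fi x by (intro arg_cong[where f = suminf] ext section_count_eq) auto
      finally show "emeasure (count_space UNIV) ((\<Union>i. F i) `` {x}) = (\<Sum>i. section_count (F i) x)" .
    qed
    also have "\<dots> = (\<Sum>i. \<integral>\<^sup>+ x. section_count (F i) x \<partial>M)" by (rule nn_integral_suminf) measurable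
    finally show "(\<Sum>i. ?\<mu> (F i)) = ?\<mu> (\<Union>i. F i)" using mu_eq[OF Fi] by simp
  qed
  ultimately have em: "emeasure (relation_measure M R) F = ?\<mu> F" if "F \<in> ?A" for F
    unfolding relation_measure_def using that A.sigma_algebra_axioms by (intro emeasure_measure_of_sigma)
  have sets_eq: "sets (relation_measure M R) = ?A" and space_eq: "space (relation_measure M R) = R"
    unfolding relation_measure_def using A.sigma_sets_eq A.space_closed by (auto simp: sets_measure_of space_measure_of)
  obtain N where N: "{q \<in> R. \<not> (case q of (x, y) \<Rightarrow> P x y)} \<subseteq> N" "emeasure (relation_measure M R) N = 0" "N \<in> ?A"
    using AE_E[OF assms] unfolding sets_eq space_eq by blast
  from N(3) have [measurable]: "N \<in> sets (M \<Otimes>\<^sub>M M)" by auto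
  have "(\<integral>\<^sup>+ x. section_count N x \<partial>M) = 0" using em[OF N(3)] mu_eq[OF N(3)] N(2) by simp
  then have "AE x in M. section_count N x = 0" by (subst (asm) nn_integral_0_iff_AE) auto
  with X_conull show ?thesis
  proof eventually_elim
    case (elim x)
    have "N `` {x} = {}"
      using section_count_eq[of N x] N(3) elim by (simp add: emeasure_count_space_eq_0)
    then show ?case using N(1) by auto
  qed
qed

end

context hyperbolic_action
begin

lemma mdist_section_measurable [measurable (raw)]:
  assumes "borel_section M B \<pi> a" "borel_section M B \<pi> b"
  shows "(\<lambda>x. mdist (H x) (a x) (b x)) \<in> borel_measurable M"
proof (rule measurableI)
  fix V :: "real set" assume V: "V \<in> sets borel"
  have ab: "a \<in> M \<rightarrow>\<^sub>M B" "b \<in> M \<rightarrow>\<^sub>M B" "\<And>x. x \<in> space M \<Longrightarrow> \<pi> (a x) = x \<and> \<pi> (b x) = x"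
    using assms by (auto simp: borel_section_def)
  have "(\<lambda>x. mdist (H x) (a x) (b x)) -` V \<inter> space M =
      {q \<in> space M. \<pi> (a q) = \<pi> (b q) \<and> mdist (H (\<pi> (a q))) (a q) (b q) \<in> V}"
    using ab(3) by auto
  then show "(\<lambda>x. mdist (H x) (a x) (b x)) -` V \<inter> space M \<in> sets M"
    using mdist_sets[OF ab(1,2) V] by simp
qed simp

lemma gromov_product_section_measurable [measurable (raw)]:
  assumes "borel_section M B \<pi> a" "borel_section M B \<pi> b" "borel_section M B \<pi> c"
  shows "(\<lambda>x. gromov_product (H x) (c x) (a x) (b x)) \<in> borel_measurable M"
  unfolding gromov_product_def
  using mdist_section_measurable[OF assms(1,3)] mdist_section_measurable[OF assms(2,3)] mdist_section_measurable[OF assms(1,2)]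
  by measurable

text \<open>The preimage of a Borel set of the total space is the projection of a Borel set cut out by the graph
of the action.\<close>
lemma orbit_section:
  assumes g [measurable]: "g \<in> M \<rightarrow>\<^sub>M M" and gR: "\<And>x. x \<in> space M \<Longrightarrow> (x, g x) \<in> R"
  obtains s where "borel_section M B \<pi> s" "AE x in M. s x = orbit_point x (g x)"
proof -
  interpret prob_space M by (rule M_prob)
  define Gr where "Gr = {(p, q) \<in> space B \<times> space B. (\<pi> p, \<pi> q) \<in> R \<and> \<alpha> (\<pi> p) (\<pi> q) q = p}"
  have Gr [measurable]: "Gr \<in> sets (B \<Otimes>\<^sub>M B)" unfolding Gr_def by (rule graph_sets)
  have [measurable]: "Measurable.pred (M \<Otimes>\<^sub>M B) (\<lambda>w. \<pi> (snd w) = fst w)"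
    by (rule standard_borel_eq_measurable[OF M_standard]) measurable
  have in_B: "orbit_point x (g x) \<in> space B \<and> \<pi> (orbit_point x (g x)) = x" if "x \<in> space M" for x
    using orbit_point_fibre[OF gR[OF that]] fibre[OF that] by auto
  have "(\<lambda>x. orbit_point x (g x)) \<in> completion M \<rightarrow>\<^sub>M B"
  proof (rule measurableI)
    show "orbit_point x (g x) \<in> space B" if "x \<in> space (completion M)" for x using in_B that by simp
    fix V assume V [measurable]: "V \<in> sets B"
    let ?E = "{w \<in> space (M \<Otimes>\<^sub>M B). snd w \<in> V \<and> \<pi> (snd w) = fst w \<and> (snd w, \<sigma> (g (fst w))) \<in> Gr}"
    have "?E \<in> sets (M \<Otimes>\<^sub>M B)" by measurable
    from measurable_projection[OF finite_measure_axioms B_souslin this]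
    have "{x. \<exists>p. (x, p) \<in> ?E} \<in> sets (completion M)" .
    moreover have "(\<lambda>x. orbit_point x (g x)) -` V \<inter> space (completion M) = {x. \<exists>p. (x, p) \<in> ?E}"
    proof (intro equalityI subsetI)
      fix x assume "x \<in> (\<lambda>x. orbit_point x (g x)) -` V \<inter> space (completion M)"
      then have x: "x \<in> space M" "orbit_point x (g x) \<in> V" by auto
      have gx: "g x \<in> space M" using measurable_space[OF g x(1)] .
      have "(orbit_point x (g x), \<sigma> (g x)) \<in> Gr"
        using in_B[OF x(1)] gR[OF x(1)] \<pi>_\<sigma>[OF gx] measurable_space[OF \<sigma>_measurable gx]
        by (simp add: Gr_def) (simp add: orbit_point_def)
      then have "(x, orbit_point x (g x)) \<in> ?E" using x in_B[OF x(1)] by (simp add: space_pair_measure)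
      then show "x \<in> {x. \<exists>p. (x, p) \<in> ?E}" by blast
    next
      fix x assume "x \<in> {x. \<exists>p. (x, p) \<in> ?E}"
      then obtain p where p: "x \<in> space M" "p \<in> V" "\<pi> p = x" "(p, \<sigma> (g x)) \<in> Gr"
        by (auto simp: space_pair_measure)
      have "p = orbit_point x (g x)"
        using p \<pi>_\<sigma>[OF measurable_space[OF g p(1)]] by (simp add: Gr_def orbit_point_def)
      then show "x \<in> (\<lambda>x. orbit_point x (g x)) -` V \<inter> space (completion M)" using p by simp
    qed
    ultimately show "(\<lambda>x. orbit_point x (g x)) -` V \<inter> space (completion M) \<in> sets (completion M)" by simp
  qed
  then obtain N where N: "N \<in> null_sets M" "(\<lambda>x. if x \<in> N then \<sigma> x else orbit_point x (g x)) \<in> M \<rightarrow>\<^sub>M B"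
    by (rule completion_measurable_modification[OF _ \<sigma>_measurable B_standard])
  show thesis
  proof (rule that[of "\<lambda>x. if x \<in> N then \<sigma> x else orbit_point x (g x)"])
    show "borel_section M B \<pi> (\<lambda>x. if x \<in> N then \<sigma> x else orbit_point x (g x))"
      unfolding borel_section_def using N(2) \<pi>_\<sigma> in_B by auto
    show "AE x in M. (if x \<in> N then \<sigma> x else orbit_point x (g x)) = orbit_point x (g x)"
      using AE_not_in[OF N(1)] by eventually_elim simp
  qed
qed

lemma hyperbolic_transport:
  assumes "(x, y) \<in> R" "hyperbolic_metric (H y) \<delta>"
  shows "hyperbolic_metric (H x) \<delta>"
proof
  interpret hyperbolic_metric "H y" \<delta> by fact
  show "0 \<le> \<delta>" by (rule \<delta>_nonneg)
  have onto: "\<alpha> x y ` mspace (H y) = mspace (H x)" using \<alpha>_isometry[OF assms(1)] by (simp add: isometry_between_def)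
  fix a b c w assume "a \<in> mspace (H x)" "b \<in> mspace (H x)" "c \<in> mspace (H x)" "w \<in> mspace (H x)"
  then obtain a' b' c' w' where *: "a' \<in> mspace (H y)" "b' \<in> mspace (H y)" "c' \<in> mspace (H y)" "w' \<in> mspace (H y)"
    "a = \<alpha> x y a'" "b = \<alpha> x y b'" "c = \<alpha> x y c'" "w = \<alpha> x y w'"
    unfolding onto[symmetric] by blast
  show "gromov_product (H x) c a w \<le> gromov_product (H x) c a b + \<delta> \<or> gromov_product (H x) c w b \<le> gromov_product (H x) c a b + \<delta>"
    using hyperbolic[OF *(1-4)] *(1-4) unfolding *(5-8) gromov_product_def by (simp add: \<alpha>_dist[OF assms(1)])
qed

lemma dense_sections:
  obtains \<tau> :: "nat \<Rightarrow> 'x \<Rightarrow> 'h" where "\<And>i. borel_section M B \<pi> (\<tau> i)"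
    "\<And>x p e. x \<in> space M \<Longrightarrow> p \<in> mspace (H x) \<Longrightarrow> e > 0 \<Longrightarrow> \<exists>k. mdist (H x) p (\<tau> k x) < e"
proof -
  obtain \<tau> :: "nat \<Rightarrow> 'x \<Rightarrow> 'h" where \<tau>: "\<And>i. borel_section M B \<pi> (\<tau> i)"
    "\<And>x. x \<in> space M \<Longrightarrow> mtopology_of (H x) closure_of (range (\<lambda>i. \<tau> i x)) = mspace (H x)"
    using main unfolding main_assumption_def separable_bundle_def by blast
  have "\<exists>k. mdist (H x) p (\<tau> k x) < e" if *: "x \<in> space M" "p \<in> mspace (H x)" "e > 0" for x p e
  proof -
    interpret Metric_space "mspace (H x)" "mdist (H x)" by (rule Metric_space_mspace_mdist)
    have "p \<in> mtopology closure_of (range (\<lambda>i. \<tau> i x))" using \<tau>(2)[OF *(1)] *(2) by (simp add: mtopology_of_def)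
    then show ?thesis using *(3) unfolding metric_closure_of by auto
  qed
  then show thesis using \<tau>(1) that by blast
qed

lemma fibre_hyperbolic_metric:
  assumes "x \<in> space M" shows "\<exists>\<delta>. hyperbolic_metric (H x) \<delta>"
proof -
  obtain \<delta> where \<delta>: "\<And>a b c w. a \<in> mspace (H x) \<Longrightarrow> b \<in> mspace (H x) \<Longrightarrow> c \<in> mspace (H x) \<Longrightarrow> w \<in> mspace (H x) \<Longrightarrow>
    gromov_product (H x) c a b \<ge> min (gromov_product (H x) c a w) (gromov_product (H x) c w b) - \<delta>"
    using fibre_hyperbolic[OF assms] unfolding gromov_hyperbolic_def by blast
  have "hyperbolic_metric (H x) (max \<delta> 0)"
  proof
    fix a b c w assume "a \<in> mspace (H x)" "b \<in> mspace (H x)" "c \<in> mspace (H x)" "w \<in> mspace (H x)"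
    from \<delta>[OF this] show "gromov_product (H x) c a w \<le> gromov_product (H x) c a b + max \<delta> 0 \<or>
        gromov_product (H x) c w b \<le> gromov_product (H x) c a b + max \<delta> 0"
      by (auto simp: min_def max_def split: if_splits)
  qed simp
  then show ?thesis ..
qed

text \<open>Moving the four points by less than 1/6 each changes every Gromov product by less than 1/2.\<close>
lemma dense_hyperbolic:
  assumes dense: "\<And>p e. p \<in> mspace m \<Longrightarrow> e > 0 \<Longrightarrow> \<exists>k::nat. mdist m p (t k) < e"
    and t: "\<And>k. t k \<in> mspace m" and "\<delta> \<ge> 0"
    and hyp: "\<And>i j k l. gromov_product m (t k) (t i) (t l) \<le> gromov_product m (t k) (t i) (t j) + \<delta> \<or>
      gromov_product m (t k) (t l) (t j) \<le> gromov_product m (t k) (t i) (t j) + \<delta>"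
  shows "hyperbolic_metric m (\<delta> + 1)"
proof
  show "0 \<le> \<delta> + 1" using assms by simp
  have approx: "gromov_product m c a b \<le> gromov_product m c' a' b' + 1/2"
    if "a \<in> mspace m" "b \<in> mspace m" "c \<in> mspace m" "a' \<in> mspace m" "b' \<in> mspace m" "c' \<in> mspace m"
      "mdist m a a' < 1/6" "mdist m b b' < 1/6" "mdist m c c' < 1/6" for a b c a' b' c'
  proof -
    have "gromov_product m c a b \<le> gromov_product m c' a b + mdist m c c'"
      using that by (intro gromov_product_change_base)
    also have "gromov_product m c' a b \<le> gromov_product m c' a' b + mdist m a a'"
      using that by (intro gromov_product_change_point)
    also have "gromov_product m c' a' b \<le> gromov_product m c' a' b' + mdist m b b'"
      using gromov_product_change_point[of b m b' a' c'] that by (simp add: gromov_product_commute)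
    finally show ?thesis using that by simp
  qed
  fix a b c w assume m: "a \<in> mspace m" "b \<in> mspace m" "c \<in> mspace m" "w \<in> mspace m"
  obtain i where i: "mdist m a (t i) < 1/6" using dense[OF m(1), of "1/6"] by auto
  obtain j where j: "mdist m b (t j) < 1/6" using dense[OF m(2), of "1/6"] by auto
  obtain k where k: "mdist m c (t k) < 1/6" using dense[OF m(3), of "1/6"] by auto
  obtain l where l: "mdist m w (t l) < 1/6" using dense[OF m(4), of "1/6"] by auto
  have "gromov_product m c a w \<le> gromov_product m (t k) (t i) (t l) + 1/2"
    "gromov_product m c w b \<le> gromov_product m (t k) (t l) (t j) + 1/2"
    "gromov_product m (t k) (t i) (t j) \<le> gromov_product m c a b + 1/2"
    using i j k l m t by (auto intro!: approx simp: mdist_commute)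
  then show "gromov_product m c a w \<le> gromov_product m c a b + (\<delta> + 1) \<or> gromov_product m c w b \<le> gromov_product m c a b + (\<delta> + 1)"
    using hyp[of k i l j] by auto
qed

text \<open>The fibres that are hyperbolic with an integer constant \<open>n\<close> on the dense sections form a Borel set \<open>Y n\<close>,
and some \<open>Y n\<close> has positive measure. By ergodicity almost every class meets it, and fibres over a
class are isometric.\<close>
lemma uniform_hyperbolicity:
  assumes "enumerated_relation M R X h U"
  obtains \<delta> where "AE x in M. hyperbolic_metric (H x) \<delta>"
proof -
  interpret enumerated_relation M R X h U by fact
  obtain \<tau> :: "nat \<Rightarrow> 'x \<Rightarrow> 'h" where \<tau>: "\<And>i. borel_section M B \<pi> (\<tau> i)"
    "\<And>x p e. x \<in> space M \<Longrightarrow> p \<in> mspace (H x) \<Longrightarrow> e > 0 \<Longrightarrow> \<exists>k. mdist (H x) p (\<tau> k x) < e"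
    by (rule dense_sections) (rule that)
  define Y where "Y n = {x \<in> space M. \<forall>i j k l. gromov_product (H x) (\<tau> k x) (\<tau> i x) (\<tau> l x) \<le>
      gromov_product (H x) (\<tau> k x) (\<tau> i x) (\<tau> j x) + real n \<or>
      gromov_product (H x) (\<tau> k x) (\<tau> l x) (\<tau> j x) \<le> gromov_product (H x) (\<tau> k x) (\<tau> i x) (\<tau> j x) + real n}" for n
  note [measurable] = gromov_product_section_measurable[OF \<tau>(1) \<tau>(1) \<tau>(1)]
  have Y_sets [measurable]: "Y n \<in> sets M" for n unfolding Y_def by measurable
  have "space M = (\<Union>n. Y n)"
  proof (intro equalityI subsetI)
    fix x assume x: "x \<in> space M"
    obtain \<delta> where "hyperbolic_metric (H x) \<delta>" using fibre_hyperbolic_metric[OF x] ..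
    then interpret hyperbolic_metric "H x" \<delta> .
    obtain n :: nat where n: "\<delta> \<le> real n" using real_arch_simple by blast
    have "x \<in> Y n" unfolding Y_def
    proof (intro CollectI conjI x allI)
      fix i j k l
      have m: "\<tau> i x \<in> mspace (H x)" for i using section_fibre[OF \<tau>(1) x] .
      show "gromov_product (H x) (\<tau> k x) (\<tau> i x) (\<tau> l x) \<le>
        gromov_product (H x) (\<tau> k x) (\<tau> i x) (\<tau> j x) + real n \<or>
        gromov_product (H x) (\<tau> k x) (\<tau> l x) (\<tau> j x) \<le> gromov_product (H x) (\<tau> k x) (\<tau> i x) (\<tau> j x) + real n"
        using hyperbolic[OF m[of i] m[of j] m[of k] m[of l]] n by auto
    qed
    then show "x \<in> (\<Union>n. Y n)" by blast
  qed (auto simp: Y_def)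
  moreover have "(\<Union>n. Y n) \<in> null_sets M" if "\<And>n. emeasure M (Y n) = 0"
    using that by (intro null_sets_UN) (auto simp: null_sets_def)
  ultimately have "\<exists>n. emeasure M (Y n) \<noteq> 0"
    using emeasure_space_1 by (metis null_setsD1 zero_neq_one)
  then obtain n where n: "emeasure M (Y n) > 0" by (auto simp: zero_less_iff_neq_zero)
  have Y_hyp: "hyperbolic_metric (H y) (real n + 1)" if "y \<in> Y n" for y
  proof (rule dense_hyperbolic[of "H y" "\<lambda>k. \<tau> k y"])
    have y: "y \<in> space M" using that by (simp add: Y_def)
    show "\<exists>k. mdist (H y) p (\<tau> k y) < e" if "p \<in> mspace (H y)" "e > 0" for p e using \<tau>(2) y that by blast
    show "\<tau> k y \<in> mspace (H y)" for k using section_fibre[OF \<tau>(1) y] .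
  qed (use that in \<open>auto simp: Y_def\<close>)
  have "AE x in M. hyperbolic_metric (H x) (real n + 1)"
    using positive_set_meets_classes[OF R_ergodic Y_sets n]
    by eventually_elim (use hyperbolic_transport Y_hyp in blast)
  then show thesis by (rule that)
qed

text \<open>A boundary point is represented by a sequence in the dense set \<open>{\<tau> k x}\<close>, that is, by an element of
\<open>nat \<Rightarrow> nat\<close>. In this parametrisation the Gromov products that generate the Borel structure of the
completion are measurable, by \<open>ext_point_countable\<close>, and the set becomes a projection.\<close>
lemma boundary_projection:
  assumes E: "E \<in> sets (completion_bundle M B \<pi> H)"
  shows "{x. \<exists>c. c \<in> gromov_boundary (H x) \<and> (x, Inr c) \<in> E} \<in> sets (completion M)"
proof -
  interpret prob_space M by (rule M_prob)
  obtain \<tau> :: "nat \<Rightarrow> 'x \<Rightarrow> 'h" where \<tau>: "\<And>i. borel_section M B \<pi> (\<tau> i)"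
    "\<And>x p e. x \<in> space M \<Longrightarrow> p \<in> mspace (H x) \<Longrightarrow> e > 0 \<Longrightarrow> \<exists>k. mdist (H x) p (\<tau> k x) < e"
    by (rule dense_sections) (rule that)
  have \<tau>m: "\<tau> i x \<in> mspace (H x)" if "x \<in> space M" for i x using section_fibre[OF \<tau>(1) that] .
  have E_sub: "E \<subseteq> (SIGMA x:space M. gromov_completion (H x))"
    using sets.sets_into_space[OF E] unfolding completion_bundle_def by (simp add: space_measure_of_conv)
  define sq where "sq q = (\<lambda>i. \<tau> (snd q i) (fst q))" for q :: "'x \<times> (nat \<Rightarrow> nat)"
  define G0 where "G0 = {q \<in> space (M \<Otimes>\<^sub>M baire). sq q \<in> gromov_sequences (H (fst q))}"
  have coord: "(\<lambda>q. snd q i) \<in> M \<Otimes>\<^sub>M baire \<rightarrow>\<^sub>M count_space UNIV" for i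
    by (rule measurable_compose[OF measurable_snd measurable_baire_coordinate])
  have gp_meas1: "(\<lambda>q. gromov_product (H (fst q)) (a (fst q)) (\<tau> k (fst q)) (\<tau> (snd q i) (fst q))) \<in> borel_measurable (M \<Otimes>\<^sub>M baire)"
    if "borel_section M B \<pi> a" for a k i
    by (rule measurable_compose_countable[OF _ coord[of i]])
      (rule measurable_compose[OF measurable_fst gromov_product_section_measurable[OF \<tau>(1) \<tau>(1) that]])
  have gp_meas2: "(\<lambda>q. gromov_product (H (fst q)) (\<sigma> (fst q)) (\<tau> (snd q j) (fst q)) (\<tau> (snd q i) (fst q))) \<in> borel_measurable (M \<Otimes>\<^sub>M baire)" for i j
    by (rule measurable_compose_countable[OF gp_meas1[OF \<sigma>_section] coord[of j]])
  have G0_sets: "G0 \<in> sets (M \<Otimes>\<^sub>M baire)"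
  proof -
    have "G0 = {q \<in> space (M \<Otimes>\<^sub>M baire). \<forall>N::nat. \<exists>n. \<forall>i\<ge>n. \<forall>j\<ge>n.
      real N \<le> gromov_product (H (fst q)) (\<sigma> (fst q)) (\<tau> (snd q i) (fst q)) (\<tau> (snd q j) (fst q))}"
      unfolding G0_def
    proof (intro Collect_cong conj_cong refl)
      fix q assume "q \<in> space (M \<Otimes>\<^sub>M baire)"
      then have x: "fst q \<in> space M" by (auto simp: space_pair_measure)
      have r: "range (sq q) \<subseteq> mspace (H (fst q))" using \<tau>m[OF x] by (auto simp: sq_def)
      have "sq q \<in> gromov_sequences (H (fst q)) \<longleftrightarrow> (\<forall>N. \<exists>n. \<forall>i\<ge>n. \<forall>j\<ge>n. N \<le> gromov_product (H (fst q)) (\<sigma> (fst q)) (sq q i) (sq q j))"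
        using r gromov_asymptotic_iff[OF r r \<sigma>_fibre[OF x]] by (simp add: gromov_sequences_def)
      also have "\<dots> \<longleftrightarrow> (\<forall>N::nat. \<exists>n. \<forall>i\<ge>n. \<forall>j\<ge>n. real N \<le> gromov_product (H (fst q)) (\<sigma> (fst q)) (sq q i) (sq q j))"
        by (meson order_trans real_arch_simple)
      finally show "sq q \<in> gromov_sequences (H (fst q)) \<longleftrightarrow> (\<forall>N::nat. \<exists>n. \<forall>i\<ge>n. \<forall>j\<ge>n.
        real N \<le> gromov_product (H (fst q)) (\<sigma> (fst q)) (\<tau> (snd q i) (fst q)) (\<tau> (snd q j) (fst q)))"
        by (simp add: sq_def)
    qed
    also have "\<dots> \<in> sets (M \<Otimes>\<^sub>M baire)" using gp_meas2 by measurable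
    finally show ?thesis .
  qed
  define cls where "cls q = hyperbolic_metric.class_of (H (fst q)) (sq q)" for q
  have cls: "cls q \<in> gromov_boundary (H (fst q))" "sq q \<in> cls q" if q: "q \<in> G0" for q
  proof -
    have x: "fst q \<in> space M" using q by (auto simp: G0_def space_pair_measure)
    obtain \<delta> where "hyperbolic_metric (H (fst q)) \<delta>" using fibre_hyperbolic_metric[OF x] ..
    then interpret hyperbolic_metric "H (fst q)" \<delta> .
    show "cls q \<in> gromov_boundary (H (fst q))" "sq q \<in> cls q"
      using boundary_class[of "sq q"] q unfolding cls_def by (auto simp: G0_def)
  qed
  have "(\<lambda>q. (fst q, Inr (cls q))) \<in> restrict_space (M \<Otimes>\<^sub>M baire) G0 \<rightarrow>\<^sub>M completion_bundle M B \<pi> H"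
    unfolding completion_bundle_def
  proof (rule measurable_measure_of)
    show "(\<lambda>q. (fst q, Inr (cls q))) \<in> space (restrict_space (M \<Otimes>\<^sub>M baire) G0) \<rightarrow> (SIGMA x:space M. gromov_completion (H x))"
      using cls(1) by (auto simp: space_restrict_space gromov_completion_def space_pair_measure)
    fix W assume "W \<in> {{(x, \<xi>). x \<in> space M \<and> \<xi> \<in> gromov_completion (H x) \<and>
           gromov_product_ext (H x) (\<eta> x) \<xi> (Inl (\<sigma> x)) \<in> ereal ` A} | \<sigma> \<eta> A.
         borel_section M B \<pi> \<sigma> \<and> borel_section M B \<pi> \<eta> \<and> A \<in> sets borel \<and> A \<subseteq> {0..}}"
    then obtain p \<eta> A where W: "W = {(x, \<xi>). x \<in> space M \<and> \<xi> \<in> gromov_completion (H x) \<and>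
           gromov_product_ext (H x) (\<eta> x) \<xi> (Inl (p x)) \<in> ereal ` A}"
      and p: "borel_section M B \<pi> p" and \<eta>: "borel_section M B \<pi> \<eta>" and A [measurable]: "A \<in> sets borel" by blast
    define \<Phi> where "\<Phi> q = (SUP N::nat. INF k. if \<exists>n. \<forall>i\<ge>n. real N \<le> gromov_product (H (fst q)) (\<eta> (fst q)) (\<tau> k (fst q)) (\<tau> (snd q i) (fst q))
       then ereal (gromov_product (H (fst q)) (\<eta> (fst q)) (\<tau> k (fst q)) (p (fst q))) else \<infinity>)" for q :: "'x \<times> (nat \<Rightarrow> nat)"
    have \<Phi>_meas [measurable]: "\<Phi> \<in> borel_measurable (M \<Otimes>\<^sub>M baire)"
    proof -
      note [measurable] = gp_meas1[OF \<eta>] measurable_compose[OF measurable_fst gromov_product_section_measurable[OF \<tau>(1) p \<eta>]]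
      show ?thesis unfolding \<Phi>_def by measurable
    qed
    have \<Phi>: "gromov_product_ext (H (fst q)) (\<eta> (fst q)) (Inr (cls q)) (Inl (p (fst q))) \<in> ereal ` A \<longleftrightarrow> real_of_ereal (\<Phi> q) \<in> A"
      if q: "q \<in> G0" for q
    proof -
      have x: "fst q \<in> space M" using q by (auto simp: G0_def space_pair_measure)
      obtain \<delta> where "hyperbolic_metric (H (fst q)) \<delta>" using fibre_hyperbolic_metric[OF x] ..
      then interpret hyperbolic_metric "H (fst q)" \<delta> .
      note pf = section_fibre[OF p x] section_fibre[OF \<eta> x]
      have "ext (\<eta> (fst q)) (Inr (cls q)) (Inl (p (fst q))) = \<Phi> q"
        unfolding \<Phi>_def using ext_point_countable[of "\<lambda>k. \<tau> k (fst q)", OF \<tau>(2)[OF x] \<tau>m[OF x] cls[OF q] pf(2,1)]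
        by (simp add: sq_def)
      moreover from this have "\<Phi> q = ereal (boundary_product (\<eta> (fst q)) (cls q) (p (fst q)))"
        using ext_boundary_product[OF cls(1)[OF q] pf] by simp
      ultimately show ?thesis by auto
    qed
    have "(\<lambda>q. (fst q, Inr (cls q))) -` W \<inter> space (restrict_space (M \<Otimes>\<^sub>M baire) G0) =
      {q \<in> space (M \<Otimes>\<^sub>M baire). q \<in> G0 \<and> real_of_ereal (\<Phi> q) \<in> A}"
      using \<Phi> cls(1) by (auto simp: W space_restrict_space gromov_completion_def space_pair_measure G0_def)
    also have "\<dots> \<in> sets (M \<Otimes>\<^sub>M baire)" using G0_sets by measurable
    finally have S: "(\<lambda>q. (fst q, Inr (cls q))) -` W \<inter> space (restrict_space (M \<Otimes>\<^sub>M baire) G0) \<in> sets (M \<Otimes>\<^sub>M baire)" .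
    show "(\<lambda>q. (fst q, Inr (cls q))) -` W \<inter> space (restrict_space (M \<Otimes>\<^sub>M baire) G0) \<in> sets (restrict_space (M \<Otimes>\<^sub>M baire) G0)"
      using S G0_sets by (subst sets_restrict_space_iff) (auto simp: space_restrict_space)
  qed auto
  from measurable_sets[OF this E]
  have "(\<lambda>q. (fst q, Inr (cls q))) -` E \<inter> space (restrict_space (M \<Otimes>\<^sub>M baire) G0) \<in> sets (M \<Otimes>\<^sub>M baire)" (is "?E' \<in> _")
    using G0_sets by (subst (asm) sets_restrict_space_iff) auto
  from measurable_projection_baire[OF finite_measure_axioms this]
  have "{x. \<exists>z. (x, z) \<in> ?E'} \<in> sets (completion M)" .
  moreover have "{x. \<exists>c. c \<in> gromov_boundary (H x) \<and> (x, Inr c) \<in> E} = {x. \<exists>z. (x, z) \<in> ?E'}"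
  proof (intro Collect_cong iffI)
    fix x assume "\<exists>c. c \<in> gromov_boundary (H x) \<and> (x, Inr c) \<in> E"
    then obtain c where c: "c \<in> gromov_boundary (H x)" "(x, Inr c) \<in> E" by blast
    then have x: "x \<in> space M" using E_sub by auto
    obtain \<delta> where "hyperbolic_metric (H x) \<delta>" using fibre_hyperbolic_metric[OF x] ..
    then interpret hyperbolic_metric "H x" \<delta> .
    obtain t where t: "t \<in> c" using boundary_nonempty[OF c(1)] ..
    have "\<forall>i. \<exists>k. mdist (H x) (t i) (\<tau> k x) < 1" using \<tau>(2)[OF x boundary_seq(3)[OF c(1) t]] by simp
    then obtain z where z: "\<And>i. mdist (H x) (t i) (\<tau> (z i) x) < 1" by metis
    have sr: "range (sq (x, z)) \<subseteq> mspace (H x)" using \<tau>m[OF x] by (auto simp: sq_def)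
    have "gromov_asymptotic (H x) t (sq (x, z))"
      unfolding gromov_asymptotic_iff[OF boundary_seq(1)[OF c(1) t] sr \<sigma>_fibre[OF x]]
    proof
      fix N
      obtain n where n: "\<And>i j. i \<ge> n \<Longrightarrow> j \<ge> n \<Longrightarrow> N + 1 \<le> gp (\<sigma> x) (t i) (t j)"
        by (rule boundary_far[OF c(1) t t \<sigma>_fibre[OF x], of "N + 1"]) (rule that)
      have "N \<le> gp (\<sigma> x) (t i) (sq (x, z) j)" if "i \<ge> n" "j \<ge> n" for i j
        using n[OF that] z[of j] gromov_product_change_point[OF boundary_seq(3)[OF c(1) t, of j] \<tau>m[OF x, of "z j"] boundary_seq(3)[OF c(1) t, of i] \<sigma>_fibre[OF x]]
        by (simp add: sq_def gromov_product_commute)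
      then show "\<exists>n. \<forall>i\<ge>n. \<forall>j\<ge>n. N \<le> gp (\<sigma> x) (t i) (sq (x, z) j)" by blast
    qed
    then have sc: "sq (x, z) \<in> c" by (rule boundary_mem[OF c(1) t sr])
    then have "(x, z) \<in> G0"
      using boundary_seq(1,2)[OF c(1) sc] x by (simp add: G0_def space_pair_measure gromov_sequences_def)
    moreover from this have "cls (x, z) = c"
      using boundary_eq[OF _ c(1) _ sc boundary_seq(2)[OF c(1) sc], of "cls (x, z)"] cls[of "(x, z)"] by simp
    ultimately have "(x, z) \<in> ?E'" using c(2) G0_sets sets.sets_into_space by (auto simp: space_restrict_space)
    then show "\<exists>z. (x, z) \<in> ?E'" by blast
  next
    fix x assume "\<exists>z. (x, z) \<in> ?E'"
    then obtain z where z: "(x, z) \<in> ?E'" ..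
    then have "(x, z) \<in> G0" "(x, Inr (cls (x, z))) \<in> E" by (auto simp: space_restrict_space)
    then show "\<exists>c. c \<in> gromov_boundary (H x) \<and> (x, Inr c) \<in> E" using cls(1)[of "(x, z)"] by auto
  qed
  ultimately show ?thesis by simp
qed

end

section \<open>Minimality of the limit set\<close>

text \<open>The situation after all null sets have been removed: on the invariant conull set \<open>X\<close> the hypotheses on \<open>C\<close>
hold at every point, the fibres are \<open>\<delta>\<close>-hyperbolic with one \<open>\<delta>\<close>, and the orbit points are given by Borel
sections \<open>s j\<close>.\<close>
locale invariant_limit_subset = hyperbolic_action M R B \<pi> H \<alpha> \<sigma> + enumerated_relation M R X h U
  for M :: "'x measure" and R B and \<pi> :: "'h \<Rightarrow> 'x" and H \<alpha> \<sigma> X h U +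
  fixes C :: "('x \<times> 'h gpoint) set" and s :: "nat \<Rightarrow> 'x \<Rightarrow> 'h" and \<delta> :: real
  assumes X_proper: "\<And>x. x \<in> X \<Longrightarrow> proper_at x"
    and X_hyperbolic: "\<And>x. x \<in> X \<Longrightarrow> hyperbolic_metric (H x) \<delta>"
    and s_section: "\<And>j. borel_section M B \<pi> (s j)"
    and s_eq: "\<And>x j. x \<in> X \<Longrightarrow> s j x = orbit_point x (h j x)"
    and C_sets: "C \<in> sets (completion_bundle M B \<pi> H)"
    and C_limit: "C \<subseteq> (SIGMA x:space M. limit_set R H \<alpha> \<sigma> x)"
    and C_closed: "\<And>x. x \<in> X \<Longrightarrow> closedin (gromov_topology (H x)) (C `` {x})"
    and C_equivariant: "\<And>x y. x \<in> X \<Longrightarrow> (x, y) \<in> R \<Longrightarrow> extend_isometry (\<alpha> x y) ` (C `` {y}) = C `` {x}"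
    and C_nonempty: "\<And>x. x \<in> X \<Longrightarrow> C `` {x} \<noteq> {}"
begin

text \<open>The default value 0 makes \<open>d\<close> a Borel function on the whole square.\<close>
definition d :: "'x \<Rightarrow> 'x \<Rightarrow> real" where "d x y = (if x \<in> X \<and> (x, y) \<in> R then orbit_dist x y else 0)"

lemma d_measurable [measurable]: "(\<lambda>(x, y). d x y) \<in> borel_measurable (M \<Otimes>\<^sub>M M)"
  unfolding d_def
  by (rule class_function_measurable[where e = "\<lambda>j x. mdist (H x) (\<sigma> x) (s j x)"])
    (auto simp: orbit_dist_def s_eq intro: mdist_section_measurable \<sigma>_section s_section)

lemma d_eq: "x \<in> X \<Longrightarrow> (x, y) \<in> R \<Longrightarrow> d x y = orbit_dist x y"
  by (simp add: d_def)

lemma d_finite: assumes "x \<in> X" shows "finite {y \<in> R `` {x}. d x y \<le> c}"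
proof -
  have "{y \<in> R `` {x}. d x y \<le> c} = {y \<in> R `` {x}. orbit_dist x y \<le> c}" using assms d_eq by auto
  then show ?thesis using X_proper[OF assms] by (simp add: proper_at_def)
qed

lemma C_boundary: "\<xi> \<in> C `` {x} \<Longrightarrow> \<exists>c\<in>gromov_boundary (H x). \<xi> = Inr c"
  using C_limit unfolding limit_set_def by auto

lemma C_transport: "x \<in> X \<Longrightarrow> (x, y) \<in> R \<Longrightarrow> Inr c \<in> C `` {y} \<Longrightarrow> Inr ((\<lambda>s. \<alpha> x y \<circ> s) ` c) \<in> C `` {x}"
  using C_equivariant[of x y] by (force simp: extend_isometry_def)

lemma limit_point_approached:
  assumes x: "x \<in> X" and \<zeta>: "\<zeta> \<in> limit_set R H \<alpha> \<sigma> x"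
  obtains c where "\<zeta> = Inr c" "c \<in> gromov_boundary (H x)"
    "\<And>z r. z \<in> mspace (H x) \<Longrightarrow> \<exists>y\<in>R `` {x}. r < hyperbolic_metric.boundary_product (H x) z c (orbit_point x y)"
proof -
  interpret hyperbolic_metric "H x" \<delta> by (rule X_hyperbolic[OF x])
  have sx: "\<sigma> x \<in> mspace (H x)" using \<sigma>_fibre X_space x by blast
  obtain c where c: "\<zeta> = Inr c" "c \<in> gromov_boundary (H x)" "Inr c \<in> gromov_topology (H x) closure_of (Inl ` orbit R \<alpha> \<sigma> x)"
    using \<zeta> unfolding limit_set_def orbit_closure_def by auto
  have orbit: "orbit R \<alpha> \<sigma> x = orbit_point x ` (R `` {x})" by (simp add: orbit_def orbit_point_def)
  have "\<exists>y\<in>orbit R \<alpha> \<sigma> x. r < boundary_product z c y" if z: "z \<in> mspace (H x)" for z r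
  proof (rule closure_point_approached[OF _ _ c(2,3) z])
    show "orbit R \<alpha> \<sigma> x \<subseteq> mspace (H x)" unfolding orbit using orbit_point_fibre by auto
    fix p r assume p: "p \<in> mspace (H x)"
    interpret Metric_space "mspace (H x)" "mdist (H x)" by (rule Metric_space_mspace_mdist)
    have "orbit R \<alpha> \<sigma> x \<inter> mball_of (H x) p r \<subseteq> orbit_point x ` {y \<in> R `` {x}. orbit_dist x y \<le> mdist (H x) (\<sigma> x) p + r}"
    proof
      fix q assume q: "q \<in> orbit R \<alpha> \<sigma> x \<inter> mball_of (H x) p r"
      then obtain y where y: "(x, y) \<in> R" "q = orbit_point x y" unfolding orbit by auto
      have "mdist (H x) p q < r" using q by (auto simp: mball_of_def)
      moreover have "mdist (H x) (\<sigma> x) q \<le> mdist (H x) (\<sigma> x) p + mdist (H x) p q"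
        using sx p orbit_point_fibre[OF y(1)] y(2) by (intro mdist_triangle) auto
      ultimately show "q \<in> orbit_point x ` {y \<in> R `` {x}. orbit_dist x y \<le> mdist (H x) (\<sigma> x) p + r}"
        using y by (auto simp: orbit_dist_def)
    qed
    moreover have "finite {y \<in> R `` {x}. orbit_dist x y \<le> mdist (H x) (\<sigma> x) p + r}"
      using X_proper[OF x] by (simp add: proper_at_def)
    ultimately show "finite (orbit R \<alpha> \<sigma> x \<inter> mball_of (H x) p r)" by (meson finite_imageI finite_subset)
  qed
  then have "\<exists>y\<in>R `` {x}. r < boundary_product z c (orbit_point x y)" if "z \<in> mspace (H x)" for z r
    using that unfolding orbit by blast
  then show thesis using c(1,2) that by blast
qed

text \<open>Let \<open>y\<close> be an orbit point close to a limit point \<open>\<zeta>\<close> outside \<open>C\<^sub>x\<close>, let \<open>o'\<close> be a fixed orbit point with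
index \<open>a \<in> A\<close>, and let \<open>z \<in> A\<close> be nearest to \<open>y\<close>. If \<open>(y|z)\<close> at \<open>o'\<close> were large, \<open>z\<close> would be close to
\<open>\<zeta>\<close> too. But \<open>z\<close> is near a geodesic between two points of \<open>C\<^sub>x\<close>, so one of them would be close to \<open>\<zeta>\<close>,
contradicting that \<open>C\<^sub>x\<close> is closed. Since \<open>z\<close> is at least as near to \<open>y\<close> as \<open>a\<close> is, its distance from
\<open>o'\<close> is at most twice this product. Thus infinitely many points send their mass to a finite set.\<close>
lemma minimal_if_near_geodesics:
  assumes A [measurable]: "A \<in> sets M" "A \<subseteq> X" "emeasure M A > 0"
    and near: "\<And>z. z \<in> A \<Longrightarrow> \<exists>c1 c2 u v. Inr c1 \<in> C `` {z} \<and> Inr c2 \<in> C `` {z} \<and> u \<in> c1 \<and> v \<in> c2 \<and>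
      (\<exists>n. \<forall>i\<ge>n. \<forall>j\<ge>n. gromov_product (H z) (\<sigma> z) (u i) (v j) \<le> r)"
  shows "AE x in M. limit_set R H \<alpha> \<sigma> x \<subseteq> C `` {x}"
proof -
  define Q where "Q = {q \<in> space (M \<Otimes>\<^sub>M M). q \<in> R \<and> snd q \<in> A \<and>
    (\<forall>j. h j (fst q) \<in> A \<longrightarrow> d (fst q) (snd q) \<le> d (fst q) (h j (fst q)))}"
  have Q_sets: "Q \<in> sets (M \<Otimes>\<^sub>M M)" unfolding Q_def by measurable
  have QR: "Q \<subseteq> R" by (auto simp: Q_def)
  have Q_iff: "(y, z) \<in> Q \<longleftrightarrow> (y, z) \<in> R \<and> z \<in> A \<and> (\<forall>w\<in>R `` {y}. w \<in> A \<longrightarrow> d y z \<le> d y w)" if "y \<in> X" for y z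
    using class_all[OF that, of "\<lambda>w. w \<in> A \<longrightarrow> d y z \<le> d y w"] R_space[of y z]
    by (auto simp: Q_def space_pair_measure)
  from finite_selected[OF Q_sets QR] positive_set_meets_classes[OF R_ergodic A(1,3)] X_conull
  show ?thesis
  proof eventually_elim
    case (elim x)
    note fin = elim(1) and x = elim(3)
    obtain a where a: "(x, a) \<in> R" "a \<in> A" using elim(2) by auto
    interpret hyperbolic_metric "H x" \<delta> by (rule X_hyperbolic[OF x])
    define o' where "o' = orbit_point x a"
    have o: "o' \<in> mspace (H x)" using orbit_point_fibre[OF a(1)] by (simp add: o'_def)
    have aX: "a \<in> X" using A(2) a(2) by auto
    show ?case
    proof
      fix \<zeta> assume "\<zeta> \<in> limit_set R H \<alpha> \<sigma> x"
      then obtain c where c: "\<zeta> = Inr c" "c \<in> gromov_boundary (H x)"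
        "\<And>z r. z \<in> mspace (H x) \<Longrightarrow> \<exists>y\<in>R `` {x}. r < boundary_product z c (orbit_point x y)"
        by (rule limit_point_approached[OF x]) (rule that)
      show "\<zeta> \<in> C `` {x}"
      proof (rule ccontr)
        assume "\<zeta> \<notin> C `` {x}"
        then obtain r' where r': "\<And>\<eta>. \<eta> \<in> C `` {x} \<Longrightarrow> ext o' (Inr c) \<eta> \<le> ereal r'"
          using closed_set_separated[OF C_closed[OF x] c(2) _ o] c(1) by blast
        obtain s0 where s0: "s0 \<in> c" using boundary_nonempty[OF c(2)] ..
        note s0m = boundary_seq(3)[OF c(2) s0]
        \<comment> \<open>\<open>r'\<close> bounds the products of \<open>\<zeta>\<close> with \<open>C\<^sub>x\<close>. The constant exceeds \<open>r' + r\<close> by the errors of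
          the comparisons below, so that a product above \<open>K\<close> forces one above \<open>r'\<close>.\<close>
        define K where "K = max r 0 + max r' 0 + 1 + 4 * \<delta>"
        define W where "W = {y \<in> R `` {x}. K < boundary_product o' c (orbit_point x y)}"
        define F where "F = {z \<in> R `` {a}. d a z \<le> 2 * K}"
        have "finite F" unfolding F_def by (rule d_finite[OF aX])
        then have finW: "finite {y \<in> R `` {x}. Q `` {y} \<noteq> {} \<and> Q `` {y} \<subseteq> F}" using fin by blast
        have "W \<subseteq> {y \<in> R `` {x}. Q `` {y} \<noteq> {} \<and> Q `` {y} \<subseteq> F}"
        proof
          fix y assume "y \<in> W"
          then have y: "(x, y) \<in> R" "K < boundary_product o' c (orbit_point x y)" by (auto simp: W_def)
          have yX: "y \<in> X" by (rule X_saturated[OF x y(1)])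
          have ya: "(y, a) \<in> R" using R_trans[OF R_sym[OF y(1)] a(1)] .
          define p where "p = orbit_point x y"
          have p: "p \<in> mspace (H x)" using orbit_point_fibre[OF y(1)] by (simp add: p_def)
          let ?T = "{z \<in> R `` {y}. z \<in> A \<and> d y z \<le> d y a}"
          have finT: "finite ?T" by (rule finite_subset[OF _ d_finite[OF yX, of "d y a"]]) auto
          have "a \<in> ?T" using ya a(2) by auto
          then have "Min (d y ` ?T) \<in> d y ` ?T" using finT by (intro Min_in) auto
          then obtain z where z: "z \<in> ?T" "d y z = Min (d y ` ?T)" by force
          have "d y z \<le> d y w" if w: "w \<in> R `` {y}" "w \<in> A" for w
          proof (cases "d y w \<le> d y a")
            case True
            then have "w \<in> ?T" using w by auto
            then show ?thesis using z(2) finT by simp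
          next
            case False then show ?thesis using z(1) by auto
          qed
          then have "(y, z) \<in> Q" using z(1) Q_iff[OF yX] by blast
          moreover have "Q `` {y} \<subseteq> F"
          proof
            fix z assume "z \<in> Q `` {y}"
            then have z: "(y, z) \<in> R" "z \<in> A" "d y z \<le> d y a" using Q_iff[OF yX] ya a(2) by auto
            have xz: "(x, z) \<in> R" by (rule R_trans[OF y(1) z(1)])
            have az: "(a, z) \<in> R" by (rule R_trans[OF R_sym[OF a(1)] xz])
            define w where "w = orbit_point x z"
            have w: "w \<in> mspace (H x)" using orbit_point_fibre[OF xz] by (simp add: w_def)
            have dist: "mdist (H x) p w = d y z" "mdist (H x) p o' = d y a" "mdist (H x) o' w = d a z"
              using mdist_orbit_point[OF y(1) xz] mdist_orbit_point[OF y(1) a(1)] mdist_orbit_point[OF a(1) xz] d_eq[OF yX z(1)] d_eq[OF yX ya] d_eq[OF aX az]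
              by (simp_all add: p_def w_def o'_def)
            have "gp o' p w \<le> K"
            proof (rule ccontr)
              assume "\<not> gp o' p w \<le> K"
              then have far: "K < gp o' p w" by simp
              obtain c1 c2 u v n where cuv: "Inr c1 \<in> C `` {z}" "Inr c2 \<in> C `` {z}" "u \<in> c1" "v \<in> c2"
                "\<And>i j. i \<ge> n \<Longrightarrow> j \<ge> n \<Longrightarrow> gromov_product (H z) (\<sigma> z) (u i) (v j) \<le> r"
                using near[OF z(2)] by blast
              define c1' c2' where "c1' = (\<lambda>s. \<alpha> x z \<circ> s) ` c1" and "c2' = (\<lambda>s. \<alpha> x z \<circ> s) ` c2"
              define u' v' where "u' = \<alpha> x z \<circ> u" and "v' = \<alpha> x z \<circ> v"
              have C': "Inr c1' \<in> C `` {x}" "Inr c2' \<in> C `` {x}"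
                using C_transport[OF x xz] cuv(1,2) by (auto simp: c1'_def c2'_def)
              have uv: "u' \<in> c1'" "v' \<in> c2'" using cuv(3,4) by (auto simp: c1'_def c2'_def u'_def v'_def)
              have bd: "c1' \<in> gromov_boundary (H x)" "c2' \<in> gromov_boundary (H x)" using C_boundary C' by blast+
              have zsp: "z \<in> space M" using R_in_space[OF xz] by simp
              interpret Z: hyperbolic_metric "H z" \<delta> by (rule X_hyperbolic) (use A(2) z(2) in auto)
              have bdz: "c1 \<in> gromov_boundary (H z)" "c2 \<in> gromov_boundary (H z)" using C_boundary cuv(1,2) by blast+
              note uvz = Z.boundary_seq(3)[OF bdz(1) cuv(3)] Z.boundary_seq(3)[OF bdz(2) cuv(4)]
              note uvm = boundary_seq(3)[OF bd(1) uv(1)] boundary_seq(3)[OF bd(2) uv(2)]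
              have gpw: "gp w (u' i) (v' j) = gromov_product (H z) (\<sigma> z) (u i) (v j)" for i j
                using uvz[of i] uvz[of j] \<sigma>_fibre[OF zsp]
                by (simp add: gromov_product_def u'_def v'_def w_def orbit_point_def \<alpha>_dist[OF xz])
              obtain n1 where n1: "\<And>i. i \<ge> n1 \<Longrightarrow> K < gp o' (s0 i) p"
                using boundary_product_eventually_greater[OF c(2) s0 p o] y(2) unfolding p_def by blast
              have less: "ext o' (Inr c) (Inr c1') < ereal (max r' 0 + 1)" "ext o' (Inr c) (Inr c2') < ereal (max r' 0 + 1)"
                using r'[OF C'(1)] r'[OF C'(2)] by (auto intro: le_less_trans)
              obtain n2 where n2: "\<forall>i\<ge>n2. \<forall>j\<ge>n2. gp o' (s0 i) (u' j) < max r' 0 + 1 + 2 * \<delta>"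
                using ext_boundary_lessD[OF c(2) bd(1) o less(1) s0 uv(1)] ..
              obtain n3 where n3: "\<forall>i\<ge>n3. \<forall>j\<ge>n3. gp o' (s0 i) (v' j) < max r' 0 + 1 + 2 * \<delta>"
                using ext_boundary_lessD[OF c(2) bd(2) o less(2) s0 uv(2)] ..
              define k where "k = max (max n n1) (max n2 n3)"
              have k: "K < gp o' (s0 k) p" "gp o' (s0 k) (u' k) < max r' 0 + 1 + 2 * \<delta>"
                "gp o' (s0 k) (v' k) < max r' 0 + 1 + 2 * \<delta>" "gp w (u' k) (v' k) \<le> r"
                using n1[of k] n2 n3 cuv(5)[of k k] by (simp_all add: k_def gpw)
              have sw: "gp o' (s0 k) w > K - \<delta>"
                using hyperbolic[OF s0m[of k] w o p] k(1) far by (auto simp: gromov_product_commute)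
              have ow: "mdist (H x) o' w > K"
                using gromov_product_le[OF p w o] far by (simp add: mdist_commute)
              have opp: "gp o' q w = mdist (H x) o' w - gp w q o'" for q
                by (simp add: gromov_product_def mdist_commute[of "H x" w o'] field_simps)
              have sq: "gp o' (s0 k) q \<ge> max r' 0 + 1 + 2 * \<delta>"
                if q: "q \<in> mspace (H x)" and qw: "gp w q o' \<le> r + \<delta>" for q
              proof -
                have "gp o' q w > K - r - \<delta>" using opp[of q] ow qw by simp
                then show ?thesis
                  using hyperbolic[OF s0m[of k] q o w] sw \<delta>_nonneg
                  unfolding K_def by (auto simp: gromov_product_commute[of _ o' w q])
              qed
              have "gp w (u' k) o' \<le> r + \<delta> \<or> gp w o' (v' k) \<le> r + \<delta>"
                using hyperbolic[OF uvm(1)[of k] uvm(2)[of k] w o] k(4) by auto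
              then show False
                using sq[OF uvm(1)[of k]] sq[OF uvm(2)[of k]] k(2,3) by (auto simp: gromov_product_commute[of _ w o'])
            qed
            moreover have "d a z \<le> 2 * gp o' p w"
              using z(3) unfolding dist[symmetric] by (simp add: gromov_product_def mdist_commute[of "H x" w o'])
            ultimately show "z \<in> F" using az by (simp add: F_def)
          qed
          ultimately show "y \<in> {y \<in> R `` {x}. Q `` {y} \<noteq> {} \<and> Q `` {y} \<subseteq> F}" using y(1) by blast
        qed
        then have finW': "finite W" using finW by (rule finite_subset)
        obtain y where y: "y \<in> R `` {x}" "Max (insert K ((\<lambda>y. boundary_product o' c (orbit_point x y)) ` W)) < boundary_product o' c (orbit_point x y)"
          using c(3)[OF o] by blast
        then have "K < boundary_product o' c (orbit_point x y)" using finW' by simp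
        then have "y \<in> W" using y(1) by (simp add: W_def)
        then have "boundary_product o' c (orbit_point x y) \<le> Max (insert K ((\<lambda>y. boundary_product o' c (orbit_point x y)) ` W))" using finW' by (intro Max_ge) auto
        then show False using y(2) by simp
      qed
    qed
  qed
qed

text \<open>Sets of this form lie over the generators of the Borel structure of the completion.\<close>
lemma C_product_sets:
  assumes p: "borel_section M B \<pi> p" and V [measurable]: "V \<in> sets borel"
  shows "{x. \<exists>c. c \<in> gromov_boundary (H x) \<and> (x, Inr c) \<in> C \<and> hyperbolic_metric.boundary_product (H x) (\<sigma> x) c (p x) \<in> V} \<in> sets (completion M)"
proof -
  let ?W = "{(x, \<xi>). x \<in> space M \<and> \<xi> \<in> gromov_completion (H x) \<and>
           gromov_product_ext (H x) (\<sigma> x) \<xi> (Inl (p x)) \<in> ereal ` (V \<inter> {0..})}"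
  have "?W \<in> {{(x, \<xi>). x \<in> space M \<and> \<xi> \<in> gromov_completion (H x) \<and>
           gromov_product_ext (H x) (\<eta> x) \<xi> (Inl (\<sigma> x)) \<in> ereal ` A} | \<sigma> \<eta> A.
         borel_section M B \<pi> \<sigma> \<and> borel_section M B \<pi> \<eta> \<and> A \<in> sets borel \<and> A \<subseteq> {0..}}"
    using p \<sigma>_section V by (intro CollectI exI[of _ p] exI[of _ \<sigma>] exI[of _ "V \<inter> {0..}"]) auto
  then have "?W \<in> sets (completion_bundle M B \<pi> H)"
    unfolding completion_bundle_def by (subst sets_measure_of) auto
  then have "C \<inter> ?W \<in> sets (completion_bundle M B \<pi> H)" using C_sets by auto
  from boundary_projection[OF this]
  have "{x. \<exists>c. c \<in> gromov_boundary (H x) \<and> (x, Inr c) \<in> C \<inter> ?W} \<in> sets (completion M)" .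
  moreover have "(x, Inr c) \<in> ?W \<longleftrightarrow> hyperbolic_metric.boundary_product (H x) (\<sigma> x) c (p x) \<in> V"
    if xc: "c \<in> gromov_boundary (H x)" "(x, Inr c) \<in> C" for x c
  proof -
    have x: "x \<in> space M" using C_limit xc(2) by auto
    obtain \<delta> where "hyperbolic_metric (H x) \<delta>" using fibre_hyperbolic_metric[OF x] ..
    then interpret hyperbolic_metric "H x" \<delta> .
    note pf = section_fibre[OF p x] \<sigma>_fibre[OF x]
    have "ext (\<sigma> x) (Inr c) (Inl (p x)) = ereal (boundary_product (\<sigma> x) c (p x))" by (rule ext_boundary_product[OF xc(1) pf])
    moreover have "0 \<le> boundary_product (\<sigma> x) c (p x)" using ext_point_nonneg[OF xc(1) pf] calculation by simp
    ultimately show ?thesis using x xc(1) by (auto simp: gromov_completion_def)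
  qed
  then have "{x. \<exists>c. c \<in> gromov_boundary (H x) \<and> (x, Inr c) \<in> C \<inter> ?W} =
    {x. \<exists>c. c \<in> gromov_boundary (H x) \<and> (x, Inr c) \<in> C \<and> hyperbolic_metric.boundary_product (H x) (\<sigma> x) c (p x) \<in> V}"
    by blast
  ultimately show ?thesis by simp
qed

text \<open>Two points of \<open>C\<^sub>x\<close> have a finite Gromov product. The existence of such a pair is expressed through
points of the dense sections, \<open>\<tau> k x\<close> close to one point and \<open>\<tau> l x\<close> close to the other, so that only
one boundary point at a time has to be projected away. The sets \<open>T n\<close> collect the fibres with a pair
whose product is at most about \<open>n\<close>.\<close>
lemma minimal_or_single_point:
  shows "(AE x in M. limit_set R H \<alpha> \<sigma> x \<subseteq> C `` {x}) \<or> (AE x in M. \<exists>c. C `` {x} = {Inr c})"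
proof -
  obtain \<tau> :: "nat \<Rightarrow> 'x \<Rightarrow> 'h" where \<tau>: "\<And>i. borel_section M B \<pi> (\<tau> i)"
    "\<And>x p e. x \<in> space M \<Longrightarrow> p \<in> mspace (H x) \<Longrightarrow> e > 0 \<Longrightarrow> \<exists>k. mdist (H x) p (\<tau> k x) < e"
    by (rule dense_sections) (rule that)
  define P where "P k r = {x. \<exists>c. c \<in> gromov_boundary (H x) \<and> (x, Inr c) \<in> C \<and> hyperbolic_metric.boundary_product (H x) (\<sigma> x) c (\<tau> k x) \<in> {r<..}}" for k and r :: real
  define T where "T n = (\<Union>k. \<Union>l. {x \<in> X. gromov_product (H x) (\<sigma> x) (\<tau> k x) (\<tau> l x) \<le> real n} \<inter> P k (real n + 2 * \<delta>) \<inter> P l (real n + 2 * \<delta>))" for n :: nat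
  note [measurable] = gromov_product_section_measurable[OF \<tau>(1) \<tau>(1) \<sigma>_section]
  have T_sets: "T n \<in> sets (completion M)" for n
  proof -
    have "{x \<in> X. gromov_product (H x) (\<sigma> x) (\<tau> k x) (\<tau> l x) \<le> real n} \<in> sets (completion M)" for k l
      by (intro sets_completionI_sets) measurable
    moreover have "P k r \<in> sets (completion M)" for k r unfolding P_def by (rule C_product_sets[OF \<tau>(1)]) simp
    ultimately show ?thesis unfolding T_def by (intro sets.countable_UN'' sets.Int) auto
  qed
  show ?thesis
  proof (cases "\<exists>n. \<not> (AE x in M. x \<notin> T n)")
    case True
    then obtain n where n: "\<not> (AE x in M. x \<notin> T n)" ..
    obtain S Z Z' where SZ: "T n = S \<union> Z" "Z \<subseteq> Z'" "S \<in> sets M" "Z' \<in> null_sets M"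
      using T_sets[of n] by (elim sets_completionE) blast
    have "emeasure M S > 0"
    proof (rule ccontr)
      assume "\<not> ?thesis"
      then have "S \<in> null_sets M" using SZ(3) by (simp add: null_sets_def)
      from AE_not_in[OF this] AE_not_in[OF SZ(4)] have "AE x in M. x \<notin> T n"
        by eventually_elim (use SZ(1,2) in auto)
      then show False using n by simp
    qed
    moreover have "S \<subseteq> X" using SZ(1) by (auto simp: T_def)
    moreover have "\<exists>c1 c2 u v. Inr c1 \<in> C `` {z} \<and> Inr c2 \<in> C `` {z} \<and> u \<in> c1 \<and> v \<in> c2 \<and>
      (\<exists>n'. \<forall>i\<ge>n'. \<forall>j\<ge>n'. gromov_product (H z) (\<sigma> z) (u i) (v j) \<le> real n + 2 * \<delta>)" if z: "z \<in> S" for z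
    proof -
      have "z \<in> T n" using SZ(1) z by auto
      then obtain k l where kl: "z \<in> X" "gromov_product (H z) (\<sigma> z) (\<tau> k z) (\<tau> l z) \<le> real n"
        "z \<in> P k (real n + 2 * \<delta>)" "z \<in> P l (real n + 2 * \<delta>)" by (auto simp: T_def)
      interpret hyperbolic_metric "H z" \<delta> by (rule X_hyperbolic[OF kl(1)])
      have zs: "z \<in> space M" using X_space kl(1) by auto
      note m = \<sigma>_fibre[OF zs] section_fibre[OF \<tau>(1) zs]
      obtain c1 c2 where c1: "c1 \<in> gromov_boundary (H z)" "Inr c1 \<in> C `` {z}" "real n + 2 * \<delta> < boundary_product (\<sigma> z) c1 (\<tau> k z)"
        and c2: "c2 \<in> gromov_boundary (H z)" "Inr c2 \<in> C `` {z}" "real n + 2 * \<delta> < boundary_product (\<sigma> z) c2 (\<tau> l z)"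
        using kl(3,4) unfolding P_def by auto
      obtain u v where u: "u \<in> c1" and v: "v \<in> c2" using boundary_nonempty c1(1) c2(1) by blast
      obtain a where a: "\<And>i. i \<ge> a \<Longrightarrow> real n + 2 * \<delta> < gp (\<sigma> z) (u i) (\<tau> k z)"
        using boundary_product_eventually_greater[OF c1(1) u m(2,1) c1(3)] by blast
      obtain b where b: "\<And>i. i \<ge> b \<Longrightarrow> real n + 2 * \<delta> < gp (\<sigma> z) (v i) (\<tau> l z)"
        using boundary_product_eventually_greater[OF c2(1) v m(2,1) c2(3)] by blast
      have "gp (\<sigma> z) (u i) (v j) \<le> real n + 2 * \<delta>" if ij: "i \<ge> max a b" "j \<ge> max a b" for i j
      proof -
        note um = boundary_seq(3)[OF c1(1) u, of i] and vm = boundary_seq(3)[OF c2(1) v, of j]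
        have 1: "gp (\<sigma> z) (\<tau> k z) (u i) > real n + 2 * \<delta>" "gp (\<sigma> z) (v j) (\<tau> l z) > real n + 2 * \<delta>"
          using a[of i] b[of j] ij by (auto simp: gromov_product_commute)
        have "gp (\<sigma> z) (u i) (\<tau> l z) \<le> real n + \<delta>"
          using hyperbolic[OF m(2)[of k] m(2)[of l] m(1) um] 1 kl(2) \<delta>_nonneg by auto
        then show ?thesis
          using hyperbolic[OF um m(2)[of l] m(1) vm] 1 \<delta>_nonneg by auto
      qed
      then show ?thesis using c1(2) c2(2) u v by blast
    qed
    ultimately have "AE x in M. limit_set R H \<alpha> \<sigma> x \<subseteq> C `` {x}"
      using SZ(3) by (intro minimal_if_near_geodesics[of S "real n + 2 * \<delta>"])
    then show ?thesis ..
  next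
    case False
    then have "AE x in M. \<forall>n. x \<notin> T n" unfolding AE_all_countable by blast
    with X_conull have "AE x in M. \<exists>c. C `` {x} = {Inr c}"
    proof eventually_elim
      case (elim x)
      interpret hyperbolic_metric "H x" \<delta> by (rule X_hyperbolic[OF elim(1)])
      have xs: "x \<in> space M" using X_space elim(1) by auto
      note m = \<sigma>_fibre[OF xs] section_fibre[OF \<tau>(1) xs]
      have unique: "c1 = c2" if c: "Inr c1 \<in> C `` {x}" "Inr c2 \<in> C `` {x}" for c1 c2
      proof (rule ccontr)
        assume "c1 \<noteq> c2"
        have bd: "c1 \<in> gromov_boundary (H x)" "c2 \<in> gromov_boundary (H x)" using C_boundary c by blast+
        obtain u v where u: "u \<in> c1" and v: "v \<in> c2" using boundary_nonempty bd by blast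
        note um = boundary_seq(3)[OF bd(1) u] and vm = boundary_seq(3)[OF bd(2) v]
        have "\<not> gromov_asymptotic (H x) u v" using boundary_eq[OF bd u v] \<open>c1 \<noteq> c2\<close> by blast
        then obtain N where N: "\<And>n. \<exists>i\<ge>n. \<exists>j\<ge>n. gp (\<sigma> x) (u i) (v j) < N"
          unfolding gromov_asymptotic_iff[OF boundary_seq(1)[OF bd(1) u] boundary_seq(1)[OF bd(2) v] m(1)]
          by (auto simp: not_le)
        obtain n :: nat where n: "max N 0 + 2 * \<delta> + 2 \<le> real n" using real_arch_simple by blast
        define L where "L = real n + 4 * \<delta> + 4"
        obtain a where a: "\<And>i j. i \<ge> a \<Longrightarrow> j \<ge> a \<Longrightarrow> L \<le> gp (\<sigma> x) (u i) (u j)"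
          by (rule boundary_far[OF bd(1) u u m(1), of L]) (rule that)
        obtain b where b: "\<And>i j. i \<ge> b \<Longrightarrow> j \<ge> b \<Longrightarrow> L \<le> gp (\<sigma> x) (v i) (v j)"
          by (rule boundary_far[OF bd(2) v v m(1), of L]) (rule that)
        obtain i j where ij: "i \<ge> max a b" "j \<ge> max a b" "gp (\<sigma> x) (u i) (v j) < N" using N by blast
        obtain k where k: "mdist (H x) (u i) (\<tau> k x) < 1" using \<tau>(2)[OF xs um[of i], of 1] by auto
        obtain l where l: "mdist (H x) (v j) (\<tau> l x) < 1" using \<tau>(2)[OF xs vm[of j], of 1] by auto
        have "gp (\<sigma> x) (\<tau> k x) (\<tau> l x) \<le> gp (\<sigma> x) (u i) (\<tau> l x) + mdist (H x) (\<tau> k x) (u i)"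
          by (rule gromov_product_change_point[OF m(2) um m(2) m(1)])
        moreover have "gp (\<sigma> x) (\<tau> l x) (u i) \<le> gp (\<sigma> x) (v j) (u i) + mdist (H x) (\<tau> l x) (v j)"
          by (rule gromov_product_change_point[OF m(2) vm um m(1)])
        ultimately have small: "gp (\<sigma> x) (\<tau> k x) (\<tau> l x) \<le> real n"
          using ij(3) k l n \<delta>_nonneg by (simp add: gromov_product_commute mdist_commute)
        have "real n + 2 * \<delta> < boundary_product (\<sigma> x) c1 (\<tau> k x)"
        proof (rule ccontr)
          assume "\<not> ?thesis"
          then have "boundary_product (\<sigma> x) c1 (\<tau> k x) < real n + 2 * \<delta> + 1" by simp
          from boundary_product_eventually_less[OF bd(1) u m(2,1) this] obtain n' where
            n': "\<And>i. i \<ge> n' \<Longrightarrow> gp (\<sigma> x) (u i) (\<tau> k x) < real n + 2 * \<delta> + 1 + \<delta>" by blast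
          have "gp (\<sigma> x) (u i) (u (max n' a)) \<le> gp (\<sigma> x) (\<tau> k x) (u (max n' a)) + mdist (H x) (u i) (\<tau> k x)"
            by (rule gromov_product_change_point[OF um m(2) um m(1)])
          then show False using n'[of "max n' a"] a[of i "max n' a"] ij k \<delta>_nonneg
            by (simp add: L_def gromov_product_commute)
        qed
        moreover have "real n + 2 * \<delta> < boundary_product (\<sigma> x) c2 (\<tau> l x)"
        proof (rule ccontr)
          assume "\<not> ?thesis"
          then have "boundary_product (\<sigma> x) c2 (\<tau> l x) < real n + 2 * \<delta> + 1" by simp
          from boundary_product_eventually_less[OF bd(2) v m(2,1) this] obtain n' where
            n': "\<And>i. i \<ge> n' \<Longrightarrow> gp (\<sigma> x) (v i) (\<tau> l x) < real n + 2 * \<delta> + 1 + \<delta>" by blast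
          have "gp (\<sigma> x) (v j) (v (max n' b)) \<le> gp (\<sigma> x) (\<tau> l x) (v (max n' b)) + mdist (H x) (v j) (\<tau> l x)"
            by (rule gromov_product_change_point[OF vm m(2) vm m(1)])
          then show False using n'[of "max n' b"] b[of j "max n' b"] ij l \<delta>_nonneg
            by (simp add: L_def gromov_product_commute)
        qed
        ultimately have "x \<in> T n"
          using small elim(1) bd c unfolding T_def P_def by blast
        then show False using elim(2) by blast
      qed
      obtain \<xi> where "\<xi> \<in> C `` {x}" using C_nonempty[OF elim(1)] by blast
      moreover from this obtain c where "\<xi> = Inr c" using C_boundary by blast
      ultimately have c: "Inr c \<in> C `` {x}" by simp
      have "C `` {x} = {Inr c}"
      proof (intro equalityI subsetI)
        fix \<eta> assume \<eta>: "\<eta> \<in> C `` {x}"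
        then obtain c' where "\<eta> = Inr c'" using C_boundary by blast
        then show "\<eta> \<in> {Inr c}" using unique[OF c] \<eta> by simp
      qed (use c in simp)
      then show ?case ..
    qed
    then show ?thesis ..
  qed
qed

text \<open>With \<open>C\<^sub>x = {\<xi>\<^sub>x}\<close> the products \<open>(y|\<xi>\<^sub>x)\<close> at \<open>\<sigma>(x)\<close> make the class a \<open>horospherical_relation\<close>. If its
hypothesis on the existence of \<open>r\<close> fails, then for almost every \<open>x\<close> every sequence of orbit points with
bounded products with \<open>\<xi>\<^sub>x\<close> stays bounded, and orbit points converging to a limit point different
from \<open>\<xi>\<^sub>x\<close> would be such a sequence.\<close>
lemma single_point_minimal_or_hyperfinite:
  assumes single: "AE x in M. \<exists>c. C `` {x} = {Inr c}"
  shows "(AE x in M. limit_set R H \<alpha> \<sigma> x \<subseteq> C `` {x}) \<or> hyperfinite M R"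
proof -
  obtain Y where Y_sets [measurable]: "Y \<in> sets M" and Y: "Y \<subseteq> X" "AE x in M. x \<in> Y"
    "\<And>x y. x \<in> Y \<Longrightarrow> (x, y) \<in> R \<Longrightarrow> y \<in> Y" "\<And>x. x \<in> Y \<Longrightarrow> \<exists>c. C `` {x} = {Inr c}"
    by (rule conull_saturated_subset[OF single]) (rule that)
  define c where "c x = (SOME c. C `` {x} = {Inr c})" for x
  have c: "C `` {x} = {Inr (c x)}" if "x \<in> Y" for x unfolding c_def by (rule someI_ex[OF Y(4)[OF that]])
  have c_bd: "c x \<in> gromov_boundary (H x)" if "x \<in> Y" for x using C_boundary[of "Inr (c x)" x] c[OF that] by auto
  define v where "v j x = (if x \<in> Y then hyperbolic_metric.boundary_product (H x) (\<sigma> x) (c x) (s j x) else 0)" for j x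
  have v_meas: "v j \<in> borel_measurable (completion M)" for j
  proof (rule measurableI)
    fix V :: "real set" assume V: "V \<in> sets borel"
    let ?P = "{x. \<exists>c. c \<in> gromov_boundary (H x) \<and> (x, Inr c) \<in> C \<and> hyperbolic_metric.boundary_product (H x) (\<sigma> x) c (s j x) \<in> V}"
    have "v j -` V \<inter> space (completion M) = (Y \<inter> ?P) \<union> (if 0 \<in> V then space M - Y else {})"
    proof (rule set_eqI)
      fix x
      show "x \<in> v j -` V \<inter> space (completion M) \<longleftrightarrow> x \<in> (Y \<inter> ?P) \<union> (if 0 \<in> V then space M - Y else {})"
      proof (cases "x \<in> Y")
        case True
        have "(x, Inr c') \<in> C \<longleftrightarrow> c' = c x" for c' using c[OF True] by auto
        then have "x \<in> ?P \<longleftrightarrow> hyperbolic_metric.boundary_product (H x) (\<sigma> x) (c x) (s j x) \<in> V"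
          using c_bd[OF True] by auto
        then show ?thesis using True X_space Y(1) by (auto simp: v_def)
      qed (auto simp: v_def)
    qed
    also have "\<dots> \<in> sets (completion M)"
    proof -
      have Y': "Y \<in> sets (completion M)" "space M - Y \<in> sets (completion M)"
        by (intro sets_completionI_sets; simp)+
      have "Y \<inter> ?P \<in> sets (completion M)"
        by (rule sets.Int[OF Y'(1) C_product_sets[OF s_section V]])
      then show ?thesis using sets.Un[OF _ Y'(2)] by (cases "0 \<in> V") (simp_all only: if_True if_False Un_empty_right)
    qed
    finally show "v j -` V \<inter> space (completion M) \<in> sets (completion M)" .
  qed simp
  have "\<exists>e\<in>borel_measurable M. AE x in M. v j x = e x" for j
    using completion_ex_borel_measurable_real[OF v_meas[of j]] by blast
  then obtain e where e: "\<And>j. e j \<in> borel_measurable M" "\<And>j. AE x in M. v j x = e j x" by metis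
  have "AE x in M. x \<in> Y \<and> (\<forall>j. v j x = e j x)" using Y(2) e(2) by (simp add: AE_all_countable)
  then obtain Z where Z_sets: "Z \<in> sets M" and Z: "Z \<subseteq> X" "AE x in M. x \<in> Z"
    "\<And>x y. x \<in> Z \<Longrightarrow> (x, y) \<in> R \<Longrightarrow> y \<in> Z" "\<And>x. x \<in> Z \<Longrightarrow> x \<in> Y \<and> (\<forall>j. v j x = e j x)"
    by (rule conull_saturated_subset) (rule that)
  have ZE: "enumerated_relation M R Z h U" by (rule restrict_enumeration[OF Z_sets Z(1-3)])
  interpret Z: enumerated_relation M R Z h U by (rule ZE)
  define K where "K w y = hyperbolic_metric.boundary_product (H w) (\<sigma> w) (c w) (orbit_point w y)" for w y
  define G where "G w y = (if w \<in> Z \<and> (w, y) \<in> R then K w y else 0)" for w y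
  define d' where "d' x y = (if x \<in> Z \<and> (x, y) \<in> R then orbit_dist x y else 0)" for x y
  have ZX: "x \<in> X" if "x \<in> Z" for x using Z(1) that by auto
  have ZY: "x \<in> Y" if "x \<in> Z" for x using Z(4) that by auto
  have G_meas: "(\<lambda>(x, y). G x y) \<in> borel_measurable (M \<Otimes>\<^sub>M M)"
    unfolding G_def
  proof (rule Z.class_function_measurable[OF e(1)])
    fix j x assume x: "x \<in> Z"
    have "K x (h j x) = v j x" using ZY[OF x] by (simp add: K_def v_def s_eq[OF ZX[OF x], symmetric])
    then show "K x (h j x) = e j x" using Z(4)[OF x] by simp
  qed
  have d'_meas: "(\<lambda>(x, y). d' x y) \<in> borel_measurable (M \<Otimes>\<^sub>M M)"
    unfolding d'_def
    by (rule Z.class_function_measurable[where e = "\<lambda>j x. mdist (H x) (\<sigma> x) (s j x)"])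
      (auto simp: orbit_dist_def s_eq ZX intro: mdist_section_measurable \<sigma>_section s_section)
  have d'_eq: "d' x y = orbit_dist x y" if "x \<in> Z" "(x, y) \<in> R" for x y using that by (simp add: d'_def)
  have G_eq: "G x y = K x y" if "x \<in> Z" "(x, y) \<in> R" for x y using that by (simp add: G_def)
  have c_move: "(\<lambda>s. \<alpha> x y \<circ> s) ` c y = c x" if "x \<in> Z" "(x, y) \<in> R" for x y
  proof -
    have "Inr ((\<lambda>s. \<alpha> x y \<circ> s) ` c y) \<in> C `` {x}"
      using C_transport[OF ZX[OF that(1)] that(2), of "c y"] c[OF ZY[OF Z(3)[OF that]]] by simp
    then show ?thesis using c[OF ZY[OF that(1)]] by simp
  qed
  \<comment> \<open>The product based at \<open>y\<close>, computed in the fibre over \<open>x\<close>.\<close>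
  have K_move: "K y x = hyperbolic_metric.boundary_product (H x) (orbit_point x y) (c x) (\<sigma> x)" if x: "x \<in> Z" and xy: "(x, y) \<in> R" for x y
  proof -
    have yZ: "y \<in> Z" by (rule Z(3)[OF x xy])
    have yx: "(y, x) \<in> R" by (rule R_sym[OF xy])
    interpret Hx: hyperbolic_metric "H x" \<delta> by (rule X_hyperbolic[OF ZX[OF x]])
    interpret Hy: hyperbolic_metric "H y" \<delta> by (rule X_hyperbolic[OF ZX[OF yZ]])
    have "gromov_product_ext (H x) (\<alpha> x y (\<sigma> y)) (Inr ((\<lambda>s. \<alpha> x y \<circ> s) ` c y)) (Inl (\<alpha> x y (orbit_point y x))) =
      gromov_product_ext (H y) (\<sigma> y) (Inr (c y)) (Inl (orbit_point y x))"
      using \<alpha>_isometry[OF xy] c_bd[OF ZY[OF yZ]] \<sigma>_fibre[OF X_space[OF ZX[OF yZ]]] orbit_point_fibre[OF yx]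
      by (rule Hy.ext_isometry)
    moreover have "\<alpha> x y (orbit_point y x) = \<sigma> x" using orbit_point_move[OF xy yx] orbit_point_self[OF X_space[OF ZX[OF x]]] by simp
    ultimately show ?thesis
      using c_move[OF x xy] by (simp add: K_def Hx.boundary_product_def Hy.boundary_product_def orbit_point_def)
  qed
  interpret P: horospherical_relation M R Z h U d' G "2 * \<delta>"
  proof
    show "(\<lambda>(x, y). d' x y) \<in> borel_measurable (M \<Otimes>\<^sub>M M)" by (rule d'_meas)
    show "(\<lambda>(x, y). G x y) \<in> borel_measurable (M \<Otimes>\<^sub>M M)" by (rule G_meas)
    have "\<exists>x. x \<in> Z"
    proof (rule ccontr)
      assume "\<not> ?thesis"
      then have "AE x in M. False" using Z(2) by simp
      then show False by simp
    qed
    then obtain x0 where "x0 \<in> Z" ..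
    then show "0 \<le> 2 * \<delta>" using hyperbolic_metric.\<delta>_nonneg[OF X_hyperbolic[OF ZX]] by simp
    fix x assume x: "x \<in> Z"
    note xX = ZX[OF x]
    have xs: "x \<in> space M" using X_space[OF xX] .
    interpret Hx: hyperbolic_metric "H x" \<delta> by (rule X_hyperbolic[OF xX])
    show "finite {y \<in> R `` {x}. d' x y \<le> r}" for r
    proof -
      have "{y \<in> R `` {x}. d' x y \<le> r} = {y \<in> R `` {x}. orbit_dist x y \<le> r}" using d'_eq[OF x] by auto
      then show ?thesis using X_proper[OF xX] by (simp add: proper_at_def)
    qed
    show "d' x x = 0" using d'_eq[OF x R_refl[OF xs]] orbit_point_self[OF xs] \<sigma>_fibre[OF xs] by (simp add: orbit_dist_def)
    fix y assume xy: "(x, y) \<in> R"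
    have yZ: "y \<in> Z" by (rule Z(3)[OF x xy])
    have yx: "(y, x) \<in> R" by (rule R_sym[OF xy])
    show "0 \<le> d' x y" using d'_eq[OF x xy] by (simp add: orbit_dist_def)
    show "d' x y = d' y x" using d'_eq[OF x xy] d'_eq[OF yZ yx] orbit_dist_sym[OF xy] by simp
    show "d' x y - 2 * \<delta> \<le> G x y + G y x"
      using Hx.boundary_product_opposite[OF c_bd[OF ZY[OF x]] \<sigma>_fibre[OF xs] orbit_point_fibre[OF xy]]
      by (simp add: d'_eq[OF x xy] G_eq[OF x xy] G_eq[OF yZ yx] K_move[OF x xy] orbit_dist_def) (simp add: K_def)
    fix z assume xz: "(x, z) \<in> R"
    have zZ: "z \<in> Z" by (rule Z(3)[OF x xz])
    have yz: "(y, z) \<in> R" by (rule R_trans[OF yx xz])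
    have zx: "(z, x) \<in> R" by (rule R_sym[OF xz])
    show "d' x z \<le> d' x y + d' y z"
      using orbit_dist_triangle[OF xy xz] d'_eq[OF x xy] d'_eq[OF x xz] d'_eq[OF yZ yz] by simp
    have to_base: "mdist (H x) (orbit_point x y) (\<sigma> x) = d' y x" if "y \<in> Z" "(x, y) \<in> R" for y
      using d'_eq[OF that(1) R_sym[OF that(2)]] orbit_dist_sym[OF that(2)] mdist_commute[of "H x" "orbit_point x y" "\<sigma> x"]
      by (simp add: orbit_dist_def)
    have "gromov_product (H x) (\<sigma> x) (orbit_point x y) (orbit_point x z) = (d' y x + d' z x - d' y z) / 2"
      unfolding gromov_product_def to_base[OF yZ xy] to_base[OF zZ xz] mdist_orbit_point[OF xy xz] d'_eq[OF yZ yz] ..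
    then show "G x y \<le> G x z + 2 * \<delta> \<or> d' y x + d' z x - d' y z \<le> 2 * (G x z + 2 * \<delta>)"
      using Hx.boundary_product_hyperbolic[OF c_bd[OF ZY[OF x]] \<sigma>_fibre[OF xs] orbit_point_fibre[OF xy] orbit_point_fibre[OF xz]]
      by (auto simp: G_eq[OF x xy] G_eq[OF x xz] K_def)
  qed
  show ?thesis
  proof (cases "\<exists>r. \<not> (AE x in M. \<not> (\<forall>b. \<exists>y\<in>R `` {x}. G x y \<le> r \<and> d' x y > b))")
    case True
    then show ?thesis using P.horospherical_hyperfinite[OF R_ergodic] by blast
  next
    case False
    then have "AE x in M. \<forall>n::nat. \<not> (\<forall>b. \<exists>y\<in>R `` {x}. G x y \<le> real n \<and> d' x y > b)"
      unfolding AE_all_countable by blast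
    with Z(2) have "AE x in M. limit_set R H \<alpha> \<sigma> x \<subseteq> C `` {x}"
    proof eventually_elim
      case (elim x)
      note x = elim(1) and xX = ZX[OF elim(1)]
      have xs: "x \<in> space M" using X_space[OF xX] .
      interpret Hx: hyperbolic_metric "H x" \<delta> by (rule X_hyperbolic[OF xX])
      note o = \<sigma>_fibre[OF xs] and cb = c_bd[OF ZY[OF x]]
      show ?case
      proof
        fix \<zeta> assume "\<zeta> \<in> limit_set R H \<alpha> \<sigma> x"
        then obtain c' where c': "\<zeta> = Inr c'" "c' \<in> gromov_boundary (H x)"
          "\<And>z r. z \<in> mspace (H x) \<Longrightarrow> \<exists>y\<in>R `` {x}. r < Hx.boundary_product z c' (orbit_point x y)"
          by (rule limit_point_approached[OF xX]) (rule that)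
        show "\<zeta> \<in> C `` {x}"
        proof (rule ccontr)
          assume "\<zeta> \<notin> C `` {x}"
          then obtain r where r: "\<And>\<eta>. \<eta> \<in> C `` {x} \<Longrightarrow> Hx.ext (\<sigma> x) (Inr c') \<eta> \<le> ereal r"
            using Hx.closed_set_separated[OF C_closed[OF xX] c'(2) _ o] c'(1) by blast
          have "Hx.ext (\<sigma> x) (Inr c') (Inr (c x)) \<le> ereal r" using r c[OF ZY[OF x]] by simp
          then have less: "Hx.ext (\<sigma> x) (Inr c') (Inr (c x)) < ereal (r + 1)" by (rule le_less_trans) simp
          obtain s' t where s': "s' \<in> c'" and t: "t \<in> c x" using Hx.boundary_nonempty c'(2) cb by blast
          obtain n where n: "\<And>i j. i \<ge> n \<Longrightarrow> j \<ge> n \<Longrightarrow> Hx.gp (\<sigma> x) (s' i) (t j) < r + 1 + 2 * \<delta>"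
            using Hx.ext_boundary_lessD[OF c'(2) cb o less s' t] by blast
          obtain m :: nat where m: "r + 1 + 3 * \<delta> \<le> real m" using real_arch_simple by blast
          obtain b where b: "\<forall>y\<in>R `` {x}. G x y \<le> real m \<longrightarrow> d' x y \<le> b"
            using spec[OF elim(2), of m] by (auto simp: not_less)
          obtain y where y: "(x, y) \<in> R" "max b (r + 1 + 3 * \<delta>) < Hx.boundary_product (\<sigma> x) c' (orbit_point x y)"
            using c'(3)[OF o] by blast
          note p = orbit_point_fibre[OF y(1)]
          have "Hx.boundary_product (\<sigma> x) (c x) (orbit_point x y) \<le> real m"
          proof (rule ccontr)
            assume "\<not> ?thesis"
            then have big: "r + 1 + 3 * \<delta> < Hx.boundary_product (\<sigma> x) (c x) (orbit_point x y)" using m by simp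
            obtain n1 where n1: "\<And>i. i \<ge> n1 \<Longrightarrow> r + 1 + 3 * \<delta> < Hx.gp (\<sigma> x) (t i) (orbit_point x y)"
              using Hx.boundary_product_eventually_greater[OF cb t p o big] by blast
            obtain n2 where n2: "\<And>i. i \<ge> n2 \<Longrightarrow> r + 1 + 3 * \<delta> < Hx.gp (\<sigma> x) (s' i) (orbit_point x y)"
              using Hx.boundary_product_eventually_greater[OF c'(2) s' p o, of "r + 1 + 3 * \<delta>"] y(2) by auto
            define k where "k = max n (max n1 n2)"
            have "Hx.gp (\<sigma> x) (s' k) (t k) < r + 1 + 2 * \<delta>" "r + 1 + 3 * \<delta> < Hx.gp (\<sigma> x) (t k) (orbit_point x y)"
              "r + 1 + 3 * \<delta> < Hx.gp (\<sigma> x) (s' k) (orbit_point x y)"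
              using n[of k k] n1[of k] n2[of k] by (simp_all add: k_def)
            then show False
              using Hx.hyperbolic[OF Hx.boundary_seq(3)[OF c'(2) s', of k] Hx.boundary_seq(3)[OF cb t, of k] o p]
              unfolding gromov_product_commute[of _ _ "orbit_point x y"] by auto
          qed
          then have "G x y \<le> real m" using G_eq[OF x y(1)] by (simp add: K_def)
          then have "d' x y \<le> b" using b y(1) by blast
          then have "orbit_dist x y \<le> b" using d'_eq[OF x y(1)] by simp
          moreover have "Hx.boundary_product (\<sigma> x) c' (orbit_point x y) \<le> orbit_dist x y"
            using Hx.ext_point_le[OF c'(2) p o] Hx.ext_boundary_product[OF c'(2) p o] by (simp add: orbit_dist_def mdist_commute)
          ultimately show False using y(2) by simp
        qed
      qed
    qed
    then show ?thesis ..
  qed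
qed

end

theorem theorem2p9:
  fixes M :: "'x measure" and R :: "('x \<times> 'x) set"
    and B :: "'h measure" and \<pi> :: "'h \<Rightarrow> 'x" and H :: "'x \<Rightarrow> 'h metric"
    and \<alpha> :: "'x \<Rightarrow> 'x \<Rightarrow> 'h \<Rightarrow> 'h" and \<sigma> :: "'x \<Rightarrow> 'h"
    and C :: "('x \<times> 'h gpoint) set"
  assumes "main_assumption M R B \<pi> H \<alpha> \<sigma>"
    and "\<not> hyperfinite M R"
    and "C \<in> sets (completion_bundle M B \<pi> H)"
    and "C \<subseteq> (SIGMA x:space M. limit_set R H \<alpha> \<sigma> x)"
    and "AE x in M. closedin (gromov_topology (H x)) (C `` {x})"
    and "AE (x, y) in relation_measure M R. extend_isometry (\<alpha> x y) ` (C `` {y}) = C `` {x}"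
    and "AE x in M. C `` {x} \<noteq> {}"
  shows "AE x in M. limit_set R H \<alpha> \<sigma> x \<subseteq> C `` {x}"
proof -
  interpret hyperbolic_action M R B \<pi> H \<alpha> \<sigma> by unfold_locales fact
  obtain X h U where E: "enumerated_relation M R X h U" and X_proper: "\<And>x. x \<in> X \<Longrightarrow> proper_at x"
    by (rule enumeration) (rule that)
  interpret E: enumerated_relation M R X h U by (rule E)
  obtain \<delta> where \<delta>: "AE x in M. hyperbolic_metric (H x) \<delta>" by (rule uniform_hyperbolicity[OF E]) (rule that)
  have "\<exists>s. borel_section M B \<pi> s \<and> (AE x in M. s x = orbit_point x (h j x))" for j
    using orbit_section[OF E.h_measurable E.h_R] by metis
  then obtain s where s: "\<And>j. borel_section M B \<pi> (s j)" "\<And>j. AE x in M. s j x = orbit_point x (h j x)" by metis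
  have s': "AE x in M. \<forall>j. s j x = orbit_point x (h j x)" using s(2) by (simp add: AE_all_countable)
  have equi: "AE x in M. \<forall>y\<in>R `` {x}. extend_isometry (\<alpha> x y) ` (C `` {y}) = C `` {x}"
    by (rule E.AE_relation_measure[OF assms(6)])
  have "AE x in M. hyperbolic_metric (H x) \<delta> \<and> (\<forall>j. s j x = orbit_point x (h j x)) \<and>
    closedin (gromov_topology (H x)) (C `` {x}) \<and>
    (\<forall>y\<in>R `` {x}. extend_isometry (\<alpha> x y) ` (C `` {y}) = C `` {x}) \<and> C `` {x} \<noteq> {}"
    using \<delta> s' assms(5) equi assms(7) by eventually_elim blast
  then obtain Y where Y_sets: "Y \<in> sets M" and Y: "Y \<subseteq> X" "AE x in M. x \<in> Y"
    "\<And>x y. x \<in> Y \<Longrightarrow> (x, y) \<in> R \<Longrightarrow> y \<in> Y" and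
    good: "\<And>x. x \<in> Y \<Longrightarrow> hyperbolic_metric (H x) \<delta> \<and> (\<forall>j. s j x = orbit_point x (h j x)) \<and>
    closedin (gromov_topology (H x)) (C `` {x}) \<and>
    (\<forall>y\<in>R `` {x}. extend_isometry (\<alpha> x y) ` (C `` {y}) = C `` {x}) \<and> C `` {x} \<noteq> {}"
    by (rule E.conull_saturated_subset) (rule that)
  have "enumerated_relation M R Y h U" by (rule E.restrict_enumeration[OF Y_sets Y(1-3)])
  then interpret invariant_limit_subset M R B \<pi> H \<alpha> \<sigma> Y h U C s \<delta>
    using s(1) good Y(1) X_proper assms(3,4)
    by (intro invariant_limit_subset.intro invariant_limit_subset_axioms.intro) (auto intro: hyperbolic_action_axioms)
  show ?thesis
    using minimal_or_single_point single_point_minimal_or_hyperfinite assms(2) by blast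
qed

end
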